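(* Let $(A,\phi)$ be a connection on the principal frame bundle $\mathcal{F}_{GL}$ of a connected smooth manifold $M$, let $u_0\in\mathcal{F}_{GL}$, let $H=Hol(A,u_0)$ be its holonomy group, and let $P\to M$ be the holonomy bundle of $u_0$, a principal $H$-bundle to which $(A,\phi)$ reduces. Let $\rho:H\to\mathrm{Aut}(V)$ be a representation of $H$ on a finite-dimensional vector space $V$ and let $E=(P\times V)/\sim$ be the associated vector bundle with the covariant derivative $\nabla$ induced by $(A,\phi)$. Then there exists a one-to-one correspondence between elements of $V$ that are invariant under the action of $H$ and sections of $E$ that are parallel with respect to the connection $(A,\phi)$.
   Context: $\mathcal{F}_{GL}$ is the principal $GL(n,\mathbb{R})$-bundle of all bases of tangent spaces of $M$, where $n=\dim M$. A connection on a principal bundle with structure group $G$ is a smooth $G$-invariant distribution $A$ complementary to the vertical spaces; its connection form $\phi$ is the $\mathfrak{g}$-valued $1$-form vanishing on $A$ with $\phi(X^* )=X$, where $X^*_u=\frac{d}{dt}(u\exp(tX))|_{t=0}$ for $X\in\mathfrak{g}$, the Lie algebra of $G$. A curve is horizontal if tangent to $A$. $Hol(A,u_0)$ is the group of $g\in G$ such that $u_0g$ is the endpoint of the horizontal lift starting at $u_0$ of some piecewise smooth loop in $M$ based at $\pi(u_0)$, where $\pi$ is the bundle projection. The holonomy bundle $P$ is the set of points that can be joined to $u_0$ by a piecewise smooth horizontal curve; it is a principal subbundle with structure group $H$, and $A$ is tangent to it, so it restricts to a connection on $P$ whose connection form takes values in the Lie algebra $\mathfrak{h}$ of $H$. $E=(P\times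 V)/\sim$ where $(p,v)\sim(ph,\rho(h)^{-1}v)$ for $h\in H$. An element $v\in V$ is invariant if $\rho(h)v=v$ for all $h\in H$. Sections $\sigma$ of $E$ correspond bijectively to smooth functions $f:P\to V$ with $f(ph)=\rho(h)^{-1}f(p)$, via $\sigma(\pi(p))=[p,f(p)]$. The covariant derivative $\nabla\sigma$ corresponds to the horizontal equivariant $V$-valued $1$-form $Df=df+\rho_*(\phi)f$ on $P$, where $\rho_*:\mathfrak{h}\to\mathrm{End}(V)$ is the induced Lie algebra map; $\sigma$ is parallel if $\nabla\sigma=0$, i.e. $Df=0$. *)

theory Defs
  imports "HOL-Analysis.Analysis"
begin

section \<open>Smooth maps between normed spaces\<close>

primrec Ck_on :: "nat \<Rightarrow> 'a::real_normed_vector set \<Rightarrow> ('a \<Rightarrow> 'b::real_normed_vector) \<Rightarrow> bool" where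
  "Ck_on 0 U f \<longleftrightarrow> continuous_on U f"
| "Ck_on (Suc k) U f \<longleftrightarrow>
     (\<forall>x\<in>U. f differentiable (at x)) \<and> (\<forall>v. Ck_on k U (\<lambda>x. frechet_derivative f (at x) v))"

text \<open>Used only for open \<open>U\<close> in finite-dimensional spaces, where testing the derivative on
  each fixed vector \<open>v\<close> gives the usual class of infinitely differentiable maps.\<close>

definition smooth_on :: "'a::real_normed_vector set \<Rightarrow> ('a \<Rightarrow> 'b::real_normed_vector) \<Rightarrow> bool" where
  "smooth_on U f \<longleftrightarrow> (\<forall>k. Ck_on k U f)"


section \<open>Manifolds given by atlases\<close>

text \<open>A chart is a domain together with a map that is meaningful on that domain only.
  The model space is a finite-dimensional normed space rather than a \<open>euclidean_space\<close>,
  so that dimension 0 is allowed (discrete holonomy groups occur for flat connections).\<close>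

type_synonym ('a, 'e) chart = "'a set \<times> ('a \<Rightarrow> 'e)"
type_synonym ('a, 'e) atlas = "('a, 'e) chart set"

definition chart_inv :: "('a, 'e) chart \<Rightarrow> 'e \<Rightarrow> 'a" where
  "chart_inv c = inv_into (fst c) (snd c)"

definition points :: "('a, 'e) atlas \<Rightarrow> 'a set" where
  "points A = (\<Union>c\<in>A. fst c)"

definition manifold_topology :: "('a, 'e::topological_space) atlas \<Rightarrow> 'a topology" where
  "manifold_topology A =
     topology (\<lambda>U. U \<subseteq> points A \<and> (\<forall>c\<in>A. open (snd c ` (U \<inter> fst c))))"

definition smooth_manifold :: "('a, 'e::real_normed_vector) atlas \<Rightarrow> bool" where
  "smooth_manifold A \<longleftrightarrow>
     (\<exists>B::'e set. finite B \<and> span B = UNIV) \<and>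
     (\<forall>c\<in>A. inj_on (snd c) (fst c) \<and> open (snd c ` fst c)) \<and>
     (\<forall>c\<in>A. \<forall>c'\<in>A. open (snd c ` (fst c \<inter> fst c')) \<and>
        smooth_on (snd c ` (fst c \<inter> fst c')) (snd c' \<circ> chart_inv c)) \<and>
     Hausdorff_space (manifold_topology A) \<and> second_countable (manifold_topology A)"

text \<open>The predicate passed to \<open>topology\<close> is a topology as soon as the charts are injective
  with open image.\<close>

lemma openin_manifold_topology:
  assumes "\<And>c. c \<in> A \<Longrightarrow> inj_on (snd c) (fst c)"
  shows "openin (manifold_topology A) U \<longleftrightarrow>
           U \<subseteq> points A \<and> (\<forall>c\<in>A. open (snd c ` (U \<inter> fst c)))"
proof -
  have "istopology (\<lambda>U. U \<subseteq> points A \<and> (\<forall>c\<in>A. open (snd c ` (U \<inter> fst c))))"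
    unfolding istopology_def
  proof (intro conjI allI impI ballI)
    fix S T c
    assume S: "S \<subseteq> points A \<and> (\<forall>c\<in>A. open (snd c ` (S \<inter> fst c)))"
      and T: "T \<subseteq> points A \<and> (\<forall>c\<in>A. open (snd c ` (T \<inter> fst c)))" and c: "c \<in> A"
    have "snd c ` (S \<inter> T \<inter> fst c) = snd c ` ((S \<inter> fst c) \<inter> (T \<inter> fst c))"
      by (rule arg_cong[where f = "image (snd c)"]) auto
    also have "\<dots> = snd c ` (S \<inter> fst c) \<inter> snd c ` (T \<inter> fst c)"
      using assms[OF c] by (intro inj_on_image_Int) auto
    finally show "open (snd c ` (S \<inter> T \<inter> fst c))"
      using S T c by (simp add: open_Int)
  next
    fix \<K> c
    assume K: "\<forall>K\<in>\<K>. K \<subseteq> points A \<and> (\<forall>c\<in>A. open (snd c ` (K \<inter> fst c)))" and c: "c \<in> A"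
    have "snd c ` (\<Union>\<K> \<inter> fst c) = (\<Union>K\<in>\<K>. snd c ` (K \<inter> fst c))" by auto
    then show "open (snd c ` (\<Union>\<K> \<inter> fst c))" using K c by auto
  qed auto
  then show ?thesis by (simp add: manifold_topology_def)
qed

definition smooth_map ::
  "('a, 'e::real_normed_vector) atlas \<Rightarrow> ('b, 'd::real_normed_vector) atlas \<Rightarrow> ('a \<Rightarrow> 'b) \<Rightarrow> bool" where
  "smooth_map A B F \<longleftrightarrow>
     (\<forall>x\<in>points A. \<exists>c\<in>A. \<exists>c'\<in>B. \<exists>W. openin (manifold_topology A) W \<and> x \<in> W \<and> W \<subseteq> fst c \<and>
        F ` W \<subseteq> fst c' \<and> smooth_on (snd c ` W) (snd c' \<circ> F \<circ> chart_inv c))"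

text \<open>The standard smooth structure on an open subset of a normed space.\<close>

definition std_atlas :: "'e set \<Rightarrow> ('e, 'e) atlas" where
  "std_atlas U = {(U, \<lambda>x. x)}"

definition restrict_atlas :: "('a, 'e) atlas \<Rightarrow> 'a set \<Rightarrow> ('a, 'e) atlas" where
  "restrict_atlas A U = (\<lambda>c. (fst c \<inter> U, snd c)) ` A"

definition prod_atlas :: "('a, 'e) atlas \<Rightarrow> ('b, 'd) atlas \<Rightarrow> ('a \<times> 'b, 'e \<times> 'd) atlas" where
  "prod_atlas A B = {(fst c \<times> fst c', map_prod (snd c) (snd c')) | c c'. c \<in> A \<and> c' \<in> B}"

definition diffeomorphism ::
  "('a, 'e::real_normed_vector) atlas \<Rightarrow> ('b, 'd::real_normed_vector) atlas \<Rightarrow> ('a \<Rightarrow> 'b) \<Rightarrow> bool" where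
  "diffeomorphism A B F \<longleftrightarrow> bij_betw F (points A) (points B) \<and>
     smooth_map A B F \<and> smooth_map B A (inv_into (points A) F)"


section \<open>Tangent vectors\<close>

text \<open>A tangent vector at \<open>x\<close> is the family of its components in all charts around \<open>x\<close>,
  related by the transition derivatives; it is \<open>0\<close> at all other charts. Vector space
  operations on tangent vectors are pointwise.\<close>

type_synonym ('a, 'e) tangent = "('a, 'e) chart \<Rightarrow> 'e"

definition tangent_space :: "('a, 'e::real_normed_vector) atlas \<Rightarrow> 'a \<Rightarrow> ('a, 'e) tangent set" where
  "tangent_space A x =
     {\<tau>. (\<forall>c\<in>A. \<forall>c'\<in>A. x \<in> fst c \<longrightarrow> x \<in> fst c' \<longrightarrow>
            \<tau> c' = frechet_derivative (snd c' \<circ> chart_inv c) (at (snd c x)) (\<tau> c)) \<and>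
         (\<forall>c. \<not> (c \<in> A \<and> x \<in> fst c) \<longrightarrow> \<tau> c = 0)}"

text \<open>On tangent vectors the following differentials do not depend on the chart selected.\<close>

definition chart_at :: "('a, 'e) atlas \<Rightarrow> 'a \<Rightarrow> ('a, 'e) chart" where
  "chart_at A x = (SOME c. c \<in> A \<and> x \<in> fst c)"

definition tangent_map ::
  "('a, 'e::real_normed_vector) atlas \<Rightarrow> ('b, 'd::real_normed_vector) atlas \<Rightarrow> ('a \<Rightarrow> 'b) \<Rightarrow>
     'a \<Rightarrow> ('a, 'e) tangent \<Rightarrow> ('b, 'd) tangent" where
  "tangent_map A B F x \<tau> = (\<lambda>c'. if c' \<in> B \<and> F x \<in> fst c' then
       frechet_derivative (snd c' \<circ> F \<circ> chart_inv (chart_at A x)) (at (snd (chart_at A x) x))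
         (\<tau> (chart_at A x))
     else 0)"

definition differential ::
  "('a, 'e::real_normed_vector) atlas \<Rightarrow> ('a \<Rightarrow> 'w::real_normed_vector) \<Rightarrow>
     'a \<Rightarrow> ('a, 'e) tangent \<Rightarrow> 'w" where
  "differential A f x \<tau> =
     frechet_derivative (f \<circ> chart_inv (chart_at A x)) (at (snd (chart_at A x) x)) (\<tau> (chart_at A x))"

definition velocity ::
  "('a, 'e::real_normed_vector) atlas \<Rightarrow> (real \<Rightarrow> 'a) \<Rightarrow> real set \<Rightarrow> real \<Rightarrow> ('a, 'e) tangent" where
  "velocity A \<gamma> I t = (\<lambda>c. if c \<in> A \<and> \<gamma> t \<in> fst c then
       vector_derivative (snd c \<circ> \<gamma>) (at t within I) else 0)"

definition smooth_vector_field_on ::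
  "('a, 'e::real_normed_vector) atlas \<Rightarrow> 'a set \<Rightarrow> ('a \<Rightarrow> ('a, 'e) tangent) \<Rightarrow> bool" where
  "smooth_vector_field_on A W X \<longleftrightarrow> (\<forall>x\<in>W. X x \<in> tangent_space A x) \<and>
     (\<forall>c\<in>A. smooth_on (snd c ` (W \<inter> fst c)) (\<lambda>z. X (chart_inv c z) c))"


section \<open>The frame bundle\<close>

type_synonym ('m, 'n) frame = "'m \<times> ('n \<Rightarrow> ('m, real^'n) tangent)"

definition frame_bundle :: "('m, real^'n) atlas \<Rightarrow> ('m, 'n::finite) frame set" where
  "frame_bundle M = {(x, u). x \<in> points M \<and> (\<forall>i. u i \<in> tangent_space M x) \<and>
     (\<forall>\<tau>\<in>tangent_space M x. \<exists>!a::real^'n. \<tau> = (\<lambda>c. \<Sum>i\<in>UNIV. a $ i *\<^sub>R u i c))}"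

definition frame_act :: "('m, 'n::finite) frame \<Rightarrow> real^'n^'n \<Rightarrow> ('m, 'n) frame" where
  "frame_act p g = (fst p, \<lambda>j c. \<Sum>i\<in>UNIV. g $ i $ j *\<^sub>R snd p i c)"

text \<open>In a chart of the base, a frame is the matrix whose columns are its members.\<close>

definition frame_atlas ::
  "('m, real^'n) atlas \<Rightarrow> (('m, 'n::finite) frame, (real^'n) \<times> (real^'n^'n)) atlas" where
  "frame_atlas M =
     (\<lambda>c. ({p \<in> frame_bundle M. fst p \<in> fst c},
           \<lambda>p. (snd c (fst p), \<chi> i j. snd p j c $ i))) ` M"

type_synonym ('m, 'n) frame_tangent = "(('m, 'n) frame, (real^'n) \<times> (real^'n^'n)) tangent"

abbreviation frame_tangent_space ::
  "('m, real^'n) atlas \<Rightarrow> ('m, 'n::finite) frame \<Rightarrow> ('m, 'n) frame_tangent set" where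
  "frame_tangent_space M \<equiv> tangent_space (frame_atlas M)"

definition vertical_space ::
  "('m, real^'n) atlas \<Rightarrow> ('m, 'n::finite) frame \<Rightarrow> ('m, 'n) frame_tangent set" where
  "vertical_space M u =
     {\<xi> \<in> frame_tangent_space M u. tangent_map (frame_atlas M) M fst u \<xi> = (\<lambda>c. 0)}"

definition matrix_exp :: "real^'n^'n \<Rightarrow> real^'n^'n" where
  "matrix_exp X = (\<Sum>k. (1 / fact k) *\<^sub>R (((**) X ^^ k) (mat 1)))"

definition fundamental_vector ::
  "('m, real^'n) atlas \<Rightarrow> real^'n^'n \<Rightarrow> ('m, 'n::finite) frame \<Rightarrow> ('m, 'n) frame_tangent" where
  "fundamental_vector M X u =
     velocity (frame_atlas M) (\<lambda>t. frame_act u (matrix_exp (t *\<^sub>R X))) UNIV 0"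


section \<open>Connections and holonomy\<close>

type_synonym ('m, 'n) distribution = "('m, 'n) frame \<Rightarrow> ('m, 'n) frame_tangent set"

text \<open>In the last clause the number of local spanning fields is the dimension of the base,
  which is the rank of any distribution complementary to the vertical spaces.\<close>

definition is_connection :: "('m, real^'n) atlas \<Rightarrow> ('m, 'n::finite) distribution \<Rightarrow> bool" where
  "is_connection M A \<longleftrightarrow>
     (\<forall>u\<in>frame_bundle M.
        A u \<subseteq> frame_tangent_space M u \<and> (\<lambda>c. 0) \<in> A u \<and>
        (\<forall>\<xi>\<in>A u. \<forall>\<eta>\<in>A u. \<forall>a b. (\<lambda>c. a *\<^sub>R \<xi> c + b *\<^sub>R \<eta> c) \<in> A u) \<and>
        (\<forall>\<xi>\<in>frame_tangent_space M u.
           \<exists>!(\<eta>, \<zeta>). \<eta> \<in> A u \<and> \<zeta> \<in> vertical_space M u \<and> \<xi> = (\<lambda>c. \<eta> c + \<zeta> c))) \<and>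
     (\<forall>u\<in>frame_bundle M. \<forall>g. invertible g \<longrightarrow>
        tangent_map (frame_atlas M) (frame_atlas M) (\<lambda>p. frame_act p g) u ` A u = A (frame_act u g)) \<and>
     (\<forall>u\<in>frame_bundle M. \<exists>W X. openin (manifold_topology (frame_atlas M)) W \<and> u \<in> W \<and>
        (\<forall>i::'n. smooth_vector_field_on (frame_atlas M) W (X i)) \<and>
        (\<forall>p\<in>W. A p = {\<xi>. \<exists>a::real^'n. \<xi> = (\<lambda>c. \<Sum>i\<in>UNIV. a $ i *\<^sub>R X i p c)}))"

definition is_connection_form ::
  "('m, real^'n) atlas \<Rightarrow> ('m, 'n::finite) distribution \<Rightarrow>
     (('m, 'n) frame \<Rightarrow> ('m, 'n) frame_tangent \<Rightarrow> real^'n^'n) \<Rightarrow> bool" where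
  "is_connection_form M A \<phi> \<longleftrightarrow>
     (\<forall>u\<in>frame_bundle M.
        (\<forall>\<xi>\<in>frame_tangent_space M u. \<forall>\<eta>\<in>frame_tangent_space M u. \<forall>a b.
           \<phi> u (\<lambda>c. a *\<^sub>R \<xi> c + b *\<^sub>R \<eta> c) = a *\<^sub>R \<phi> u \<xi> + b *\<^sub>R \<phi> u \<eta>) \<and>
        (\<forall>\<xi>\<in>A u. \<phi> u \<xi> = 0) \<and>
        (\<forall>X. \<phi> u (fundamental_vector M X u) = X))"

text \<open>A curve on a closed interval is smooth if it extends smoothly to an open interval.\<close>

definition smooth_arc ::
  "('a, 'e::real_normed_vector) atlas \<Rightarrow> (real \<Rightarrow> 'a) \<Rightarrow> real \<Rightarrow> real \<Rightarrow> bool" where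
  "smooth_arc A \<gamma> a b \<longleftrightarrow>
     (\<exists>e>0. \<exists>\<delta>. smooth_map (std_atlas {a - e<..<b + e}) A \<delta> \<and> (\<forall>t\<in>{a..b}. \<delta> t = \<gamma> t))"

definition piecewise :: "(real \<Rightarrow> real \<Rightarrow> bool) \<Rightarrow> bool" where
  "piecewise Q \<longleftrightarrow>
     (\<exists>k (t :: nat \<Rightarrow> real). t 0 = 0 \<and> t k = 1 \<and> (\<forall>i<k. t i < t (Suc i) \<and> Q (t i) (t (Suc i))))"

definition piecewise_smooth_curve ::
  "('a, 'e::real_normed_vector) atlas \<Rightarrow> (real \<Rightarrow> 'a) \<Rightarrow> bool" where
  "piecewise_smooth_curve A \<gamma> \<longleftrightarrow> piecewise (smooth_arc A \<gamma>)"

definition horizontal_curve ::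
  "('m, real^'n) atlas \<Rightarrow> ('m, 'n::finite) distribution \<Rightarrow> (real \<Rightarrow> ('m, 'n) frame) \<Rightarrow> bool" where
  "horizontal_curve M A \<gamma> \<longleftrightarrow>
     piecewise (\<lambda>a b. smooth_arc (frame_atlas M) \<gamma> a b \<and>
       (\<forall>t\<in>{a..b}. velocity (frame_atlas M) \<gamma> {a..b} t \<in> A (\<gamma> t)))"

definition Hol ::
  "('m, real^'n) atlas \<Rightarrow> ('m, 'n::finite) distribution \<Rightarrow> ('m, 'n) frame \<Rightarrow> (real^'n^'n) set" where
  "Hol M A u\<^sub>0 = {g. invertible g \<and>
     (\<exists>\<alpha> \<gamma>. piecewise_smooth_curve M \<alpha> \<and> \<alpha> 0 = fst u\<^sub>0 \<and> \<alpha> 1 = fst u\<^sub>0 \<and>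
        horizontal_curve M A \<gamma> \<and> (\<forall>t\<in>{0..1}. fst (\<gamma> t) = \<alpha> t) \<and>
        \<gamma> 0 = u\<^sub>0 \<and> \<gamma> 1 = frame_act u\<^sub>0 g)}"

definition holonomy_bundle ::
  "('m, real^'n) atlas \<Rightarrow> ('m, 'n::finite) distribution \<Rightarrow> ('m, 'n) frame \<Rightarrow> ('m, 'n) frame set" where
  "holonomy_bundle M A u\<^sub>0 =
     {p \<in> frame_bundle M. \<exists>\<gamma>. horizontal_curve M A \<gamma> \<and> \<gamma> 0 = u\<^sub>0 \<and> \<gamma> 1 = p}"


section \<open>Lie subgroups and reductions\<close>

text \<open>The holonomy group and the holonomy bundle are in general only immersed, so each carries
  a smooth structure of its own (\<open>HA\<close>, resp. \<open>PA\<close>) whose topology may be finer than the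
  subspace topology.\<close>

definition lie_subgroup ::
  "(real^'n^'n) set \<Rightarrow> (real^'n^'n, 'h::real_normed_vector) atlas \<Rightarrow> bool" where
  "lie_subgroup H HA \<longleftrightarrow>
     smooth_manifold HA \<and> points HA = H \<and>
     mat 1 \<in> H \<and> (\<forall>g\<in>H. invertible g \<and> matrix_inv g \<in> H) \<and> (\<forall>g\<in>H. \<forall>h\<in>H. g ** h \<in> H) \<and>
     smooth_map (prod_atlas HA HA) HA (\<lambda>(g, h). g ** h) \<and> smooth_map HA HA matrix_inv \<and>
     smooth_map HA (std_atlas UNIV) (\<lambda>g. g) \<and>
     (\<forall>g\<in>H. inj_on (differential HA (\<lambda>g. g) g) (tangent_space HA g))"

definition principal_subbundle ::
  "('m, real^'n) atlas \<Rightarrow> ('m, 'n::finite) frame set \<Rightarrow> (('m, 'n) frame, 'p::real_normed_vector) atlas \<Rightarrow>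
     (real^'n^'n) set \<Rightarrow> (real^'n^'n, 'h::real_normed_vector) atlas \<Rightarrow> bool" where
  "principal_subbundle M P PA H HA \<longleftrightarrow>
     smooth_manifold PA \<and> points PA = P \<and> P \<subseteq> frame_bundle M \<and>
     smooth_map PA (frame_atlas M) (\<lambda>p. p) \<and>
     (\<forall>p\<in>P. inj_on (tangent_map PA (frame_atlas M) (\<lambda>p. p) p) (tangent_space PA p)) \<and>
     (\<forall>p\<in>P. \<forall>h\<in>H. frame_act p h \<in> P) \<and>
     smooth_map (prod_atlas PA HA) PA (\<lambda>(p, h). frame_act p h) \<and>
     (\<forall>x\<in>points M. \<exists>U \<theta>. openin (manifold_topology M) U \<and> x \<in> U \<and>
        diffeomorphism (restrict_atlas PA {p \<in> P. fst p \<in> U}) (prod_atlas (restrict_atlas M U) HA)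
          (\<lambda>p. (fst p, \<theta> p)) \<and>
        (\<forall>p\<in>P. \<forall>h\<in>H. fst p \<in> U \<longrightarrow> \<theta> (frame_act p h) = \<theta> p ** h))"

definition connection_reduces ::
  "('m, real^'n) atlas \<Rightarrow> ('m, 'n::finite) distribution \<Rightarrow>
     (('m, 'n) frame, 'p::real_normed_vector) atlas \<Rightarrow> bool" where
  "connection_reduces M A PA \<longleftrightarrow>
     (\<forall>p\<in>points PA. A p \<subseteq> tangent_map PA (frame_atlas M) (\<lambda>p. p) p ` tangent_space PA p)"


section \<open>Representations and associated bundles\<close>

definition is_representation ::
  "(real^'n^'n, 'h::real_normed_vector) atlas \<Rightarrow> (real^'n^'n \<Rightarrow> 'v::real_normed_vector \<Rightarrow>\<^sub>L 'v) \<Rightarrow> bool" where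
  "is_representation HA \<rho> \<longleftrightarrow>
     (\<forall>h\<in>points HA. bij (blinfun_apply (\<rho> h))) \<and>
     (\<forall>g\<in>points HA. \<forall>h\<in>points HA. \<rho> (g ** h) = \<rho> g o\<^sub>L \<rho> h) \<and>
     smooth_map HA (std_atlas UNIV) \<rho>"

definition invariant_vectors ::
  "(real^'n^'n) set \<Rightarrow> (real^'n^'n \<Rightarrow> 'v::real_normed_vector \<Rightarrow>\<^sub>L 'v) \<Rightarrow> 'v set" where
  "invariant_vectors H \<rho> = {v. \<forall>h\<in>H. blinfun_apply (\<rho> h) v = v}"

text \<open>The Lie algebra of \<open>H\<close> is the image of the tangent space at the identity in the space of
  all matrices; \<open>lie_rep\<close> is the differential of \<open>\<rho>\<close> at the identity, as a map on that image.
  It is only meaningful on the Lie algebra of \<open>H\<close>.\<close>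

definition lie_rep ::
  "(real^'n^'n, 'h::real_normed_vector) atlas \<Rightarrow> (real^'n^'n \<Rightarrow> 'v::real_normed_vector \<Rightarrow>\<^sub>L 'v) \<Rightarrow>
     real^'n^'n \<Rightarrow> 'v \<Rightarrow>\<^sub>L 'v" where
  "lie_rep HA \<rho> X = differential HA \<rho> (mat 1)
     (THE \<tau>. \<tau> \<in> tangent_space HA (mat 1) \<and> differential HA (\<lambda>g. g) (mat 1) \<tau> = X)"

definition assoc_rel ::
  "('m, 'n::finite) frame set \<Rightarrow> (real^'n^'n) set \<Rightarrow> (real^'n^'n \<Rightarrow> 'v::real_normed_vector \<Rightarrow>\<^sub>L 'v) \<Rightarrow>
     ((('m, 'n) frame \<times> 'v) \<times> (('m, 'n) frame \<times> 'v)) set" where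
  "assoc_rel P H \<rho> =
     {((p, v), (frame_act p h, inv (blinfun_apply (\<rho> h)) v)) | p v h. p \<in> P \<and> h \<in> H}"

definition assoc_class ::
  "('m, 'n::finite) frame set \<Rightarrow> (real^'n^'n) set \<Rightarrow> (real^'n^'n \<Rightarrow> 'v::real_normed_vector \<Rightarrow>\<^sub>L 'v) \<Rightarrow>
     ('m, 'n) frame \<Rightarrow> 'v \<Rightarrow> (('m, 'n) frame \<times> 'v) set" where
  "assoc_class P H \<rho> p v = assoc_rel P H \<rho> `` {(p, v)}"

text \<open>A smooth local section \<open>s\<close> of \<open>P\<close> over an open subset \<open>U\<close> of a chart domain gives the chart
  \<open>[s x, w] \<mapsto> (coordinates of x, w)\<close> of the associated bundle.\<close>

definition assoc_atlas ::
  "('m, real^'n) atlas \<Rightarrow> (('m, 'n::finite) frame, 'p::real_normed_vector) atlas \<Rightarrow>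
     (real^'n^'n) set \<Rightarrow> (real^'n^'n \<Rightarrow> 'v::real_normed_vector \<Rightarrow>\<^sub>L 'v) \<Rightarrow>
     ((('m, 'n) frame \<times> 'v) set, (real^'n) \<times> 'v) atlas" where
  "assoc_atlas M PA H \<rho> =
     {({assoc_class (points PA) H \<rho> (s x) w | x w. x \<in> U},
       \<lambda>e. THE z. \<exists>x\<in>U. \<exists>w. e = assoc_class (points PA) H \<rho> (s x) w \<and> z = (snd c x, w)) | c U s.
      c \<in> M \<and> openin (manifold_topology M) U \<and> U \<subseteq> fst c \<and>
      smooth_map (restrict_atlas M U) PA s \<and> (\<forall>x\<in>U. fst (s x) = x)}"

text \<open>Sections are taken to be undefined off the base, so that equality of sections is equality
  on the base.\<close>

definition smooth_sections ::
  "('m, real^'n) atlas \<Rightarrow> (('m, 'n::finite) frame, 'p::real_normed_vector) atlas \<Rightarrow>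
     (real^'n^'n) set \<Rightarrow> (real^'n^'n \<Rightarrow> 'v::real_normed_vector \<Rightarrow>\<^sub>L 'v) \<Rightarrow>
     ('m \<Rightarrow> (('m, 'n) frame \<times> 'v) set) set" where
  "smooth_sections M PA H \<rho> =
     {\<sigma> \<in> extensional (points M).
        (\<forall>x\<in>points M. \<exists>p\<in>points PA. \<exists>v. fst p = x \<and> \<sigma> x = assoc_class (points PA) H \<rho> p v) \<and>
        smooth_map M (assoc_atlas M PA H \<rho>) \<sigma>}"

definition section_function ::
  "('m, 'n::finite) frame set \<Rightarrow> (real^'n^'n) set \<Rightarrow> (real^'n^'n \<Rightarrow> 'v::real_normed_vector \<Rightarrow>\<^sub>L 'v) \<Rightarrow>
     ('m \<Rightarrow> (('m, 'n) frame \<times> 'v) set) \<Rightarrow> ('m, 'n) frame \<Rightarrow> 'v" where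
  "section_function P H \<rho> \<sigma> p = (THE v. \<sigma> (fst p) = assoc_class P H \<rho> p v)"

text \<open>\<open>Df = df + \<rho>\<^sub>*(\<phi>) f\<close> on \<open>P\<close>, where \<open>\<phi>\<close> is pulled back along the inclusion of \<open>P\<close>.\<close>

definition cov_differential ::
  "('m, real^'n) atlas \<Rightarrow> (('m, 'n::finite) frame \<Rightarrow> ('m, 'n) frame_tangent \<Rightarrow> real^'n^'n) \<Rightarrow>
     (('m, 'n) frame, 'p::real_normed_vector) atlas \<Rightarrow> (real^'n^'n, 'h::real_normed_vector) atlas \<Rightarrow>
     (real^'n^'n \<Rightarrow> 'v::real_normed_vector \<Rightarrow>\<^sub>L 'v) \<Rightarrow> (('m, 'n) frame \<Rightarrow> 'v) \<Rightarrow>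
     ('m, 'n) frame \<Rightarrow> (('m, 'n) frame, 'p) tangent \<Rightarrow> 'v" where
  "cov_differential M \<phi> PA HA \<rho> f p \<xi> =
     differential PA f p \<xi> +
     blinfun_apply (lie_rep HA \<rho> (\<phi> p (tangent_map PA (frame_atlas M) (\<lambda>p. p) p \<xi>))) (f p)"

definition parallel_sections ::
  "('m, real^'n) atlas \<Rightarrow> (('m, 'n::finite) frame \<Rightarrow> ('m, 'n) frame_tangent \<Rightarrow> real^'n^'n) \<Rightarrow>
     (('m, 'n) frame, 'p::real_normed_vector) atlas \<Rightarrow> (real^'n^'n, 'h::real_normed_vector) atlas \<Rightarrow>
     (real^'n^'n \<Rightarrow> 'v::real_normed_vector \<Rightarrow>\<^sub>L 'v) \<Rightarrow> ('m \<Rightarrow> (('m, 'n) frame \<times> 'v) set) set" where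
  "parallel_sections M \<phi> PA HA \<rho> =
     {\<sigma> \<in> smooth_sections M PA (points HA) \<rho>.
        \<forall>p\<in>points PA. \<forall>\<xi>\<in>tangent_space PA p.
          cov_differential M \<phi> PA HA \<rho> (section_function (points PA) (points HA) \<rho> \<sigma>) p \<xi> = 0}"

end

theory Submission
  imports Defs
begin

text \<open>
  The section belonging to an invariant vector \<open>v\<close> is \<open>\<pi>(p) \<mapsto> [p, v]\<close>; its function on \<open>P\<close> is constant,
  and \<open>\<rho>\<^sub>*\<close> annihilates invariant vectors, so it is parallel. Conversely, the function \<open>f\<close> of a parallel
  section has \<open>df = 0\<close> on horizontal vectors, hence is constant along horizontal curves; all points of
  \<open>P\<close> are joined to \<open>u\<^sub>0\<close> by such curves, so \<open>f\<close> is constant, and equivariance makes its value invariant.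

  The delicate point is that a horizontal curve is smooth in the frame bundle, whereas \<open>P\<close> is only
  immersed. In a local trivialization the curve is \<open>s(x(t)) h(t)\<close> with \<open>h\<close> continuous as a matrix-valued
  curve. Near the identity, \<open>H\<close> is a disjoint union of slices \<open>(1 + Y) ** j(z)\<close>, with \<open>j\<close> a local
  parametrization of \<open>H\<close> and \<open>Y\<close> in a complement of its Lie algebra. There are countably many of them
  because \<open>H\<close> is second countable, so \<open>h\<close> stays in one slice and is continuous in \<open>H\<close>.
  Then the curve is continuous in \<open>P\<close>, and differentiable because the inclusion is an immersion.
\<close>

section \<open>Atlases with differentiable transitions\<close>

text \<open>The argument is of first order: the chain rule at single points carries everything that
  concerns curves, tangent vectors and the function of a section. Charts and maps are therefore
  weakened at once to pointwise differentiability, a class to which products, restrictions and the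
  frame bundle are easily shown to belong and whose maps compose. Smooth maps have to be produced
  for three purposes only: truncated horizontal curves, local sections of \<open>P\<close> (they
  define the charts of \<open>E\<close>), and the section of an invariant vector. In each case the
  coordinate expression is a given smooth map after an affine map, or z \<mapsto> (z, v).

  Truncation matters because \<open>P\<close> is defined by end points: the intermediate points of a
  horizontal curve must be shown to lie in \<open>P\<close> before the covariant derivative can be
  used along it.

  Differentiability in \<open>P\<close> cannot be read off from the image in the frame bundle alone,
  since other sheets of \<open>P\<close> may come arbitrarily close to a given one; continuity for
  the topology of \<open>P\<close> has to be settled first.\<close>

definition diff_atlas :: "('a, 'e::real_normed_vector) atlas \<Rightarrow> bool" where
  "diff_atlas A \<longleftrightarrow> (\<forall>c\<in>A. inj_on (snd c) (fst c)) \<and>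
     (\<forall>c\<in>A. \<forall>c'\<in>A. open (snd c ` (fst c \<inter> fst c')) \<and>
        (\<forall>x\<in>fst c \<inter> fst c'. (snd c' \<circ> chart_inv c) differentiable (at (snd c x))))"

lemma smooth_on_imp_differentiable:
  "smooth_on U f \<Longrightarrow> x \<in> U \<Longrightarrow> f differentiable (at x)"
  unfolding smooth_on_def by (metis Ck_on.simps(2))

lemma smooth_manifold_diff_atlas: "smooth_manifold A \<Longrightarrow> diff_atlas A"
  unfolding smooth_manifold_def diff_atlas_def
  by (meson image_eqI smooth_on_imp_differentiable)

lemma diff_atlas_inj: "diff_atlas A \<Longrightarrow> c \<in> A \<Longrightarrow> inj_on (snd c) (fst c)"
  by (simp add: diff_atlas_def)

lemma chart_inv_chart: "inj_on (snd c) (fst c) \<Longrightarrow> x \<in> fst c \<Longrightarrow> chart_inv c (snd c x) = x"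
  by (simp add: chart_inv_def)

lemma diff_atlas_chart_inv: "diff_atlas A \<Longrightarrow> c \<in> A \<Longrightarrow> x \<in> fst c \<Longrightarrow> chart_inv c (snd c x) = x"
  by (simp add: chart_inv_chart diff_atlas_inj)

lemma openin_diff_atlas:
  "diff_atlas A \<Longrightarrow> openin (manifold_topology A) U \<longleftrightarrow>
     U \<subseteq> points A \<and> (\<forall>c\<in>A. open (snd c ` (U \<inter> fst c)))"
  by (simp add: openin_manifold_topology diff_atlas_inj)

lemma diff_atlas_domain_open:
  assumes "diff_atlas A" "c \<in> A" shows "open (snd c ` fst c)"
  using assms unfolding diff_atlas_def by (metis inf.idem)

lemma diff_atlas_transition:
  assumes "diff_atlas A" "c \<in> A" "c' \<in> A" "x \<in> fst c" "x \<in> fst c'"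
  shows "(snd c' \<circ> chart_inv c) differentiable (at (snd c x))"
  using assms unfolding diff_atlas_def by blast

lemma openin_points:
  assumes "diff_atlas A" shows "openin (manifold_topology A) (points A)"
proof -
  have "points A \<inter> fst c = fst c" if "c \<in> A" for c using that by (auto simp: points_def)
  then show ?thesis using assms by (auto simp: openin_diff_atlas diff_atlas_domain_open)
qed

lemma topspace_diff_atlas:
  assumes "diff_atlas A" shows "topspace (manifold_topology A) = points A"
  using openin_points[OF assms] openin_subset openin_diff_atlas[OF assms] openin_topspace
  by (metis subset_antisym)

text \<open>Continuity of a chart is tested in every other chart, where it becomes continuity of the
  transition map, a consequence of its differentiability.\<close>

lemma openin_chart_preimage:
  assumes A: "diff_atlas A" and c: "c \<in> A" and S: "open S"
  shows "openin (manifold_topology A) {x \<in> fst c. snd c x \<in> S}"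
  unfolding openin_diff_atlas[OF A]
proof (intro conjI ballI)
  show "{x \<in> fst c. snd c x \<in> S} \<subseteq> points A" using c by (auto simp: points_def)
  fix d assume d: "d \<in> A"
  let ?g = "snd c \<circ> chart_inv d" and ?D = "snd d ` (fst d \<inter> fst c)"
  have oD: "open ?D" using A c d by (simp add: diff_atlas_def)
  have "continuous_on ?D ?g"
    using diff_atlas_transition[OF A d c]
    by (intro continuous_at_imp_continuous_on) (auto intro!: differentiable_imp_continuous_within)
  then have "open (?D \<inter> ?g -` S)" using oD S by (rule continuous_open_preimage)
  moreover have "?D \<inter> ?g -` S = snd d ` ({x \<in> fst c. snd c x \<in> S} \<inter> fst d)"
    using diff_atlas_chart_inv[OF A d] by auto
  ultimately show "open (snd d ` ({x \<in> fst c. snd c x \<in> S} \<inter> fst d))" by simp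
qed

lemma openin_chart_domain:
  "diff_atlas A \<Longrightarrow> c \<in> A \<Longrightarrow> openin (manifold_topology A) (fst c)"
  using openin_chart_preimage[of A c UNIV] by simp

lemma open_chart_image:
  assumes "diff_atlas A" "c \<in> A" "openin (manifold_topology A) U"
  shows "open (snd c ` (U \<inter> fst c))"
  using assms by (simp add: openin_diff_atlas)

text \<open>\<open>chart_inv\<close> is total, with arbitrary values off the image of the chart.
  Coordinate expressions are therefore compared only near a point, and this gives the neighbourhood
  on which \<open>chart_inv c\<close> really inverts the chart.\<close>

lemma eventually_chart_inv:
  assumes A: "diff_atlas A" and c: "c \<in> A" and U: "openin (manifold_topology A) U"
    and x: "x \<in> U" "x \<in> fst c"
  shows "\<forall>\<^sub>F z in nhds (snd c x). chart_inv c z \<in> U \<and> chart_inv c z \<in> fst c \<and> snd c (chart_inv c z) = z"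
proof -
  have "\<forall>\<^sub>F z in nhds (snd c x). z \<in> snd c ` (U \<inter> fst c)"
    using open_chart_image[OF A c U] x by (intro eventually_nhds_in_open) auto
  then show ?thesis
    by eventually_elim (auto simp: diff_atlas_chart_inv[OF A c])
qed

text \<open>As types, the points of a manifold have either no topology, like frames, or a possibly
  coarser one than intended, like matrices in \<open>H\<close>. Limits are therefore taken with
  \<open>limitin\<close>, and one chart around the limit suffices to test them.\<close>

lemma limitin_chart_iff:
  assumes A: "diff_atlas A" and c: "c \<in> A" and x: "x \<in> fst c"
  shows "limitin (manifold_topology A) \<gamma> x F \<longleftrightarrow>
           (\<forall>\<^sub>F t in F. \<gamma> t \<in> fst c) \<and> ((\<lambda>t. snd c (\<gamma> t)) \<longlongrightarrow> snd c x) F" (is "?l = ?r")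
proof
  assume l: ?l
  show ?r
  proof
    show e: "\<forall>\<^sub>F t in F. \<gamma> t \<in> fst c"
      using l openin_chart_domain[OF A c] x by (auto simp: limitin_def)
    show "((\<lambda>t. snd c (\<gamma> t)) \<longlongrightarrow> snd c x) F"
    proof (rule topological_tendstoI)
      fix S assume "open S" "snd c x \<in> S"
      then have "\<forall>\<^sub>F t in F. \<gamma> t \<in> {x \<in> fst c. snd c x \<in> S}"
        using l openin_chart_preimage[OF A c, of S] x by (auto simp: limitin_def)
      then show "\<forall>\<^sub>F t in F. snd c (\<gamma> t) \<in> S" by eventually_elim auto
    qed
  qed
next
  assume r: ?r
  show ?l unfolding limitin_def
  proof (intro conjI allI impI)
    show "x \<in> topspace (manifold_topology A)"
      using c x topspace_diff_atlas[OF A] by (auto simp: points_def)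
    fix U assume U: "openin (manifold_topology A) U \<and> x \<in> U"
    then have "\<forall>\<^sub>F t in F. snd c (\<gamma> t) \<in> snd c ` (U \<inter> fst c)"
      using r x open_chart_image[OF A c] by (auto intro!: topological_tendstoD)
    with r have "\<forall>\<^sub>F t in F. snd c (\<gamma> t) \<in> snd c ` (U \<inter> fst c) \<and> \<gamma> t \<in> fst c"
      by (simp add: eventually_conj)
    then show "\<forall>\<^sub>F t in F. \<gamma> t \<in> U"
      by (rule eventually_mono) (use diff_atlas_inj[OF A c] in \<open>auto dest: inj_onD\<close>)
  qed
qed

section \<open>Maps differentiable at a point\<close>

lemma isCont_filterlim_nhds: "isCont f a \<Longrightarrow> filterlim f (nhds (f a)) (nhds a)"
  by (simp add: isCont_def tendsto_at_iff_tendsto_nhds)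

text \<open>The eventuality keeps nearby values inside the domain of \<open>c'\<close>. Outside it
  \<open>snd c'\<close> is arbitrary, and differentiability of the coordinate expression alone would
  not even imply continuity of \<open>F\<close>.\<close>

definition mdifferentiable ::
  "('a, 'e::real_normed_vector) atlas \<Rightarrow> ('b, 'd::real_normed_vector) atlas \<Rightarrow> ('a \<Rightarrow> 'b) \<Rightarrow> 'a \<Rightarrow> bool" where
  "mdifferentiable A B F x \<longleftrightarrow> (\<exists>c\<in>A. \<exists>c'\<in>B. x \<in> fst c \<and> F x \<in> fst c' \<and>
     (\<forall>\<^sub>F z in nhds (snd c x). F (chart_inv c z) \<in> fst c') \<and>
     (snd c' \<circ> F \<circ> chart_inv c) differentiable (at (snd c x)))"

lemma has_derivative_eventually_cong:
  assumes "(f has_derivative f') (at x)" "\<forall>\<^sub>F z in nhds x. g z = f z"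
  shows "(g has_derivative f') (at x)"
proof -
  have "\<forall>\<^sub>F z in at x. f z = g z" "f x = g x"
    using assms(2) by (auto simp: eventually_at_filter eq_commute elim: eventually_mono dest: eventually_nhds_x_imp_x)
  with assms(1) show ?thesis by (auto intro: has_derivative_transform_eventually)
qed

lemma differentiable_eventually_cong:
  assumes "f differentiable (at x)" "\<forall>\<^sub>F z in nhds x. g z = f z"
  shows "g differentiable (at x)"
  using assms has_derivative_eventually_cong unfolding differentiable_def by blast

lemma transition_has_derivative:
  assumes A: "diff_atlas A" and c: "c \<in> A" "x \<in> fst c" and c': "c' \<in> A" "x \<in> fst c'"
    and g: "((g \<circ> chart_inv c') has_derivative g') (at (snd c' x))"
  shows "((g \<circ> chart_inv c) has_derivative
            (\<lambda>w. g' (frechet_derivative (snd c' \<circ> chart_inv c) (at (snd c x)) w))) (at (snd c x))"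
proof -
  let ?t = "snd c' \<circ> chart_inv c"
  have t: "(?t has_derivative frechet_derivative ?t (at (snd c x))) (at (snd c x))"
    using diff_atlas_transition[OF A c(1) c'(1) c(2) c'(2)] frechet_derivative_works by blast
  have "?t (snd c x) = snd c' x" by (simp add: diff_atlas_chart_inv[OF A c])
  with g have "((g \<circ> chart_inv c') has_derivative g') (at (?t (snd c x)))" by simp
  then have "(((g \<circ> chart_inv c') \<circ> ?t) has_derivative (g' \<circ> frechet_derivative ?t (at (snd c x)))) (at (snd c x))"
    by (rule diff_chain_at[OF t])
  moreover have "\<forall>\<^sub>F z in nhds (snd c x). (g \<circ> chart_inv c) z = ((g \<circ> chart_inv c') \<circ> ?t) z"
    using eventually_chart_inv[OF A c(1) openin_chart_domain[OF A c'(1)] c'(2) c(2)]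
    by eventually_elim (simp add: diff_atlas_chart_inv[OF A c'(1)])
  ultimately show ?thesis by (auto intro: has_derivative_eventually_cong simp: o_def)
qed

lemma frechet_derivative_transition:
  assumes "diff_atlas A" "c \<in> A" "x \<in> fst c" "c' \<in> A" "x \<in> fst c'"
    and "(g \<circ> chart_inv c') differentiable (at (snd c' x))"
  shows "(g \<circ> chart_inv c) differentiable (at (snd c x))"
    and "frechet_derivative (g \<circ> chart_inv c) (at (snd c x)) w =
         frechet_derivative (g \<circ> chart_inv c') (at (snd c' x))
           (frechet_derivative (snd c' \<circ> chart_inv c) (at (snd c x)) w)"
proof -
  note h = transition_has_derivative[OF assms(1-5), OF assms(6)[unfolded frechet_derivative_works]]
  show "(g \<circ> chart_inv c) differentiable (at (snd c x))"
    using h unfolding differentiable_def by blast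
  show "frechet_derivative (g \<circ> chart_inv c) (at (snd c x)) w =
         frechet_derivative (g \<circ> chart_inv c') (at (snd c' x))
           (frechet_derivative (snd c' \<circ> chart_inv c) (at (snd c x)) w)"
    using fun_cong[OF frechet_derivative_at[OF h]] by simp
qed

text \<open>With the source parametrization \<open>k\<close> fixed, only the target chart changes.
  Continuity of the first coordinate expression keeps nearby values in the second chart domain,
  after which the chain rule with the transition applies.\<close>

lemma codomain_transition:
  assumes B: "diff_atlas B" and c1: "c1 \<in> B" "F x \<in> fst c1" and c2: "c2 \<in> B" "F x \<in> fst c2"
    and x: "x = k z" and ev: "\<forall>\<^sub>F w in nhds z. F (k w) \<in> fst c1"
    and d: "(snd c1 \<circ> F \<circ> k) differentiable (at z)"
  shows "\<forall>\<^sub>F w in nhds z. F (k w) \<in> fst c2"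
    and "(snd c2 \<circ> F \<circ> k) differentiable (at z)"
    and "frechet_derivative (snd c2 \<circ> F \<circ> k) (at z) v =
         frechet_derivative (snd c2 \<circ> chart_inv c1) (at (snd c1 (F x)))
           (frechet_derivative (snd c1 \<circ> F \<circ> k) (at z) v)"
proof -
  let ?p = "snd c1 \<circ> F \<circ> k" and ?t = "snd c2 \<circ> chart_inv c1"
  have pz: "?p z = snd c1 (F x)" using x by simp
  have "isCont ?p z" using d by (rule differentiable_imp_continuous_within)
  then have "filterlim ?p (nhds (snd c1 (F x))) (nhds z)"
    using pz isCont_filterlim_nhds by metis
  then have "\<forall>\<^sub>F w in nhds z. chart_inv c1 (?p w) \<in> fst c2"
    using eventually_chart_inv[OF B c1(1) openin_chart_domain[OF B c2(1)] c2(2) c1(2)]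
    by (auto simp: filterlim_iff elim: eventually_mono)
  with ev have ev2: "\<forall>\<^sub>F w in nhds z. F (k w) \<in> fst c1 \<and> F (k w) \<in> fst c2"
    by eventually_elim (auto simp: diff_atlas_chart_inv[OF B c1(1)])
  then show "\<forall>\<^sub>F w in nhds z. F (k w) \<in> fst c2" by eventually_elim auto
  have t: "(?t has_derivative frechet_derivative ?t (at (snd c1 (F x)))) (at (?p z))"
    using diff_atlas_transition[OF B c1(1) c2(1) c1(2) c2(2)] pz by (simp add: frechet_derivative_works)
  have eq: "\<forall>\<^sub>F w in nhds z. (snd c2 \<circ> F \<circ> k) w = (?t \<circ> ?p) w"
    using ev2 by eventually_elim (simp add: diff_atlas_chart_inv[OF B c1(1)])
  have h: "((snd c2 \<circ> F \<circ> k) has_derivative (frechet_derivative ?t (at (snd c1 (F x))) \<circ> frechet_derivative ?p (at z))) (at z)"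
    using has_derivative_eventually_cong[OF diff_chain_at[OF d[unfolded frechet_derivative_works] t] eq] .
  then show "(snd c2 \<circ> F \<circ> k) differentiable (at z)" unfolding differentiable_def by blast
  show "frechet_derivative (snd c2 \<circ> F \<circ> k) (at z) v =
         frechet_derivative ?t (at (snd c1 (F x))) (frechet_derivative ?p (at z) v)"
    using fun_cong[OF frechet_derivative_at[OF h], of v] by simp
qed

text \<open>The charts provided by \<open>mdifferentiable\<close> are exchanged one at a time: the
  source chart by the chain rule, then the target chart by
  \<open>codomain_transition\<close>.\<close>

lemma mdifferentiable_in_charts:
  assumes A: "diff_atlas A" and B: "diff_atlas B" and F: "mdifferentiable A B F x"
    and c: "c \<in> A" "x \<in> fst c" and c': "c' \<in> B" "F x \<in> fst c'"
  shows "\<forall>\<^sub>F z in nhds (snd c x). F (chart_inv c z) \<in> fst c'"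
    and "(snd c' \<circ> F \<circ> chart_inv c) differentiable (at (snd c x))"
proof -
  obtain c1 c2 where c1: "c1 \<in> A" "x \<in> fst c1" and c2: "c2 \<in> B" "F x \<in> fst c2"
    and ev: "\<forall>\<^sub>F z in nhds (snd c1 x). F (chart_inv c1 z) \<in> fst c2"
    and d: "(snd c2 \<circ> F \<circ> chart_inv c1) differentiable (at (snd c1 x))"
    using F unfolding mdifferentiable_def by blast
  let ?t = "snd c1 \<circ> chart_inv c"
  have d1: "(snd c2 \<circ> F \<circ> chart_inv c) differentiable (at (snd c x))"
    by (rule frechet_derivative_transition(1)[OF A c c1 d])
  have "isCont ?t (snd c x)"
    using diff_atlas_transition[OF A c(1) c1(1) c(2) c1(2)] by (rule differentiable_imp_continuous_within)
  then have "filterlim ?t (nhds (snd c1 x)) (nhds (snd c x))"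
    using isCont_filterlim_nhds[of "snd c x" ?t] by (simp add: diff_atlas_chart_inv[OF A c])
  then have "\<forall>\<^sub>F z in nhds (snd c x). F (chart_inv c1 (?t z)) \<in> fst c2"
    using ev by (auto simp: filterlim_iff)
  moreover have "\<forall>\<^sub>F z in nhds (snd c x). chart_inv c z \<in> fst c1"
    using eventually_chart_inv[OF A c(1) openin_chart_domain[OF A c1(1)] c1(2) c(2)] by eventually_elim auto
  ultimately have e1: "\<forall>\<^sub>F z in nhds (snd c x). F (chart_inv c z) \<in> fst c2"
    by eventually_elim (simp add: diff_atlas_chart_inv[OF A c1(1)])
  show "\<forall>\<^sub>F z in nhds (snd c x). F (chart_inv c z) \<in> fst c'"
    and "(snd c' \<circ> F \<circ> chart_inv c) differentiable (at (snd c x))"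
    using codomain_transition[OF B c2 c' _ e1 d1] diff_atlas_chart_inv[OF A c] by auto
qed

lemma mdifferentiable_compose:
  assumes B: "diff_atlas B" and C: "diff_atlas C" and A: "diff_atlas A"
    and F: "mdifferentiable A B F x" and G: "mdifferentiable B C G (F x)"
  shows "mdifferentiable A C (\<lambda>x. G (F x)) x"
proof -
  obtain c c' where c: "c \<in> A" "x \<in> fst c" and c': "c' \<in> B" "F x \<in> fst c'"
    using F unfolding mdifferentiable_def by blast
  obtain d where d: "d \<in> C" "G (F x) \<in> fst d"
    using G unfolding mdifferentiable_def by blast
  note f = mdifferentiable_in_charts[OF A B F c c'] and g = mdifferentiable_in_charts[OF B C G c' d]
  let ?f = "snd c' \<circ> F \<circ> chart_inv c" and ?g = "snd d \<circ> G \<circ> chart_inv c'"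
  have fx: "?f (snd c x) = snd c' (F x)" by (simp add: diff_atlas_chart_inv[OF A c])
  have "filterlim ?f (nhds (snd c' (F x))) (nhds (snd c x))"
    using differentiable_imp_continuous_within[OF f(2)] fx isCont_filterlim_nhds by metis
  then have "\<forall>\<^sub>F z in nhds (snd c x). G (chart_inv c' (?f z)) \<in> fst d"
    using g(1) by (auto simp: filterlim_iff)
  with f(1) have ev: "\<forall>\<^sub>F z in nhds (snd c x). G (F (chart_inv c z)) \<in> fst d \<and>
      (snd d \<circ> (\<lambda>x. G (F x)) \<circ> chart_inv c) z = (?g \<circ> ?f) z"
    by eventually_elim (simp add: diff_atlas_chart_inv[OF B c'(1)])
  have "(?g \<circ> ?f) differentiable (at (snd c x))"
    using f(2) g(2) fx by (intro differentiable_chain_at) auto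
  then have "(snd d \<circ> (\<lambda>x. G (F x)) \<circ> chart_inv c) differentiable (at (snd c x))"
    by (rule differentiable_eventually_cong) (use ev in eventually_elim, simp)
  moreover have "\<forall>\<^sub>F z in nhds (snd c x). G (F (chart_inv c z)) \<in> fst d"
    using ev by eventually_elim simp
  ultimately show ?thesis unfolding mdifferentiable_def using c d by blast
qed

lemma mdifferentiable_cong:
  assumes A: "diff_atlas A" and F: "mdifferentiable A B F x"
    and W: "openin (manifold_topology A) W" "x \<in> W" "\<And>y. y \<in> W \<Longrightarrow> G y = F y"
  shows "mdifferentiable A B G x"
proof -
  obtain c c' where c: "c \<in> A" "x \<in> fst c" "c' \<in> B" "F x \<in> fst c'"
    and ev: "\<forall>\<^sub>F z in nhds (snd c x). F (chart_inv c z) \<in> fst c'"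
    and d: "(snd c' \<circ> F \<circ> chart_inv c) differentiable (at (snd c x))"
    using F unfolding mdifferentiable_def by blast
  have e: "\<forall>\<^sub>F z in nhds (snd c x). chart_inv c z \<in> W"
    using eventually_chart_inv[OF A c(1) W(1,2) c(2)] by eventually_elim simp
  have "\<forall>\<^sub>F z in nhds (snd c x). G (chart_inv c z) \<in> fst c'"
    using e ev by eventually_elim (simp add: W(3))
  moreover have "(snd c' \<circ> G \<circ> chart_inv c) differentiable (at (snd c x))"
    by (rule differentiable_eventually_cong[OF d]) (use e in eventually_elim, simp add: W(3))
  ultimately show ?thesis unfolding mdifferentiable_def using c W by force
qed

lemma limitin_mdifferentiable:
  assumes A: "diff_atlas A" and B: "diff_atlas B" and F: "mdifferentiable A B F x"
    and l: "limitin (manifold_topology A) \<gamma> x L"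
  shows "limitin (manifold_topology B) (\<lambda>t. F (\<gamma> t)) (F x) L"
proof -
  obtain c c' where c: "c \<in> A" "x \<in> fst c" "c' \<in> B" "F x \<in> fst c'"
    and ev: "\<forall>\<^sub>F z in nhds (snd c x). F (chart_inv c z) \<in> fst c'"
    and d: "(snd c' \<circ> F \<circ> chart_inv c) differentiable (at (snd c x))"
    using F unfolding mdifferentiable_def by blast
  have e: "\<forall>\<^sub>F t in L. \<gamma> t \<in> fst c" and t: "((\<lambda>t. snd c (\<gamma> t)) \<longlongrightarrow> snd c x) L"
    using l limitin_chart_iff[OF A c(1,2)] by auto
  have "\<forall>\<^sub>F t in L. F (chart_inv c (snd c (\<gamma> t))) \<in> fst c'"
    using ev t by (auto simp: filterlim_iff)
  with e have 1: "\<forall>\<^sub>F t in L. F (\<gamma> t) \<in> fst c'"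
    by eventually_elim (simp add: diff_atlas_chart_inv[OF A c(1)])
  have "((\<lambda>t. (snd c' \<circ> F \<circ> chart_inv c) (snd c (\<gamma> t))) \<longlongrightarrow> (snd c' \<circ> F \<circ> chart_inv c) (snd c x)) L"
    using differentiable_imp_continuous_within[OF d] t by (rule isCont_tendsto_compose)
  moreover have "\<forall>\<^sub>F t in L. (snd c' \<circ> F \<circ> chart_inv c) (snd c (\<gamma> t)) = snd c' (F (\<gamma> t))"
    using e by eventually_elim (simp add: diff_atlas_chart_inv[OF A c(1)])
  ultimately have "((\<lambda>t. snd c' (F (\<gamma> t))) \<longlongrightarrow> snd c' (F x)) L"
    using Lim_transform_eventually by (fastforce simp: diff_atlas_chart_inv[OF A c(1,2)])
  with 1 show ?thesis using limitin_chart_iff[OF B c(3,4)] by blast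
qed

lemma mdifferentiable_preimage_nhd:
  assumes A: "diff_atlas A" and B: "diff_atlas B" and F: "mdifferentiable A B F x"
    and V: "openin (manifold_topology B) V" "F x \<in> V"
  obtains W where "openin (manifold_topology A) W" "x \<in> W" "\<And>y. y \<in> W \<Longrightarrow> F y \<in> V"
proof -
  obtain c where c: "c \<in> A" "x \<in> fst c" using F unfolding mdifferentiable_def by blast
  \<comment> \<open>Viewed as a family indexed by coordinates, \<open>chart_inv c\<close> converges
    to \<open>x\<close>; preservation of limits by \<open>F\<close> then yields an actual
    neighbourhood.\<close>
  have "limitin (manifold_topology A) (chart_inv c) x (nhds (snd c x))"
    unfolding limitin_chart_iff[OF A c]
    using eventually_chart_inv[OF A c(1) openin_chart_domain[OF A c(1)] c(2,2)]
    by (auto elim: eventually_mono intro!: Lim_transform_eventually[OF filterlim_ident])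
  then have "limitin (manifold_topology B) (\<lambda>z. F (chart_inv c z)) (F x) (nhds (snd c x))"
    by (rule limitin_mdifferentiable[OF A B F])
  then have "\<forall>\<^sub>F z in nhds (snd c x). F (chart_inv c z) \<in> V" using V by (auto simp: limitin_def)
  then obtain S where S: "open S" "snd c x \<in> S" "\<And>z. z \<in> S \<Longrightarrow> F (chart_inv c z) \<in> V"
    by (auto simp: eventually_nhds)
  show thesis
    by (rule that[OF openin_chart_preimage[OF A c(1) S(1)]])
       (use S c diff_atlas_chart_inv[OF A c(1)] in force)+
qed

section \<open>Smooth maps, products and tangent vectors\<close>

text \<open>Agreement on an open set is agreement near each of its points, so it passes to Frechet
  derivatives. Coordinate expressions that agree only where \<open>chart_inv\<close> is a true
  inverse can then be exchanged.\<close>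

lemma Ck_on_cong:
  assumes "open U" "\<And>x. x \<in> U \<Longrightarrow> f x = g x"
  shows "Ck_on k U f \<longleftrightarrow> Ck_on k U g"
  using assms(2)
proof (induction k arbitrary: f g)
  case 0
  then show ?case by (auto intro: continuous_on_cong)
next
  case (Suc k)
  have ev: "\<forall>\<^sub>F z in nhds x. f z = g z" if "x \<in> U" for x
    using eventually_nhds_in_open[OF assms(1) that] by eventually_elim (rule Suc.prems)
  then have ev': "\<forall>\<^sub>F z in nhds x. g z = f z" if "x \<in> U" for x
    using that by (simp add: eq_commute)
  have "f differentiable (at x) \<longleftrightarrow> g differentiable (at x)"
    and "frechet_derivative f (at x) = frechet_derivative g (at x)" if "x \<in> U" for x
    using that has_derivative_eventually_cong[OF _ ev[OF that]] has_derivative_eventually_cong[OF _ ev'[OF that]]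
    by (auto simp: differentiable_def frechet_derivative_def intro!: arg_cong[where f = Eps])
  then show ?case
    using Suc.IH[of "\<lambda>x. frechet_derivative f (at x) v" "\<lambda>x. frechet_derivative g (at x) v" for v] by simp
qed

lemma smooth_on_cong:
  "open U \<Longrightarrow> (\<And>x. x \<in> U \<Longrightarrow> f x = g x) \<Longrightarrow> smooth_on U f \<longleftrightarrow> smooth_on U g"
  unfolding smooth_on_def using Ck_on_cong by blast

text \<open>The derivative of the composite in the direction \<open>v\<close> is the derivative of
  \<open>f\<close> in the direction \<open>l v\<close>, precomposed with the same affine map. The
  induction closes because \<open>l v\<close> is the same at all points; a nonlinear inner map would
  bring in a product rule.\<close>

lemma Ck_on_compose_affine:
  assumes l: "bounded_linear l" and "\<And>x. x \<in> U' \<Longrightarrow> b + l x \<in> U" "open U'"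
    and "Ck_on k U f"
  shows "Ck_on k U' (\<lambda>x. f (b + l x))"
  using assms(4)
proof (induction k arbitrary: f)
  case 0
  have "continuous_on U' (\<lambda>x. b + l x)"
    by (intro continuous_intros linear_continuous_on[OF l])
  then have "continuous_on U' (f \<circ> (\<lambda>x. b + l x))"
    using 0 assms(2) by (intro continuous_on_compose) (auto intro: continuous_on_subset)
  then show ?case by (simp add: o_def)
next
  case (Suc k)
  have h: "((\<lambda>x. f (b + l x)) has_derivative (\<lambda>v. frechet_derivative f (at (b + l x)) (l v))) (at x)"
    if "x \<in> U'" for x
  proof -
    have "((\<lambda>x. b + l x) has_derivative l) (at x)"
      using bounded_linear_imp_has_derivative[OF l, of "at x"] by (auto intro!: derivative_eq_intros)
    moreover have "(f has_derivative frechet_derivative f (at (b + l x))) (at (b + l x))"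
      using Suc.prems assms(2)[OF that] by (simp add: frechet_derivative_works[symmetric])
    ultimately show ?thesis using diff_chain_at by (fastforce simp: o_def)
  qed
  have "Ck_on k U' (\<lambda>x. frechet_derivative f (at (b + l x)) (l v))" for v
    using Suc.IH[of "\<lambda>x. frechet_derivative f (at x) (l v)"] Suc.prems by simp
  moreover have "Ck_on k U' (\<lambda>x. frechet_derivative f (at (b + l x)) (l v)) \<longleftrightarrow>
      Ck_on k U' (\<lambda>x. frechet_derivative (\<lambda>x. f (b + l x)) (at x) v)" for v
    by (intro Ck_on_cong assms(3)) (simp add: frechet_derivative_at[OF h, symmetric])
  ultimately show ?case using h by (auto simp: differentiable_def)
qed

lemma smooth_on_compose_affine:
  assumes "bounded_linear l" "\<And>x. x \<in> U' \<Longrightarrow> b + l x \<in> U" "open U'" "smooth_on U f"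
  shows "smooth_on U' (\<lambda>x. f (b + l x))"
  using assms Ck_on_compose_affine unfolding smooth_on_def by blast

lemma smooth_on_const: "smooth_on U (\<lambda>x. a)"
proof -
  have "Ck_on k U (\<lambda>x. a)" for k
    by (induction k arbitrary: a) (auto simp: frechet_derivative_const)
  then show ?thesis by (simp add: smooth_on_def)
qed

lemma smooth_on_Pair_const: "smooth_on U (\<lambda>x. (x, a))"
  unfolding smooth_on_def
proof
  fix k
  have h: "((\<lambda>x. (x, a)) has_derivative (\<lambda>v. (v, 0))) (at x)" for x
    by (auto intro!: derivative_eq_intros)
  show "Ck_on k U (\<lambda>x. (x, a))"
  proof (cases k)
    case 0
    then show ?thesis by (auto intro!: continuous_intros)
  next
    case (Suc j)
    then show ?thesis
      using h smooth_on_const[of U] unfolding smooth_on_def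
      by (auto simp: differentiable_def frechet_derivative_at[OF h, symmetric])
  qed
qed

section \<open>Restrictions of atlases\<close>

lemma points_restrict: "points (restrict_atlas A S) = points A \<inter> S"
  by (auto simp: points_def restrict_atlas_def)

lemma openin_restrict:
  assumes A: "diff_atlas A"
  shows "openin (manifold_topology (restrict_atlas A S)) W \<longleftrightarrow> W \<subseteq> S \<and> openin (manifold_topology A) W"
proof -
  have "inj_on (snd c) (fst c)" if "c \<in> restrict_atlas A S" for c
    using that diff_atlas_inj[OF A] unfolding restrict_atlas_def
    by (elim imageE) (metis Int_lower1 fst_conv inj_on_subset snd_conv)
  then have "openin (manifold_topology (restrict_atlas A S)) W \<longleftrightarrow>
      W \<subseteq> points A \<inter> S \<and> (\<forall>c\<in>A. open (snd c ` (W \<inter> (fst c \<inter> S))))"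
    by (subst openin_manifold_topology) (auto simp: points_restrict, auto simp: restrict_atlas_def)
  moreover have "W \<inter> (fst c \<inter> S) = W \<inter> fst c" if "W \<subseteq> S" for c :: "('a, 'b) chart"
    using that by auto
  ultimately show ?thesis by (auto simp: openin_diff_atlas[OF A])
qed

text \<open>Restricting the domain changes \<open>inv_into\<close>, hence \<open>chart_inv\<close>
  as a total function; on coordinates of points of the smaller domain both versions return the same
  point.\<close>

lemma chart_inv_restrict:
  assumes "diff_atlas A" "c \<in> A" "x \<in> fst c" "x \<in> S"
  shows "chart_inv (fst c \<inter> S, snd c) (snd c x) = x"
  using assms diff_atlas_inj[OF assms(1,2)]
  by (intro chart_inv_chart[of "(fst c \<inter> S, snd c)", simplified]) (auto intro: inj_on_subset)

lemma smooth_map_restrict_mdifferentiable: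
  assumes A: "diff_atlas A" and F: "smooth_map (restrict_atlas A S) B F"
    and x: "x \<in> points A" "x \<in> S"
  shows "mdifferentiable A B F x"
proof -
  obtain c c' W where c: "c \<in> A" and c': "c' \<in> B"
    and W: "openin (manifold_topology (restrict_atlas A S)) W" "x \<in> W" "W \<subseteq> fst c \<inter> S" "F ` W \<subseteq> fst c'"
    and s: "smooth_on (snd c ` W) (snd c' \<circ> F \<circ> chart_inv (fst c \<inter> S, snd c))"
  proof -
    have "x \<in> points (restrict_atlas A S)" using x by (simp add: points_restrict)
    then obtain d c' W where "d \<in> restrict_atlas A S" "c' \<in> B"
      "openin (manifold_topology (restrict_atlas A S)) W" "x \<in> W" "W \<subseteq> fst d" "F ` W \<subseteq> fst c'"
      "smooth_on (snd d ` W) (snd c' \<circ> F \<circ> chart_inv d)"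
      using F unfolding smooth_map_def by meson
    moreover from this(1) obtain c where "c \<in> A" "d = (fst c \<inter> S, snd c)"
      unfolding restrict_atlas_def by blast
    ultimately show thesis using that[of c c' W] by simp
  qed
  have W': "openin (manifold_topology A) W" using W(1) by (simp add: openin_restrict[OF A])
  have xc: "x \<in> fst c" using W by auto
  have ev: "\<forall>\<^sub>F z in nhds (snd c x). chart_inv c z \<in> W \<and> chart_inv (fst c \<inter> S, snd c) z = chart_inv c z"
    using eventually_chart_inv[OF A c W' W(2) xc]
  proof eventually_elim
    case (elim z)
    then have "chart_inv c z \<in> S" using W(3) by blast
    with elim show ?case using chart_inv_restrict[OF A c, of "chart_inv c z" S] by simp
  qed
  have "(snd c' \<circ> F \<circ> chart_inv (fst c \<inter> S, snd c)) differentiable (at (snd c x))"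
    using s W(2) by (intro smooth_on_imp_differentiable) auto
  then have "(snd c' \<circ> F \<circ> chart_inv c) differentiable (at (snd c x))"
    by (rule differentiable_eventually_cong) (use ev in eventually_elim, simp)
  moreover have "\<forall>\<^sub>F z in nhds (snd c x). F (chart_inv c z) \<in> fst c'"
    using ev by eventually_elim (use W(4) in auto)
  ultimately show ?thesis unfolding mdifferentiable_def using c c' xc W by blast
qed

lemma restrict_atlas_UNIV [simp]: "restrict_atlas A UNIV = A"
  by (simp add: restrict_atlas_def)

lemma smooth_map_mdifferentiable:
  "diff_atlas A \<Longrightarrow> smooth_map A B F \<Longrightarrow> x \<in> points A \<Longrightarrow> mdifferentiable A B F x"
  using smooth_map_restrict_mdifferentiable[of A UNIV B F x] by simp

lemma smooth_map_points: "smooth_map A B F \<Longrightarrow> x \<in> points A \<Longrightarrow> F x \<in> points B"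
  unfolding smooth_map_def points_def by (metis UN_iff image_subset_iff)

section \<open>Products of atlases\<close>

lemma prod_atlasI:
  "c \<in> A \<Longrightarrow> d \<in> B \<Longrightarrow> (fst c \<times> fst d, map_prod (snd c) (snd d)) \<in> prod_atlas A B"
  unfolding prod_atlas_def by blast

lemma prod_atlasE:
  assumes "p \<in> prod_atlas A B"
  obtains c d where "c \<in> A" "d \<in> B" "p = (fst c \<times> fst d, map_prod (snd c) (snd d))"
  using assms unfolding prod_atlas_def by blast

lemma points_prod: "points (prod_atlas A B) = points A \<times> points B"
proof (intro equalityI subsetI)
  fix z assume "z \<in> points (prod_atlas A B)"
  then obtain p where p: "p \<in> prod_atlas A B" "z \<in> fst p" by (auto simp: points_def)
  from p(1) obtain c d where "c \<in> A" "d \<in> B" "p = (fst c \<times> fst d, map_prod (snd c) (snd d))"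
    by (rule prod_atlasE)
  then show "z \<in> points A \<times> points B" using p(2) by (auto simp: points_def)
next
  fix z assume "z \<in> points A \<times> points B"
  then obtain c d where "c \<in> A" "d \<in> B" "z \<in> fst c \<times> fst d" by (auto simp: points_def)
  then show "z \<in> points (prod_atlas A B)" using prod_atlasI[of c A d B] unfolding points_def by force
qed

lemma chart_inv_prod:
  assumes "inj_on (snd c) (fst c)" "inj_on (snd c') (fst c')" "x \<in> fst c" "y \<in> fst c'"
  shows "chart_inv (fst c \<times> fst c', map_prod (snd c) (snd c')) (snd c x, snd c' y) = (x, y)"
  using assms chart_inv_chart[of "(fst c \<times> fst c', map_prod (snd c) (snd c'))" "(x, y)"]
  by (simp add: map_prod_inj_on)

lemma mdifferentiable_prodD:
  assumes "mdifferentiable A (prod_atlas B C) F x"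
  shows "mdifferentiable A B (\<lambda>y. fst (F y)) x" "mdifferentiable A C (\<lambda>y. snd (F y)) x"
proof -
  obtain c p where c: "c \<in> A" "x \<in> fst c" and p: "p \<in> prod_atlas B C" "F x \<in> fst p"
    "\<forall>\<^sub>F z in nhds (snd c x). F (chart_inv c z) \<in> fst p"
    "(snd p \<circ> F \<circ> chart_inv c) differentiable (at (snd c x))"
    using assms unfolding mdifferentiable_def by blast
  from p(1) obtain b d where b0: "b \<in> B" "d \<in> C" "p = (fst b \<times> fst d, map_prod (snd b) (snd d))"
    by (rule prod_atlasE)
  with p have b: "b \<in> B" "d \<in> C" "F x \<in> fst b \<times> fst d"
    and ev: "\<forall>\<^sub>F z in nhds (snd c x). F (chart_inv c z) \<in> fst b \<times> fst d"
    and h: "(map_prod (snd b) (snd d) \<circ> F \<circ> chart_inv c) differentiable (at (snd c x))"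
    by simp_all
  have "(\<lambda>z. fst ((map_prod (snd b) (snd d) \<circ> F \<circ> chart_inv c) z)) differentiable (at (snd c x))"
    "(\<lambda>z. snd ((map_prod (snd b) (snd d) \<circ> F \<circ> chart_inv c) z)) differentiable (at (snd c x))"
    using h unfolding differentiable_def by (blast intro: has_derivative_fst has_derivative_snd)+
  then have "(snd b \<circ> (\<lambda>y. fst (F y)) \<circ> chart_inv c) differentiable (at (snd c x))"
    "(snd d \<circ> (\<lambda>y. snd (F y)) \<circ> chart_inv c) differentiable (at (snd c x))"
    by (simp_all add: o_def)
  moreover have "\<forall>\<^sub>F z in nhds (snd c x). fst (F (chart_inv c z)) \<in> fst b"
    "\<forall>\<^sub>F z in nhds (snd c x). snd (F (chart_inv c z)) \<in> fst d"
    using ev by (eventually_elim; auto)+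
  ultimately show "mdifferentiable A B (\<lambda>y. fst (F y)) x" "mdifferentiable A C (\<lambda>y. snd (F y)) x"
    unfolding mdifferentiable_def using c b by (auto simp: mem_Times_iff)
qed

lemma mdifferentiable_Pair:
  assumes A: "diff_atlas A" and B: "diff_atlas B" and C: "diff_atlas C"
    and F: "mdifferentiable A B F x" and G: "mdifferentiable A C G x"
  shows "mdifferentiable A (prod_atlas B C) (\<lambda>y. (F y, G y)) x"
proof -
  obtain c b where c: "c \<in> A" "x \<in> fst c" and b: "b \<in> B" "F x \<in> fst b"
    using F unfolding mdifferentiable_def by blast
  obtain d where d: "d \<in> C" "G x \<in> fst d" using G unfolding mdifferentiable_def by blast
  note f = mdifferentiable_in_charts[OF A B F c b] and g = mdifferentiable_in_charts[OF A C G c d]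
  have "(map_prod (snd b) (snd d) \<circ> (\<lambda>y. (F y, G y)) \<circ> chart_inv c) differentiable (at (snd c x))"
  proof -
    have "(\<lambda>z. ((snd b \<circ> F \<circ> chart_inv c) z, (snd d \<circ> G \<circ> chart_inv c) z)) differentiable (at (snd c x))"
      using f(2) g(2) unfolding differentiable_def by (blast intro: has_derivative_Pair)
    then show ?thesis by (simp add: o_def)
  qed
  moreover have "\<forall>\<^sub>F z in nhds (snd c x). (F (chart_inv c z), G (chart_inv c z)) \<in> fst b \<times> fst d"
    using f(1) g(1) by eventually_elim auto
  moreover have "(fst b \<times> fst d, map_prod (snd b) (snd d)) \<in> prod_atlas B C"
    using b d by (auto intro: prod_atlasI)
  ultimately show ?thesis
    unfolding mdifferentiable_def using c b d
    by (intro bexI[of _ c] bexI[of _ "(fst b \<times> fst d, map_prod (snd b) (snd d))"]) auto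
qed

lemma diff_atlas_prod:
  assumes A: "diff_atlas A" and B: "diff_atlas B"
  shows "diff_atlas (prod_atlas A B)"
  unfolding diff_atlas_def
proof (intro conjI ballI)
  fix c assume "c \<in> prod_atlas A B"
  then obtain a b where "a \<in> A" "b \<in> B" "c = (fst a \<times> fst b, map_prod (snd a) (snd b))"
    by (rule prod_atlasE)
  then show "inj_on (snd c) (fst c)"
    by (simp add: map_prod_inj_on diff_atlas_inj[OF A] diff_atlas_inj[OF B])
next
  fix p q assume "p \<in> prod_atlas A B" "q \<in> prod_atlas A B"
  then obtain a b a' b' where p: "p = (fst a \<times> fst b, map_prod (snd a) (snd b))" "a \<in> A" "b \<in> B"
    and q: "q = (fst a' \<times> fst b', map_prod (snd a') (snd b'))" "a' \<in> A" "b' \<in> B"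
    by (metis prod_atlasE)
  have "snd p ` (fst p \<inter> fst q) = (snd a ` (fst a \<inter> fst a')) \<times> (snd b ` (fst b \<inter> fst b'))"
    using p q by (force simp: map_prod_def)
  then show "open (snd p ` (fst p \<inter> fst q))"
    using A B p q by (auto simp: diff_atlas_def intro!: open_Times)
  fix z assume z: "z \<in> fst p \<inter> fst q"
  obtain x y where xy: "z = (x, y)" by (cases z)
  with z p q have x: "x \<in> fst a" "x \<in> fst a'" and y: "y \<in> fst b" "y \<in> fst b'" by auto
  let ?g = "snd a' \<circ> chart_inv a" and ?h = "snd b' \<circ> chart_inv b"
  have g: "?g differentiable (at (snd a x))" and h: "?h differentiable (at (snd b y))"
    using diff_atlas_transition[OF A p(2) q(2) x] diff_atlas_transition[OF B p(3) q(3) y] .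
  have "(\<lambda>w. (?g (fst w), ?h (snd w))) differentiable (at (snd a x, snd b y))"
  proof -
    have "(?g \<circ> fst) differentiable (at (snd a x, snd b y))"
      by (intro differentiable_chain_at) (use g in \<open>auto intro!: bounded_linear_imp_differentiable bounded_linear_fst\<close>)
    moreover have "(?h \<circ> snd) differentiable (at (snd a x, snd b y))"
      by (intro differentiable_chain_at) (use h in \<open>auto intro!: bounded_linear_imp_differentiable bounded_linear_snd\<close>)
    ultimately obtain D E where "((\<lambda>w. ?g (fst w)) has_derivative D) (at (snd a x, snd b y))"
      "((\<lambda>w. ?h (snd w)) has_derivative E) (at (snd a x, snd b y))"
      by (auto simp: differentiable_def o_def)
    from has_derivative_Pair[OF this] show ?thesis unfolding differentiable_def by blast
  qed
  moreover have "\<forall>\<^sub>F w in nhds (snd a x, snd b y). (snd q \<circ> chart_inv p) w = (?g (fst w), ?h (snd w))"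
  proof -
    have "\<forall>\<^sub>F w in nhds (snd a x, snd b y). w \<in> snd a ` fst a \<times> snd b ` fst b"
      using diff_atlas_domain_open[OF A p(2)] diff_atlas_domain_open[OF B p(3)] x y
      by (intro eventually_nhds_in_open open_Times) auto
    then show ?thesis
    proof eventually_elim
      case (elim w)
      then obtain u v where "w = (snd a u, snd b v)" "u \<in> fst a" "v \<in> fst b" by auto
      then show ?case
        using p q chart_inv_prod[OF diff_atlas_inj[OF A p(2)] diff_atlas_inj[OF B p(3)], of u v]
        by (simp add: diff_atlas_chart_inv[OF A p(2)] diff_atlas_chart_inv[OF B p(3)])
    qed
  qed
  ultimately show "(snd q \<circ> chart_inv p) differentiable (at (snd p z))"
    using differentiable_eventually_cong xy p by fastforce
qed

lemma mdifferentiable_const: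
  assumes "x \<in> points A" "b \<in> points B" shows "mdifferentiable A B (\<lambda>y. b) x"
  using assms unfolding mdifferentiable_def points_def by (fastforce simp: o_def)

lemma mdifferentiable_id:
  assumes A: "diff_atlas A" and x: "x \<in> points A" shows "mdifferentiable A A (\<lambda>y. y) x"
proof -
  obtain c where c: "c \<in> A" "x \<in> fst c" using x by (auto simp: points_def)
  have ev: "\<forall>\<^sub>F z in nhds (snd c x). chart_inv c z \<in> fst c \<and> snd c (chart_inv c z) = z"
    using eventually_chart_inv[OF A c(1) openin_chart_domain[OF A c(1)] c(2,2)] by eventually_elim auto
  have "(snd c \<circ> (\<lambda>y. y) \<circ> chart_inv c) differentiable (at (snd c x))"
    by (rule differentiable_eventually_cong[OF differentiable_ident]) (use ev in eventually_elim, simp)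
  moreover have "\<forall>\<^sub>F z in nhds (snd c x). chart_inv c z \<in> fst c" using ev by eventually_elim simp
  ultimately show ?thesis unfolding mdifferentiable_def using c by auto
qed

lemma limitin_Pair_prod:
  assumes A: "diff_atlas A" and B: "diff_atlas B"
    and a: "limitin (manifold_topology A) f x F" and b: "limitin (manifold_topology B) g y F"
  shows "limitin (manifold_topology (prod_atlas A B)) (\<lambda>t. (f t, g t)) (x, y) F"
proof -
  obtain c d where c: "c \<in> A" "x \<in> fst c" and d: "d \<in> B" "y \<in> fst d"
    using a b topspace_diff_atlas[OF A] topspace_diff_atlas[OF B] by (auto simp: limitin_def points_def)
  have "(fst c \<times> fst d, map_prod (snd c) (snd d)) \<in> prod_atlas A B"
    using c d by (intro prod_atlasI)
  moreover have "\<forall>\<^sub>F t in F. f t \<in> fst c \<and> g t \<in> fst d"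
    using a b limitin_chart_iff[OF A c] limitin_chart_iff[OF B d] by (auto simp: eventually_conj_iff)
  moreover have "((\<lambda>t. (snd c (f t), snd d (g t))) \<longlongrightarrow> (snd c x, snd d y)) F"
    using a b unfolding limitin_chart_iff[OF A c] limitin_chart_iff[OF B d] by (intro tendsto_Pair) auto
  ultimately show ?thesis
    using limitin_chart_iff[OF diff_atlas_prod[OF A B], of "(fst c \<times> fst d, map_prod (snd c) (snd d))" "(x, y)" "\<lambda>t. (f t, g t)" F]
      c d by (simp add: case_prod_unfold map_prod_def)
qed

section \<open>Open subsets of normed spaces as manifolds\<close>

lemma diff_atlas_std_open:
  fixes I :: "'e::real_normed_vector set"
  assumes I: "open I"
  shows "diff_atlas (std_atlas I)"
proof -
  have "((\<lambda>x. x) \<circ> chart_inv (I, \<lambda>x. x)) differentiable (at x)" if "x \<in> I" for x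
  proof (rule differentiable_eventually_cong[OF differentiable_ident])
    show "\<forall>\<^sub>F z in nhds x. ((\<lambda>x. x) \<circ> chart_inv (I, \<lambda>x. x)) z = z"
      using eventually_nhds_in_open[OF I that]
      by eventually_elim (simp add: chart_inv_chart[of "(I, \<lambda>x. x)", simplified])
  qed
  then show ?thesis using I by (simp add: diff_atlas_def std_atlas_def)
qed

lemma diff_atlas_std: "diff_atlas (std_atlas UNIV)"
  by (rule diff_atlas_std_open) simp

lemma mdifferentiable_std_iff:
  assumes A: "diff_atlas A" and c: "c \<in> A" "x \<in> fst c"
  shows "mdifferentiable A (std_atlas UNIV) f x \<longleftrightarrow> (f \<circ> chart_inv c) differentiable (at (snd c x))"
proof
  assume "mdifferentiable A (std_atlas UNIV) f x"
  from mdifferentiable_in_charts(2)[OF A diff_atlas_std this c, of "(UNIV, \<lambda>x. x)"]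
  show "(f \<circ> chart_inv c) differentiable (at (snd c x))" by (simp add: std_atlas_def o_def)
next
  assume "(f \<circ> chart_inv c) differentiable (at (snd c x))"
  then show "mdifferentiable A (std_atlas UNIV) f x"
    using c unfolding mdifferentiable_def by (auto simp: std_atlas_def o_def)
qed

text \<open>Inverse to reading off the component in \<open>c\<close>. With
  \<open>tangent_vector_eqI\<close> it identifies the tangent space at \<open>x\<close> with the
  model space.\<close>

definition tangent_vector :: "('a, 'e::real_normed_vector) atlas \<Rightarrow> ('a, 'e) chart \<Rightarrow> 'a \<Rightarrow> 'e \<Rightarrow> ('a, 'e) tangent" where
  "tangent_vector A c x w = (\<lambda>c'. if c' \<in> A \<and> x \<in> fst c' then
     frechet_derivative (snd c' \<circ> chart_inv c) (at (snd c x)) w else 0)"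

lemma frechet_derivative_self_transition:
  assumes A: "diff_atlas A" and c: "c \<in> A" "x \<in> fst c"
  shows "frechet_derivative (snd c \<circ> chart_inv c) (at (snd c x)) w = w"
proof -
  have ev: "\<forall>\<^sub>F z in nhds (snd c x). (snd c \<circ> chart_inv c) z = z"
    using eventually_chart_inv[OF A c(1) openin_chart_domain[OF A c(1)] c(2,2)] by eventually_elim simp
  show ?thesis
    using fun_cong[OF frechet_derivative_at[OF has_derivative_eventually_cong[OF has_derivative_ident ev]], of w]
    by (rule sym)
qed

lemma tangent_vector_chart:
  "diff_atlas A \<Longrightarrow> c \<in> A \<Longrightarrow> x \<in> fst c \<Longrightarrow> tangent_vector A c x w c = w"
  by (simp add: tangent_vector_def frechet_derivative_self_transition)

lemma tangent_vector_in:
  assumes A: "diff_atlas A" and c: "c \<in> A" "x \<in> fst c"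
  shows "tangent_vector A c x w \<in> tangent_space A x"
  unfolding tangent_space_def
proof (intro CollectI conjI ballI impI allI)
  fix c1 c2 assume c1: "c1 \<in> A" and c2: "c2 \<in> A" and x: "x \<in> fst c1" "x \<in> fst c2"
  show "tangent_vector A c x w c2 =
    frechet_derivative (snd c2 \<circ> chart_inv c1) (at (snd c1 x)) (tangent_vector A c x w c1)"
    using frechet_derivative_transition(2)[OF A c c1 x(1) diff_atlas_transition[OF A c1 c2 x]] c1 c2 x
    by (simp add: tangent_vector_def)
qed (auto simp: tangent_vector_def)

lemma tangent_space_transition:
  assumes "\<tau> \<in> tangent_space A x" "c \<in> A" "c' \<in> A" "x \<in> fst c" "x \<in> fst c'"
  shows "\<tau> c' = frechet_derivative (snd c' \<circ> chart_inv c) (at (snd c x)) (\<tau> c)"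
  using assms unfolding tangent_space_def by blast

lemma tangent_vector_eqI:
  assumes "\<tau> \<in> tangent_space A x" "\<tau>' \<in> tangent_space A x" "c \<in> A" "x \<in> fst c" "\<tau> c = \<tau>' c"
  shows "\<tau> = \<tau>'"
proof
  fix d show "\<tau> d = \<tau>' d"
  proof (cases "d \<in> A \<and> x \<in> fst d")
    case True
    then have "\<tau> d = frechet_derivative (snd d \<circ> chart_inv c) (at (snd c x)) (\<tau> c)"
      "\<tau>' d = frechet_derivative (snd d \<circ> chart_inv c) (at (snd c x)) (\<tau>' c)"
      using assms(3,4) by (auto intro: tangent_space_transition assms(1,2))
    then show ?thesis by (simp only: assms(5))
  next
    case False
    then have "\<tau> d = 0" "\<tau>' d = 0" using assms(1,2) unfolding tangent_space_def by blast+
    then show ?thesis by simp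
  qed
qed

lemma tangent_space_zero:
  assumes A: "diff_atlas A" shows "(\<lambda>c. 0) \<in> tangent_space A x"
  unfolding tangent_space_def
  using diff_atlas_transition[OF A] by (auto simp: linear_frechet_derivative linear_0)

lemma chart_at:
  "x \<in> points A \<Longrightarrow> chart_at A x \<in> A \<and> x \<in> fst (chart_at A x)"
  unfolding chart_at_def points_def by (rule someI_ex) auto

text \<open>\<open>differential\<close> computes in the chart picked by \<open>chart_at\<close>; the
  compatibility of the components of \<open>\<tau>\<close> cancels the transition derivative that
  the chain rule produces.\<close>

lemma differential_in_chart:
  assumes A: "diff_atlas A" and c: "c \<in> A" "x \<in> fst c" and f: "mdifferentiable A (std_atlas UNIV) f x"
    and \<tau>: "\<tau> \<in> tangent_space A x"
  shows "differential A f x \<tau> = frechet_derivative (f \<circ> chart_inv c) (at (snd c x)) (\<tau> c)"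
proof -
  let ?c = "chart_at A x"
  have c0: "?c \<in> A" "x \<in> fst ?c" using chart_at[of x A] c by (auto simp: points_def)
  have "differential A f x \<tau> = frechet_derivative (f \<circ> chart_inv ?c) (at (snd ?c x))
      (frechet_derivative (snd ?c \<circ> chart_inv c) (at (snd c x)) (\<tau> c))"
    using tangent_space_transition[OF \<tau> c(1) c0(1) c(2) c0(2)] by (simp add: differential_def)
  also have "\<dots> = frechet_derivative (f \<circ> chart_inv c) (at (snd c x)) (\<tau> c)"
    using f mdifferentiable_std_iff[OF A c0] by (intro frechet_derivative_transition(2)[OF A c c0, symmetric]) auto
  finally show ?thesis .
qed

section \<open>Continuity of curves in a Lie subgroup\<close>

lemma bounded_bilinear_matrix_mult:
  "bounded_bilinear (\<lambda>(A::real^'n^'m) (B::real^'p^'n). A ** B)"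
  unfolding bilinear_conv_bounded_bilinear[symmetric] bilinear_def
  by (auto intro!: linearI
      simp: matrix_matrix_mult_def vec_eq_iff sum.distrib sum_distrib_left algebra_simps)

lemma matrix_inv_mult:
  fixes A :: "real^'n^'n"
  assumes "invertible A" shows "A ** matrix_inv A = mat 1" "matrix_inv A ** A = mat 1"
proof -
  have "A ** matrix_inv A = mat 1 \<and> matrix_inv A ** A = mat 1"
    unfolding matrix_inv_def using assms[unfolded invertible_def] by (rule someI_ex)
  then show "A ** matrix_inv A = mat 1" "matrix_inv A ** A = mat 1" by auto
qed

lemma immersion_curve_derivative:
  fixes j :: "'e::real_normed_vector \<Rightarrow> 'f::euclidean_space"
  assumes j: "(j has_derivative J) (at z0)" and J: "inj J"
    and z: "(z \<longlongrightarrow> z0) (at t0 within I)" and z0: "z t0 = z0"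
    and d: "((\<lambda>t. j (z t)) has_vector_derivative J \<zeta>) (at t0 within I)"
  shows "(z has_vector_derivative \<zeta>) (at t0 within I)"
proof -
  have "linear J" using j has_derivative_linear by blast
  then obtain L where L: "linear L" "L \<circ> J = id"
    using linear_injective_left_inverse[OF _ J] by auto
  have bL: "bounded_linear L" using L(1) by (simp add: linear_conv_bounded_linear)
  have LJ: "L (J v) = v" for v using L(2) by (metis comp_apply id_apply)
  define r where "r w = (w - z0) - L (j w - j z0)" for w
  define q where "q t = L (j (z t) - j z0)" for t
  have "(r has_derivative (\<lambda>v. (v - 0) - L (J v - 0))) (at z0)"
    unfolding r_def
    by (intro derivative_intros j bounded_linear.has_derivative[OF bL])
  then have r: "(r has_derivative (\<lambda>v. 0)) (at z0)" by (simp add: LJ)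
  have "(q has_derivative (\<lambda>x. L (x *\<^sub>R J \<zeta> - 0))) (at t0 within I)"
    unfolding q_def using d unfolding has_vector_derivative_def
    by (intro derivative_intros bounded_linear.has_derivative[OF bL])
  then have q: "(q has_derivative (\<lambda>x. x *\<^sub>R \<zeta>)) (at t0 within I)"
    by (simp add: linear_scale[OF L(1)] LJ)
  \<comment> \<open>A linear growth bound for \<open>q\<close> near \<open>t0\<close>: its
    derivative contributes \<open>norm \<zeta>\<close>, and the error estimate is taken with
    tolerance 1.\<close>
  define K where "K = norm \<zeta> + 1"
  have K: "K > 0" unfolding K_def by (simp add: add_nonneg_pos)
  have "q t0 = 0" by (simp add: q_def z0 linear_0[OF L(1)])
  have "((\<lambda>t. r (z t)) has_derivative (\<lambda>x. 0)) (at t0 within I)"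
    unfolding has_derivative_within_alt
  proof (intro conjI allI impI)
    show "bounded_linear (\<lambda>x::real. 0)" by simp
    fix e :: real assume e: "e > 0"
    \<comment> \<open>The bound 1/2 permits the absorption; the bound e / (2K) compensates the
      resulting Lipschitz constant 2K of \<open>z\<close>.\<close>
    define e' where "e' = min (1/2) (e / (2 * K))"
    have e': "e' > 0" "e' \<le> 1/2" "e' * (2 * K) \<le> e"
      using e K by (auto simp: e'_def min_def field_simps)
    obtain d1 where d1: "d1 > 0" "\<And>w. norm (w - z0) < d1 \<Longrightarrow> norm (r w) \<le> e' * norm (w - z0)"
      using r e'(1) unfolding has_derivative_at_alt r_def by (auto simp: linear_0[OF L(1)])
    obtain d2 where d2: "d2 > 0" "\<And>t. t \<in> I \<Longrightarrow> norm (t - t0) < d2 \<Longrightarrow>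
        norm (q t - q t0 - (t - t0) *\<^sub>R \<zeta>) \<le> 1 * norm (t - t0)"
      using q unfolding has_derivative_within_alt by (metis zero_less_one)
    have "\<forall>\<^sub>F t in at t0 within I. dist (z t) z0 < d1" using z d1(1) by (rule tendstoD)
    then obtain d3 where d3: "d3 > 0" "\<And>t. t \<in> I \<Longrightarrow> t \<noteq> t0 \<Longrightarrow> dist t t0 < d3 \<Longrightarrow> dist (z t) z0 < d1"
      unfolding eventually_at by blast
    show "\<exists>d>0. \<forall>t\<in>I. norm (t - t0) < d \<longrightarrow> norm (r (z t) - r (z t0) - 0) \<le> e * norm (t - t0)"
    proof (intro exI[of _ "min d2 d3"] conjI ballI impI)
      fix t assume t: "t \<in> I" "norm (t - t0) < min d2 d3"
      have near: "norm (z t - z0) < d1"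
        using d3(2)[OF t(1)] t(2) d1(1) z0 by (cases "t = t0") (auto simp: dist_norm)
      note rb = d1(2)[OF near]
      have "norm (q t) \<le> norm (q t - (t - t0) *\<^sub>R \<zeta>) + norm ((t - t0) *\<^sub>R \<zeta>)"
        by (metis diff_add_cancel norm_triangle_ineq)
      also have "\<dots> \<le> K * norm (t - t0)"
      proof -
        have "norm ((t - t0) *\<^sub>R \<zeta>) = norm \<zeta> * norm (t - t0)" by simp
        moreover have "norm (q t - (t - t0) *\<^sub>R \<zeta>) \<le> norm (t - t0)"
          using d2(2)[OF t(1)] t(2) \<open>q t0 = 0\<close> by simp
        ultimately show ?thesis by (simp only: K_def distrib_right)
      qed
      finally have qb: "norm (q t) \<le> K * norm (t - t0)" .
      have "z t - z0 = q t + r (z t)" by (simp add: q_def r_def)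
      then have "norm (z t - z0) \<le> norm (q t) + norm (r (z t))" by (metis norm_triangle_ineq)
      also have "\<dots> \<le> K * norm (t - t0) + 1/2 * norm (z t - z0)"
        using qb rb mult_right_mono[OF e'(2), of "norm (z t - z0)"] by simp
      finally have zb: "norm (z t - z0) \<le> 2 * K * norm (t - t0)" by simp
      have "norm (r (z t)) \<le> e' * (2 * K * norm (t - t0))"
        using rb mult_left_mono[OF zb, of e'] e' by linarith
      also have "\<dots> \<le> e * norm (t - t0)"
        using mult_right_mono[OF e'(3), of "norm (t - t0)"] by (simp add: mult.assoc)
      finally show "norm (r (z t) - r (z t0) - 0) \<le> e * norm (t - t0)"
        by (simp add: z0 r_def linear_0[OF L(1)])
    qed (use d2 d3 in auto)
  qed
  then have "((\<lambda>t. z0 + q t + r (z t)) has_derivative (\<lambda>x. 0 + x *\<^sub>R \<zeta> + 0)) (at t0 within I)"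
    by (intro derivative_intros q)
  then show ?thesis by (simp add: has_vector_derivative_def q_def r_def)
qed

text \<open>Choosing a nonempty member of a countable basis inside each set embeds the index set
  into that basis, by disjointness.\<close>

lemma second_countable_disjoint_family_countable:
  assumes X: "second_countable X" and O: "\<And>i. i \<in> I \<Longrightarrow> openin X (S i)" "\<And>i. i \<in> I \<Longrightarrow> S i \<noteq> {}"
    and dis: "disjoint_family_on S I"
  shows "countable I"
proof -
  obtain \<B> where \<B>: "countable \<B>" "\<And>U x. openin X U \<Longrightarrow> x \<in> U \<Longrightarrow> \<exists>V\<in>\<B>. x \<in> V \<and> V \<subseteq> U"
    using X unfolding second_countable_def by metis
  have "\<exists>V. V \<in> \<B> \<and> V \<noteq> {} \<and> V \<subseteq> S i" if "i \<in> I" for i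
    using \<B>(2)[OF O(1)[OF that]] O(2)[OF that] by blast
  then obtain b where b: "\<And>i. i \<in> I \<Longrightarrow> b i \<in> \<B> \<and> b i \<noteq> {} \<and> b i \<subseteq> S i" by metis
  have "inj_on b I"
  proof (rule inj_onI, rule ccontr)
    fix i k assume "i \<in> I" "k \<in> I" "b i = b k" "i \<noteq> k"
    then show False using b[of i] b[of k] dis unfolding disjoint_family_on_def by blast
  qed
  moreover have "countable (b ` I)" using b \<B>(1) by (auto intro: countable_subset)
  ultimately show ?thesis by (rule countable_image_inj_on[rotated])
qed

section \<open>Lie subgroups of the general linear group, with their own topology\<close>

lemma lie_subgroup_diff_atlas: "lie_subgroup H HA \<Longrightarrow> diff_atlas HA"
  unfolding lie_subgroup_def by (blast intro: smooth_manifold_diff_atlas)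

lemma lie_subgroup_inverse:
  assumes "lie_subgroup H HA" "g \<in> H"
  shows "matrix_inv g \<in> H" "g ** matrix_inv g = mat 1" "matrix_inv g ** g = mat 1"
  using assms matrix_inv_mult unfolding lie_subgroup_def by blast+

lemma lie_subgroup_mult: "lie_subgroup H HA \<Longrightarrow> g \<in> H \<Longrightarrow> h \<in> H \<Longrightarrow> g ** h \<in> H"
  unfolding lie_subgroup_def by blast

lemma lie_subgroup_points: "lie_subgroup H HA \<Longrightarrow> points HA = H"
  unfolding lie_subgroup_def by blast

lemma lie_subgroup_one: "lie_subgroup H HA \<Longrightarrow> mat 1 \<in> H"
  unfolding lie_subgroup_def by blast

lemma lie_subgroup_mdifferentiable_mult:
  assumes "lie_subgroup H HA" "g \<in> H" "h \<in> H"
  shows "mdifferentiable (prod_atlas HA HA) HA (\<lambda>(g, h). g ** h) (g, h)"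
  using assms lie_subgroup_diff_atlas[OF assms(1)]
  by (intro smooth_map_mdifferentiable diff_atlas_prod) (auto simp: lie_subgroup_def points_prod)

lemma lie_subgroup_mdifferentiable_left_mult:
  assumes H: "lie_subgroup H HA" and a: "a \<in> H" and q: "q \<in> H"
  shows "mdifferentiable HA HA (\<lambda>q. a ** q) q"
proof -
  note A = lie_subgroup_diff_atlas[OF H]
  have "mdifferentiable HA (prod_atlas HA HA) (\<lambda>q. (a, q)) q"
    using a q lie_subgroup_points[OF H] by (intro mdifferentiable_Pair mdifferentiable_const mdifferentiable_id A) auto
  from mdifferentiable_compose[OF diff_atlas_prod[OF A A] A A this lie_subgroup_mdifferentiable_mult[OF H a q]]
  show ?thesis by simp
qed

text \<open>The translate is the preimage under translation by the inverse of \<open>a\<close>,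
  which is continuous for the topology of \<open>HA\<close>. It carries pieces of \<open>H\<close>
  near the identity to the other slices.\<close>

lemma lie_subgroup_openin_left_mult:
  assumes H: "lie_subgroup H HA" and a: "a \<in> H" and S: "openin (manifold_topology HA) S"
  shows "openin (manifold_topology HA) ((**) a ` S)"
proof (subst openin_subopen, intro ballI)
  note A = lie_subgroup_diff_atlas[OF H]
  fix x assume "x \<in> (**) a ` S"
  then obtain s where s: "s \<in> S" "x = a ** s" by blast
  have SH: "S \<subseteq> H"
    using openin_subset[OF S] topspace_diff_atlas[OF A] lie_subgroup_points[OF H] by simp
  note ai = lie_subgroup_inverse[OF H a]
  have xH: "x \<in> H" using s SH a lie_subgroup_mult[OF H] by blast
  have "matrix_inv a ** x \<in> S" using s ai by (simp add: matrix_mul_assoc)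
  from mdifferentiable_preimage_nhd[OF A A lie_subgroup_mdifferentiable_left_mult[OF H ai(1) xH] S this]
  obtain W where W: "openin (manifold_topology HA) W" "x \<in> W" "\<And>y. y \<in> W \<Longrightarrow> matrix_inv a ** y \<in> S"
    by blast
  have "y \<in> (**) a ` S" if "y \<in> W" for y
    using W(3)[OF that] ai by (intro image_eqI[of _ _ "matrix_inv a ** y"]) (simp_all add: matrix_mul_assoc)
  then show "\<exists>T. openin (manifold_topology HA) T \<and> x \<in> T \<and> T \<subseteq> (**) a ` S" using W by blast
qed

text \<open>Read in the chart \<open>c\<close>, the inclusion of \<open>H\<close> into the matrices
  is \<open>chart_inv c\<close>, so this derivative is the injective differential of the
  inclusion.\<close>

lemma lie_subgroup_immersed_one:
  assumes H: "lie_subgroup H HA" and c: "c \<in> HA" "mat 1 \<in> fst c"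
  shows "inj (frechet_derivative (chart_inv c) (at (snd c (mat 1))))"
proof -
  note A = lie_subgroup_diff_atlas[OF H]
  let ?D = "frechet_derivative (chart_inv c) (at (snd c (mat 1)))"
  have m: "mdifferentiable HA (std_atlas UNIV) (\<lambda>g. g) (mat 1)"
    using H A lie_subgroup_one[OF H] by (intro smooth_map_mdifferentiable) (auto simp: lie_subgroup_def)
  have inj: "inj_on (differential HA (\<lambda>g. g) (mat 1)) (tangent_space HA (mat 1))"
    using H lie_subgroup_one[OF H] by (auto simp: lie_subgroup_def)
  have eq: "differential HA (\<lambda>g. g) (mat 1) (tangent_vector HA c (mat 1) w) = ?D w" for w
    using differential_in_chart[OF A c m tangent_vector_in[OF A c]]
    by (simp add: tangent_vector_chart[OF A c] o_def)
  show ?thesis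
  proof (rule injI)
    fix v w assume "?D v = ?D w"
    then have "tangent_vector HA c (mat 1) v = tangent_vector HA c (mat 1) w"
      using inj eq tangent_vector_in[OF A c] by (metis inj_onD)
    then show "v = w" using tangent_vector_chart[OF A c] by metis
  qed
qed

text \<open>Near the identity the subgroup is a union of slices \<open>Y = const\<close>, each open in the topology
  of \<open>HA\<close>; second countability leaves only countably many of them.\<close>

lemma lie_subgroup_slices:
  fixes HA :: "(real^'n^'n, 'h::real_normed_vector) atlas"
  assumes H: "lie_subgroup H HA"
  obtains c V and Y :: "real^'n^'n \<Rightarrow> real^'n^'n" and \<zeta> :: "real^'n^'n \<Rightarrow> 'h"
  where "c \<in> HA" "mat 1 \<in> fst c" "open V" "mat 1 \<in> V" "continuous_on V Y" "continuous_on V \<zeta>"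
    "Y (mat 1) = 0" "countable (Y ` (V \<inter> H))"
    "\<And>k. k \<in> V \<Longrightarrow> Y k = 0 \<Longrightarrow> k \<in> fst c \<and> snd c k = \<zeta> k"
proof -
  note A = lie_subgroup_diff_atlas[OF H]
  have "smooth_map HA (std_atlas UNIV) (\<lambda>g. g)" "mat 1 \<in> points HA"
    using H by (auto simp: lie_subgroup_def)
  \<comment> \<open>The identity is the only chart of the target, so the coordinate expression of
    the inclusion is \<open>chart_inv c\<close> itself, a smooth matrix-valued parametrization of
    \<open>H\<close> near the identity.\<close>
  then obtain c W where c: "c \<in> HA" and W: "openin (manifold_topology HA) W" "mat 1 \<in> W" "W \<subseteq> fst c"
    and s: "smooth_on (snd c ` W) (chart_inv c)"
    unfolding smooth_map_def std_atlas_def by (force simp: o_def)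
  have oneC: "mat 1 \<in> fst c" using W by auto
  note ci = diff_atlas_chart_inv[OF A c]
  define j where "j = chart_inv c"
  define B where "B = snd c ` W"
  define z0 where "z0 = snd c (mat 1)"
  define D where "D z = frechet_derivative j (at z)" for z
  have B: "open B" "z0 \<in> B"
    using open_chart_image[OF A c W(1)] W by (auto simp: B_def z0_def Int_absorb2)
  have WH: "W \<subseteq> H"
    using openin_subset[OF W(1)] topspace_diff_atlas[OF A] lie_subgroup_points[OF H] by simp
  have jB: "j z \<in> W" "snd c (j z) = z" if "z \<in> B" for z
    using that ci W by (auto simp: B_def j_def)
  have jW: "j (snd c q) = q" "snd c q \<in> B" if "q \<in> W" for q
    using that ci W by (auto simp: B_def j_def)
  have C1: "Ck_on (Suc 0) B j" using s by (simp add: smooth_on_def B_def j_def)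
  have Dj: "(j has_derivative D z) (at z)" if "z \<in> B" for z
    using C1 that by (simp add: D_def frechet_derivative_works[symmetric])
  have Dcont: "continuous_on B (\<lambda>z. D z v)" for v using C1 by (simp add: D_def)
  have linD: "bounded_linear (D z)" if "z \<in> B" for z using Dj[OF that] has_derivative_bounded_linear by blast
  have "inj (D z0)" using lie_subgroup_immersed_one[OF H c oneC] by (simp add: D_def j_def z0_def)
  then obtain L where L: "linear L" "L \<circ> D z0 = id"
    using linear_injective_left_inverse linD[OF B(2)] bounded_linear.linear by metis
  have bL: "bounded_linear L" using L(1) by (simp add: linear_conv_bounded_linear)
  have LD: "L (D z0 v) = v" for v using L(2) by (metis comp_apply id_apply)
  \<comment> \<open>The range of \<open>D z0\<close> is the Lie algebra and
    \<open>D z0 \<circ> L\<close> projects onto it; \<open>T\<close> is the complementary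
    projection, onto the kernel of \<open>L\<close>.\<close>
  define T where "T v = v - D z0 (L v)" for v
  have bT: "bounded_linear T"
    unfolding T_def by (intro bounded_linear_sub bounded_linear_ident bounded_linear_compose[OF linD[OF B(2)] bL])
  have LT: "L (T v) = 0" for v by (simp add: T_def linear_diff[OF L(1)] LD)
  define U where "U = {x. z0 + L x \<in> B}"
  have contL: "continuous_on S (\<lambda>x. z0 + L x)" for S
    by (intro continuous_intros linear_continuous_on[OF bL])
  have U: "open U" "0 \<in> U"
  proof -
    have "U = (\<lambda>x. z0 + L x) -` B" by (auto simp: U_def)
    then show "open U" using B(1) contL[of UNIV] by (simp add: open_vimage)
    show "0 \<in> U" using B by (simp add: U_def linear_0[OF L(1)])
  qed
  \<comment> \<open>\<open>L x\<close> moves along \<open>H\<close> and \<open>T x\<close> across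
    it. With the transversal factor on the left, fixing \<open>T x = y\<close> leaves a left
    translate by 1 + y of a piece of \<open>H\<close>, which is open in \<open>H\<close> as soon as
    1 + y belongs to \<open>H\<close>.\<close>
  define \<Psi> where "\<Psi> x = (mat 1 + T x) ** j (z0 + L x)" for x
  define \<Psi>' where "\<Psi>' x v = (mat 1 + T x) ** D (z0 + L x) (L v) + T v ** j (z0 + L x)" for x v
  interpret mm: bounded_bilinear "\<lambda>(A::real^'n^'n) (B::real^'n^'n). A ** B"
    by (rule bounded_bilinear_matrix_mult)
  have der: "(\<Psi> has_derivative \<Psi>' x) (at x)" if x: "x \<in> U" for x
  proof -
    have "((\<lambda>x. z0 + L x) has_derivative L) (at x)"
      using bounded_linear_imp_has_derivative[OF bL, of "at x"] by (auto intro!: derivative_eq_intros)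
    moreover have "(j has_derivative D (z0 + L x)) (at (z0 + L x))" using x Dj by (simp add: U_def)
    ultimately have "((\<lambda>x. j (z0 + L x)) has_derivative (\<lambda>v. D (z0 + L x) (L v))) (at x)"
      using diff_chain_at by (fastforce simp: o_def)
    moreover have "((\<lambda>x. mat 1 + T x) has_derivative T) (at x)"
      using bounded_linear_imp_has_derivative[OF bT, of "at x"] by (auto intro!: derivative_eq_intros)
    ultimately show ?thesis
      unfolding \<Psi>_def \<Psi>'_def using mm.FDERIV by blast
  qed
  have app: "blinfun_apply (Blinfun (\<Psi>' x)) = \<Psi>' x" if "x \<in> U" for x
    using der[OF that] has_derivative_bounded_linear by (intro bounded_linear_Blinfun_apply) blast
  \<comment> \<open>On a finite-dimensional domain, continuity in operator norm can be tested on
    basis vectors, and \<open>Ck_on\<close> supplies exactly the continuity of the derivative in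
    each fixed direction.\<close>
  have cont: "continuous_on U (\<lambda>x. Blinfun (\<Psi>' x))"
  proof (rule continuous_on_blinfun_componentwise)
    fix i :: "real^'n^'n"
    have sub: "(\<lambda>x. z0 + L x) ` U \<subseteq> B" by (auto simp: U_def)
    have "continuous_on U (\<lambda>x. D (z0 + L x) (L i))"
      using continuous_on_compose2[OF Dcont contL sub] .
    moreover have "continuous_on B j"
      using Dj has_derivative_continuous by (intro continuous_at_imp_continuous_on) blast
    then have "continuous_on U (\<lambda>x. j (z0 + L x))"
      using continuous_on_compose2[OF _ contL sub] by blast
    moreover have "continuous_on U T" by (rule linear_continuous_on[OF bT])
    ultimately have "continuous_on U (\<lambda>x. \<Psi>' x i)"
      unfolding \<Psi>'_def by (intro continuous_intros mm.continuous_on)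
    then show "continuous_on U (\<lambda>x. blinfun_apply (Blinfun (\<Psi>' x)) i)"
      by (simp add: app cong: continuous_on_cong)
  qed
  have jz0: "j z0 = mat 1" using jW(1)[OF W(2)] by (simp add: z0_def)
  \<comment> \<open>At 0 the tangential part \<open>D z0 (L v)\<close> and the transversal part
    \<open>T v\<close> add up to \<open>v\<close>, so the inverse function theorem applies with the
    identity as inverse derivative.\<close>
  have "\<Psi>' 0 v = v" for v
    by (simp add: \<Psi>'_def linear_0[OF L(1)] linear_0[OF bounded_linear.linear[OF bT]] jz0)
       (simp add: T_def)
  then have "id_blinfun o\<^sub>L Blinfun (\<Psi>' 0) = id_blinfun"
    using app[OF U(2)] by (intro blinfun_eqI) simp
  with der app U obtain U' V g where U': "open U'" "U' \<subseteq> U" "0 \<in> U'"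
    and V: "open V" "\<Psi> 0 \<in> V" and hom: "homeomorphism U' V \<Psi> g"
    using inverse_function_theorem[OF U(1) _ cont U(2), of \<Psi> id_blinfun] by metis
  have \<Psi>0: "\<Psi> 0 = mat 1"
    by (simp add: \<Psi>_def linear_0[OF L(1)] linear_0[OF bounded_linear.linear[OF bT]] jz0)
  have g0: "g (mat 1) = 0" using hom U'(3) \<Psi>0 by (metis homeomorphism_apply1)
  have gU: "g k \<in> U'" "\<Psi> (g k) = k" if "k \<in> V" for k
    using hom that by (auto simp: homeomorphism_def)
  have contg: "continuous_on V g" using hom by (simp add: homeomorphism_def)
  define Y where "Y k = T (g k)" for k
  define \<zeta> where "\<zeta> k = z0 + L (g k)" for k
  have \<zeta>B: "\<zeta> k \<in> B" if "k \<in> V" for k using gU(1)[OF that] U'(2) by (auto simp: \<zeta>_def U_def)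
  have dec: "k = (mat 1 + Y k) ** j (\<zeta> k)" if "k \<in> V" for k
    using gU(2)[OF that] by (simp add: \<Psi>_def Y_def \<zeta>_def)
  \<comment> \<open>The slices are the level sets of \<open>Y\<close> in
    \<open>V \<inter> H\<close>: pairwise disjoint and nonempty. What remains is that each of them
    is open for \<open>HA\<close>.\<close>
  have "countable (Y ` (V \<inter> H))"
  proof (rule second_countable_disjoint_family_countable)
    show "second_countable (manifold_topology HA)" using H by (simp add: lie_subgroup_def smooth_manifold_def)
    define S where "S y = {k \<in> V \<inter> H. Y k = y}" for y
    show "disjoint_family_on S (Y ` (V \<inter> H))" by (auto simp: disjoint_family_on_def S_def)
    show "S y \<noteq> {}" if "y \<in> Y ` (V \<inter> H)" for y using that by (auto simp: S_def)
    fix y assume "y \<in> Y ` (V \<inter> H)"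
    then obtain k1 where k1: "k1 \<in> V" "k1 \<in> H" "y = Y k1" by blast
    have Ly: "L y = 0" by (simp add: k1 Y_def LT)
    have jk1: "j (\<zeta> k1) \<in> H" using jB(1)[OF \<zeta>B[OF k1(1)]] WH by blast
    \<comment> \<open>Solving k1 = (1 + y) j(\<zeta> k1) for the left factor puts it into the group,
      since the two other matrices are in \<open>H\<close>.\<close>
    have "mat 1 + y = k1 ** matrix_inv (j (\<zeta> k1))"
      using dec[OF k1(1)] lie_subgroup_inverse(2)[OF H jk1] k1(3) by (metis matrix_mul_assoc matrix_mul_rid)
    then have a: "mat 1 + y \<in> H"
      using lie_subgroup_mult[OF H k1(2)] lie_subgroup_inverse(1)[OF H jk1] by simp
    \<comment> \<open>From x = T x + D z0 (L x): the point \<open>x\<close> of \<open>U\<close> is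
      recovered from \<open>T x = y\<close> and its chart coordinate z = z0 + L x.\<close>
    let ?f = "\<lambda>z. y + D z0 (z - z0)"
    have "continuous_on UNIV ?f"
      by (intro continuous_intros bounded_linear.continuous_on[OF linD[OF B(2)]])
    then have "open (B \<inter> ?f -` U')" using B(1) U'(1) by (intro open_Int open_vimage)
    from openin_chart_preimage[OF A c this]
    have o: "openin (manifold_topology HA) {q \<in> fst c. snd c q \<in> B \<inter> ?f -` U'}" .
    have "S y = (**) (mat 1 + y) ` {q \<in> fst c. snd c q \<in> B \<inter> ?f -` U'}"
    proof (intro equalityI subsetI)
      fix k assume k: "k \<in> S y"
      then have kV: "k \<in> V" and kY: "Y k = y" by (auto simp: S_def)
      have "?f (\<zeta> k) = g k" using kY by (simp add: \<zeta>_def Y_def T_def flip: kY)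
      then have "j (\<zeta> k) \<in> {q \<in> fst c. snd c q \<in> B \<inter> ?f -` U'}"
        using jB[OF \<zeta>B[OF kV]] \<zeta>B[OF kV] gU(1)[OF kV] W(3) by auto
      then show "k \<in> (**) (mat 1 + y) ` {q \<in> fst c. snd c q \<in> B \<inter> ?f -` U'}"
        using dec[OF kV] kY by blast
    next
      fix k assume "k \<in> (**) (mat 1 + y) ` {q \<in> fst c. snd c q \<in> B \<inter> ?f -` U'}"
      then obtain q where q: "q \<in> fst c" "snd c q \<in> B" "?f (snd c q) \<in> U'" "k = (mat 1 + y) ** q" by auto
      have qW: "q \<in> W" using q(1,2) diff_atlas_inj[OF A c] W(3) unfolding B_def by (auto dest: inj_onD)
      let ?x = "?f (snd c q)"
      have Lx: "z0 + L ?x = snd c q" by (simp add: linear_add[OF L(1)] Ly LD)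
      have Tx: "T ?x = y" by (simp add: T_def linear_add[OF L(1)] Ly LD)
      have \<Psi>x: "\<Psi> ?x = k" unfolding \<Psi>_def Lx Tx using jW(1)[OF qW] q(4) by simp
      have "k \<in> V" using \<Psi>x q(3) hom by (metis homeomorphism_image1 imageI)
      moreover have "g k = ?x" using \<Psi>x q(3) hom by (metis homeomorphism_apply1)
      moreover have "k \<in> H" using q(4) a qW WH lie_subgroup_mult[OF H] by blast
      ultimately show "k \<in> S y" using Tx by (simp add: S_def Y_def)
    qed
    then show "openin (manifold_topology HA) (S y)"
      using lie_subgroup_openin_left_mult[OF H a o] by simp
  qed
  moreover have "continuous_on V Y"
    unfolding Y_def by (rule continuous_on_compose2[OF linear_continuous_on[OF bT] contg, of UNIV]) auto
  moreover have "continuous_on V \<zeta>"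
    unfolding \<zeta>_def by (rule continuous_on_compose2[OF contL contg, of UNIV]) auto
  moreover have "Y (mat 1) = 0" by (simp add: Y_def g0 linear_0[OF bounded_linear.linear[OF bT]])
  \<comment> \<open>On the slice \<open>Y = 0\<close> the left factor is the identity, so there the
    chart coordinate equals \<open>\<zeta>\<close>, which is continuous for the topology of
    matrices.\<close>
  moreover have "k \<in> fst c \<and> snd c k = \<zeta> k" if "k \<in> V" "Y k = 0" for k
  proof -
    have "k = j (\<zeta> k)" using dec[OF that(1)] that(2) by simp
    then show ?thesis using jB[OF \<zeta>B[OF that(1)]] W(3) by (metis subsetD)
  qed
  ultimately show thesis using that c oneC V \<Psi>0 by metis
qed

text \<open>Curves do not see that the topology of \<open>H\<close> may be finer than that of the
  matrices. Convexity of \<open>N\<close> provides connected neighbourhoods of \<open>t0\<close> in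
  \<open>N\<close>, also when \<open>t0\<close> is an end point of an interval.\<close>

lemma lie_subgroup_curve_limitin:
  fixes HA :: "(real^'n^'n, 'h::real_normed_vector) atlas" and h :: "real \<Rightarrow> real^'n^'n"
  assumes H: "lie_subgroup H HA" and N: "convex N" "t0 \<in> N" "continuous_on N h" "h ` N \<subseteq> H"
  shows "limitin (manifold_topology HA) h (h t0) (at t0 within N)"
proof -
  note A = lie_subgroup_diff_atlas[OF H]
  obtain c V Y and \<zeta> :: "real^'n^'n \<Rightarrow> 'h" where c: "c \<in> HA" "mat 1 \<in> fst c" and V: "open V" "mat 1 \<in> V"
    and cont: "continuous_on V Y" "continuous_on V \<zeta>" and Y1: "Y (mat 1) = (0::real^'n^'n)"
    and cnt: "countable (Y ` (V \<inter> H))"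
    and slice: "\<And>k. k \<in> V \<Longrightarrow> Y k = 0 \<Longrightarrow> k \<in> fst c \<and> snd c k = \<zeta> k"
    using lie_subgroup_slices[OF H] by metis
  interpret mm: bounded_bilinear "\<lambda>(A::real^'n^'n) (B::real^'n^'n). A ** B"
    by (rule bounded_bilinear_matrix_mult)
  have h0: "h t0 \<in> H" using N by auto
  note hi = lie_subgroup_inverse[OF H h0]
  \<comment> \<open>Translated so that \<open>k t0\<close> is the identity, where the slices are
    available.\<close>
  define k where "k t = matrix_inv (h t0) ** h t" for t
  have kc: "continuous_on N k" unfolding k_def by (intro mm.continuous_on continuous_intros N)
  have k0: "k t0 = mat 1" by (simp add: k_def hi)
  have kH: "k t \<in> H" if "t \<in> N" for t
    unfolding k_def using hi N(4) that by (intro lie_subgroup_mult[OF H]) auto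
  have "\<forall>\<^sub>F t in at t0 within N. k t \<in> V"
    using kc N(2) V k0 by (auto simp: continuous_on_def intro: topological_tendstoD)
  then obtain d where d: "d > 0" "\<And>t. t \<in> N \<Longrightarrow> t \<noteq> t0 \<Longrightarrow> dist t t0 < d \<Longrightarrow> k t \<in> V"
    unfolding eventually_at by blast
  define N' where "N' = N \<inter> ball t0 d"
  have kV: "k t \<in> V" if "t \<in> N'" for t
    using that d(2)[of t] k0 V by (cases "t = t0") (auto simp: N'_def dist_commute)
  have t0: "t0 \<in> N'" using N(2) d(1) by (simp add: N'_def)
  have "continuous_on N' (\<lambda>t. Y (k t))"
    using kc kV by (intro continuous_on_compose2[OF cont(1)]) (auto simp: N'_def intro: continuous_on_subset)
  moreover have "connected N'" unfolding N'_def by (intro convex_connected convex_Int N(1) convex_ball)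
  ultimately have "connected ((\<lambda>t. Y (k t)) ` N')" by (rule connected_continuous_image)
  moreover have "countable ((\<lambda>t. Y (k t)) ` N')"
    by (rule countable_subset[OF _ cnt]) (use kV kH in \<open>auto simp: N'_def\<close>)
  \<comment> \<open>A connected set with more than one point is uncountable, so \<open>Y\<close> is
    constant along the curve.\<close>
  ultimately have "\<exists>a. (\<lambda>t. Y (k t)) ` N' \<subseteq> {a}"
    using connected_card_eq_iff_nontrivial by metis
  then have "Y (k t) = Y (k t0)" if "t \<in> N'" for t using t0 that by blast
  then have Y0: "Y (k t) = 0" if "t \<in> N'" for t using k0 Y1 that by simp
  have ev: "\<forall>\<^sub>F t in at t0 within N. t \<in> N'"
    unfolding eventually_at using d(1) by (auto simp: N'_def dist_commute)
  have "limitin (manifold_topology HA) k (mat 1) (at t0 within N)"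
    unfolding limitin_chart_iff[OF A c]
  proof
    show "\<forall>\<^sub>F t in at t0 within N. k t \<in> fst c"
      using ev by (rule eventually_mono) (use slice kV Y0 in blast)
    have "isCont \<zeta> (k t0)" using cont(2) V k0 by (simp add: continuous_on_eq_continuous_at)
    moreover have "(k \<longlongrightarrow> k t0) (at t0 within N)" using kc N(2) by (simp add: continuous_on_def)
    ultimately have "((\<lambda>t. \<zeta> (k t)) \<longlongrightarrow> \<zeta> (k t0)) (at t0 within N)"
      by (rule isCont_tendsto_compose)
    then have "((\<lambda>t. snd c (k t)) \<longlongrightarrow> \<zeta> (k t0)) (at t0 within N)"
    proof (rule Lim_transform_eventually)
      show "\<forall>\<^sub>F t in at t0 within N. \<zeta> (k t) = snd c (k t)"
        using ev by (rule eventually_mono) (use slice kV Y0 in metis)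
    qed
    then show "((\<lambda>t. snd c (k t)) \<longlongrightarrow> snd c (mat 1)) (at t0 within N)"
      using slice[OF kV[OF t0] Y0[OF t0]] k0 by simp
  qed
  from limitin_mdifferentiable[OF A A lie_subgroup_mdifferentiable_left_mult[OF H h0 lie_subgroup_one[OF H]] this]
  have "limitin (manifold_topology HA) (\<lambda>t. h t0 ** k t) (h t0 ** mat 1) (at t0 within N)" .
  moreover have "h t0 ** k t = h t" for t by (simp add: k_def matrix_mul_assoc hi)
  ultimately show ?thesis by simp
qed

section \<open>The frame bundle\<close>

lemma continuous_on_det: "continuous_on S (det :: real^'n^'n \<Rightarrow> real)"
  unfolding det_def by (intro continuous_intros)

lemma open_invertible: "open {X :: real^'n^'n. invertible X}"
proof -
  have "{X :: real^'n^'n. invertible X} = det -` (- {0})" by (auto simp: invertible_det_nz)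
  moreover have "continuous_on UNIV (det :: real^'n^'n \<Rightarrow> real)" by (rule continuous_on_det)
  then have "open ((det :: real^'n^'n \<Rightarrow> real) -` (- {0}))" by (intro open_vimage) auto
  ultimately show ?thesis by simp
qed

definition frame_matrix :: "('m, real^'n) chart \<Rightarrow> ('m, 'n::finite) frame \<Rightarrow> real^'n^'n" where
  "frame_matrix c p = (\<chi> i j. snd p j c $ i)"

definition frame_chart ::
  "('m, real^'n) atlas \<Rightarrow> ('m, real^'n) chart \<Rightarrow> (('m, 'n::finite) frame, (real^'n) \<times> (real^'n^'n)) chart" where
  "frame_chart M c = ({p \<in> frame_bundle M. fst p \<in> fst c}, \<lambda>p. (snd c (fst p), frame_matrix c p))"

lemma frame_atlas_eq: "frame_atlas M = frame_chart M ` M"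
  by (simp add: frame_atlas_def frame_chart_def frame_matrix_def)

lemma frame_chart_simps [simp]:
  "fst (frame_chart M c) = {p \<in> frame_bundle M. fst p \<in> fst c}"
  "snd (frame_chart M c) p = (snd c (fst p), frame_matrix c p)"
  by (simp_all add: frame_chart_def)

lemma frame_bundle_base: "p \<in> frame_bundle M \<Longrightarrow> fst p \<in> points M"
  by (auto simp: frame_bundle_def)

lemma frame_bundle_tangent: "p \<in> frame_bundle M \<Longrightarrow> snd p i \<in> tangent_space M (fst p)"
  by (auto simp: frame_bundle_def)

lemma points_frame_atlas: "points (frame_atlas M) = frame_bundle M"
  using frame_bundle_base by (fastforce simp: points_def frame_atlas_eq)

lemma frame_matrix_mult_vector:
  "frame_matrix c p *v a = (\<Sum>i\<in>UNIV. a $ i *\<^sub>R snd p i c)"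
  by (simp add: frame_matrix_def matrix_vector_mult_def vec_eq_iff mult.commute)

lemma frame_matrix_act: "frame_matrix c (frame_act p g) = frame_matrix c p ** g"
  by (simp add: frame_matrix_def frame_act_def matrix_matrix_mult_def vec_eq_iff mult.commute)

lemma fst_frame_act [simp]: "fst (frame_act p g) = fst p"
  by (simp add: frame_act_def)

text \<open>Every vector of the model space is the component in \<open>c\<close> of a tangent
  vector, and the frame spans the tangent space; so the columns span, and a surjective square matrix
  is invertible.\<close>

lemma frame_matrix_invertible:
  assumes M: "diff_atlas M" and p: "p \<in> frame_bundle M" and c: "c \<in> M" "fst p \<in> fst c"
  shows "invertible (frame_matrix c p)"
proof -
  have "\<exists>a. w = frame_matrix c p *v a" for w
  proof -
    have "tangent_vector M c (fst p) w \<in> tangent_space M (fst p)" by (rule tangent_vector_in[OF M c])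
    then obtain a where "tangent_vector M c (fst p) w = (\<lambda>c. \<Sum>i\<in>UNIV. a $ i *\<^sub>R snd p i c)"
      using p unfolding frame_bundle_def by (auto split: prod.splits)
    from fun_cong[OF this, of c] have "w = frame_matrix c p *v a"
      by (simp add: tangent_vector_chart[OF M c] frame_matrix_mult_vector)
    then show ?thesis ..
  qed
  then have "surj ((*v) (frame_matrix c p))" by (auto simp: surj_def)
  then show ?thesis by (simp add: invertible_right_inverse matrix_right_invertible_surjective)
qed

lemma tangent_vector_sum:
  assumes A: "diff_atlas A" and c: "c \<in> A" "x \<in> fst c"
  shows "(\<lambda>c'. \<Sum>i\<in>I. a i *\<^sub>R tangent_vector A c x (v i) c') = tangent_vector A c x (\<Sum>i\<in>I. a i *\<^sub>R v i)"
proof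
  fix c'
  show "(\<Sum>i\<in>I. a i *\<^sub>R tangent_vector A c x (v i) c') = tangent_vector A c x (\<Sum>i\<in>I. a i *\<^sub>R v i) c'"
  proof (cases "c' \<in> A \<and> x \<in> fst c'")
    case True
    then have "linear (frechet_derivative (snd c' \<circ> chart_inv c) (at (snd c x)))"
      using diff_atlas_transition[OF A c(1) _ c(2)] by (blast intro: linear_frechet_derivative)
    with True show ?thesis by (simp add: tangent_vector_def linear_sum linear_scale)
  qed (auto simp: tangent_vector_def)
qed

text \<open>Tangent vectors are compared by their single component in \<open>c\<close>, where
  existence and uniqueness of coefficients become solvability of a linear system with matrix
  \<open>X\<close>.\<close>

lemma frame_of_matrix:
  fixes M :: "('m, real^'n) atlas" and X :: "real^'n^'n"
  assumes M: "diff_atlas M" and c: "c \<in> M" "x \<in> fst c" and X: "invertible X"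
  defines "p \<equiv> (x, \<lambda>j. tangent_vector M c x (column j X))"
  shows "p \<in> frame_bundle M" "frame_matrix c p = X"
proof -
  show fm: "frame_matrix c p = X"
    by (simp add: p_def frame_matrix_def tangent_vector_chart[OF M c] column_def vec_eq_iff)
  have sum: "(\<lambda>c'. \<Sum>i\<in>UNIV. a $ i *\<^sub>R tangent_vector M c x (column i X) c') = tangent_vector M c x (X *v a)" for a
    using frame_matrix_mult_vector[of c p a] fm
    by (simp add: tangent_vector_sum[OF M c] p_def tangent_vector_chart[OF M c])
  have "\<exists>!a. \<tau> = (\<lambda>c. \<Sum>i\<in>UNIV. a $ i *\<^sub>R tangent_vector M (c') x (column i X) c)"
    if "\<tau> \<in> tangent_space M x" "c' = c" for \<tau> c'
  proof -
    have \<tau>: "\<tau> = tangent_vector M c x (\<tau> c)"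
      using that c by (intro tangent_vector_eqI[OF _ tangent_vector_in[OF M c]])
        (auto simp: tangent_vector_chart[OF M c])
    have iff: "\<tau> = tangent_vector M c x (X *v a) \<longleftrightarrow> X *v a = \<tau> c" for a
      using \<tau> tangent_vector_chart[OF M c] by metis
    have "X *v (matrix_inv X *v \<tau> c) = \<tau> c"
      by (simp add: matrix_vector_mul_assoc matrix_inv_mult[OF X])
    moreover have "a = matrix_inv X *v \<tau> c" if "X *v a = \<tau> c" for a
      using that by (metis matrix_inv_mult(2)[OF X] matrix_vector_mul_assoc matrix_vector_mul_lid)
    ultimately show ?thesis unfolding that(2) sum iff by blast
  qed
  then show "p \<in> frame_bundle M"
    using c tangent_vector_in[OF M c] unfolding frame_bundle_def p_def by (auto simp: points_def)
qed

lemma frame_chart_image: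
  fixes M :: "('m, real^'n) atlas"
  assumes M: "diff_atlas M" and c: "c \<in> M" "U \<subseteq> fst c"
  shows "snd (frame_chart M c) ` {p \<in> frame_bundle M. fst p \<in> U} = snd c ` U \<times> {X :: real^'n^'n. invertible X}"
proof (intro equalityI subsetI)
  fix z assume "z \<in> snd (frame_chart M c) ` {p \<in> frame_bundle M. fst p \<in> U}"
  then show "z \<in> snd c ` U \<times> {X :: real^'n^'n. invertible X}"
    using frame_matrix_invertible[OF M _ c(1)] c(2) by auto
next
  fix z assume "z \<in> snd c ` U \<times> {X :: real^'n^'n. invertible X}"
  then obtain x X where z: "z = (snd c x, X)" "x \<in> U" "invertible X" by auto
  have "x \<in> fst c" using z c by auto
  note f = frame_of_matrix[OF M c(1) this z(3)]
  show "z \<in> snd (frame_chart M c) ` {p \<in> frame_bundle M. fst p \<in> U}"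
    by (rule image_eqI[of _ _ "(x, \<lambda>j. tangent_vector M c x (column j X))"]) (use f z in auto)
qed

lemma frame_chart_inj:
  assumes M: "diff_atlas M" and c: "c \<in> M"
  shows "inj_on (snd (frame_chart M c)) (fst (frame_chart M c))"
proof (rule inj_onI)
  fix p q assume p: "p \<in> fst (frame_chart M c)" and q: "q \<in> fst (frame_chart M c)"
    and eq: "snd (frame_chart M c) p = snd (frame_chart M c) q"
  then have b: "fst p = fst q" using diff_atlas_inj[OF M c] by (auto dest: inj_onD)
  have "snd p j c = snd q j c" for j
    using eq by (simp add: frame_matrix_def vec_eq_iff)
  then have "snd p j = snd q j" for j
    using p q b frame_bundle_tangent[of p M j] frame_bundle_tangent[of q M j]
    by (intro tangent_vector_eqI[OF _ _ c]) auto
  then show "p = q" using b by (auto intro: prod_eqI)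
qed

lemma frame_matrix_transition:
  assumes p: "p \<in> frame_bundle M" and c: "c \<in> M" "fst p \<in> fst c" and c': "c' \<in> M" "fst p \<in> fst c'"
  shows "snd p j c' = frechet_derivative (snd c' \<circ> chart_inv c) (at (snd c (fst p))) (snd p j c)"
  using tangent_space_transition[OF frame_bundle_tangent[OF p] c(1) c'(1) c(2) c'(2)] .

text \<open>A change of base chart g acts on frame matrices through its Jacobian, so the transition
  is (z, X) \<mapsto> (g z, Jac z ** X). Its differentiability involves second derivatives of g,
  hence the smoothness assumption on \<open>M\<close> in place of \<open>diff_atlas\<close>.\<close>

lemma diff_atlas_frame:
  fixes M :: "('m, real^'n) atlas"
  assumes M: "smooth_manifold M"
  shows "diff_atlas (frame_atlas M)"
  unfolding diff_atlas_def frame_atlas_eq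
proof (intro conjI ballI; elim imageE; simp only:)
  note A = smooth_manifold_diff_atlas[OF M]
  fix c assume c: "c \<in> M"
  show "inj_on (snd (frame_chart M c)) (fst (frame_chart M c))" by (rule frame_chart_inj[OF A c])
  fix c' assume c': "c' \<in> M"
  let ?U = "fst c \<inter> fst c'"
  have int: "fst (frame_chart M c) \<inter> fst (frame_chart M c') = {p \<in> frame_bundle M. fst p \<in> ?U}" by auto
  have im: "snd (frame_chart M c) ` {p \<in> frame_bundle M. fst p \<in> ?U} = snd c ` ?U \<times> {X. invertible X}"
    by (rule frame_chart_image[OF A c]) auto
  have oU: "open (snd c ` ?U)" using A c c' by (simp add: diff_atlas_def)
  then have oI: "open (snd c ` ?U \<times> {X :: real^'n^'n. invertible X})"
    by (rule open_Times[OF _ open_invertible])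
  then show "open (snd (frame_chart M c) ` (fst (frame_chart M c) \<inter> fst (frame_chart M c')))"
    unfolding int im .
  fix p assume "p \<in> fst (frame_chart M c) \<inter> fst (frame_chart M c')"
  then have p: "p \<in> frame_bundle M" "fst p \<in> fst c" "fst p \<in> fst c'" by auto
  let ?g = "snd c' \<circ> chart_inv c" and ?z = "snd c (fst p)"
  \<comment> \<open>\<open>E k v\<close> has \<open>v\<close> as its \<open>k\<close>-th column and
    0 elsewhere. \<open>Ck_on\<close> speaks of fixed directions, so the Jacobian matrix is
    assembled from the derivatives along the standard basis.\<close>
  define E :: "'n \<Rightarrow> real^'n \<Rightarrow> real^'n^'n" where "E k v = (\<chi> i j. if j = k then v $ i else 0)" for k v
  define Jac where "Jac z = (\<Sum>k\<in>UNIV. E k (frechet_derivative ?g (at z) (axis k 1)))" for z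
  have "smooth_on (snd c ` ?U) ?g" using M c c' by (simp add: smooth_manifold_def)
  then have C2: "Ck_on (Suc (Suc 0)) (snd c ` ?U) ?g" by (simp add: smooth_on_def)
  have zU: "?z \<in> snd c ` ?U" using p by auto
  interpret mm: bounded_bilinear "\<lambda>(A::real^'n^'n) (B::real^'n^'n). A ** B"
    by (rule bounded_bilinear_matrix_mult)
  have linE: "bounded_linear (E k)" for k
    unfolding linear_conv_bounded_linear[symmetric] E_def by (rule linearI) (auto simp: vec_eq_iff)
  have "(\<lambda>z. E k (frechet_derivative ?g (at z) (axis k 1))) differentiable (at ?z)" for k
  proof -
    have "(\<lambda>z. frechet_derivative ?g (at z) (axis k 1)) differentiable (at ?z)"
      using C2 zU unfolding Ck_on.simps by blast
    then show ?thesis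
      unfolding differentiable_def using bounded_linear.has_derivative[OF linE] by blast
  qed
  then have "Jac differentiable (at ?z)" unfolding Jac_def by (intro differentiable_sum) auto
  then have "(Jac \<circ> fst) differentiable (at (snd (frame_chart M c) p))"
    by (intro differentiable_chain_at) (auto intro!: bounded_linear_imp_differentiable bounded_linear_fst)
  then obtain D1 where D1: "((\<lambda>w. Jac (fst w)) has_derivative D1) (at (snd (frame_chart M c) p))"
    by (auto simp: differentiable_def o_def)
  have "?g differentiable (at ?z)" using C2 zU unfolding Ck_on.simps by blast
  then have "(?g \<circ> fst) differentiable (at (snd (frame_chart M c) p))"
    by (intro differentiable_chain_at) (auto intro!: bounded_linear_imp_differentiable bounded_linear_fst)
  then obtain D2 where D2: "((\<lambda>w. ?g (fst w)) has_derivative D2) (at (snd (frame_chart M c) p))"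
    by (auto simp: differentiable_def o_def)
  have "((\<lambda>w. (?g (fst w), Jac (fst w) ** snd w)) has_derivative
      (\<lambda>h. (D2 h, Jac (fst (snd (frame_chart M c) p)) ** snd h + D1 h ** snd (snd (frame_chart M c) p))))
      (at (snd (frame_chart M c) p))"
    by (intro has_derivative_Pair D2 mm.FDERIV D1 has_derivative_snd has_derivative_ident)
  moreover have "\<forall>\<^sub>F w in nhds (snd (frame_chart M c) p).
      (snd (frame_chart M c') \<circ> chart_inv (frame_chart M c)) w = (?g (fst w), Jac (fst w) ** snd w)"
  proof -
    have "\<forall>\<^sub>F w in nhds (snd (frame_chart M c) p). w \<in> snd c ` ?U \<times> {X. invertible X}"
      using zU frame_matrix_invertible[OF A p(1) c p(2)] by (intro eventually_nhds_in_open oI) auto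
    then show ?thesis unfolding im[symmetric]
    proof eventually_elim
      case (elim w)
      then obtain q where q: "q \<in> frame_bundle M" "fst q \<in> fst c" "fst q \<in> fst c'"
        and w: "w = snd (frame_chart M c) q" by auto
      have ci: "chart_inv (frame_chart M c) w = q"
        unfolding w by (rule chart_inv_chart[OF frame_chart_inj[OF A c]]) (use q in simp)
      have Jc: "Jac z $ i $ k = frechet_derivative ?g (at z) (axis k 1) $ i" for z i k
        unfolding Jac_def E_def by (simp add: sum.delta)
      have "linear (frechet_derivative ?g (at (snd c (fst q))))"
        using diff_atlas_transition[OF A c c' q(2,3)] by (rule linear_frechet_derivative)
      then have lin: "frechet_derivative ?g (at (snd c (fst q))) v =
          (\<Sum>k\<in>UNIV. v $ k *\<^sub>R frechet_derivative ?g (at (snd c (fst q))) (axis k 1))" for v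
        using arg_cong[OF basis_expansion[of v], of "frechet_derivative ?g (at (snd c (fst q)))"]
        by (simp add: linear_sum linear_scale scalar_mult_eq_scaleR)
      have "frame_matrix c' q $ i $ j = (Jac (snd c (fst q)) ** frame_matrix c q) $ i $ j" for i j
      proof -
        have "frame_matrix c' q $ i $ j = frechet_derivative ?g (at (snd c (fst q))) (snd q j c) $ i"
          by (simp add: frame_matrix_def frame_matrix_transition[OF q(1) c q(2) c' q(3)])
        also have "\<dots> = (\<Sum>k\<in>UNIV. snd q j c $ k *\<^sub>R frechet_derivative ?g (at (snd c (fst q))) (axis k 1)) $ i"
          by (subst lin) simp
        also have "\<dots> = (Jac (snd c (fst q)) ** frame_matrix c q) $ i $ j"
          by (simp add: matrix_matrix_mult_def Jc frame_matrix_def mult.commute)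
        finally show ?thesis .
      qed
      then have "frame_matrix c' q = Jac (snd c (fst q)) ** frame_matrix c q" by (simp add: vec_eq_iff)
      then show ?case using ci diff_atlas_chart_inv[OF A c q(2)] by (simp add: w)
    qed
  qed
  ultimately show "(snd (frame_chart M c') \<circ> chart_inv (frame_chart M c)) differentiable
      (at (snd (frame_chart M c) p))"
    unfolding differentiable_def using has_derivative_eventually_cong by blast
qed

lemma mdifferentiable_frame_projection:
  assumes M: "smooth_manifold M" and p: "p \<in> frame_bundle M"
  shows "mdifferentiable (frame_atlas M) M fst p"
proof -
  note F = diff_atlas_frame[OF M]
  obtain c where c: "c \<in> M" "fst p \<in> fst c" using frame_bundle_base[OF p] by (auto simp: points_def)
  have fc: "frame_chart M c \<in> frame_atlas M" "p \<in> fst (frame_chart M c)"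
    using c p by (auto simp: frame_atlas_eq)
  have ev: "\<forall>\<^sub>F z in nhds (snd (frame_chart M c) p). fst (chart_inv (frame_chart M c) z) \<in> fst c \<and>
      (snd c \<circ> fst \<circ> chart_inv (frame_chart M c)) z = fst z"
    using eventually_chart_inv[OF F fc(1) openin_chart_domain[OF F fc(1)] fc(2,2)]
    by eventually_elim (auto simp: prod_eq_iff)
  have "fst differentiable (at (snd (frame_chart M c) p))"
    by (intro bounded_linear_imp_differentiable bounded_linear_fst)
  then have "(snd c \<circ> fst \<circ> chart_inv (frame_chart M c)) differentiable (at (snd (frame_chart M c) p))"
    by (rule differentiable_eventually_cong) (use ev in eventually_elim, simp)
  moreover have "\<forall>\<^sub>F z in nhds (snd (frame_chart M c) p). fst (chart_inv (frame_chart M c) z) \<in> fst c"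
    using ev by eventually_elim simp
  ultimately show ?thesis unfolding mdifferentiable_def using c fc by blast
qed

section \<open>Smooth arcs and their reparametrization\<close>

lemma openin_std_atlas:
  fixes I :: "'e::real_normed_vector set"
  shows "open I \<Longrightarrow> openin (manifold_topology (std_atlas I)) W \<longleftrightarrow> W \<subseteq> I \<and> open W"
  using openin_diff_atlas[OF diff_atlas_std_open, of I W]
  by (auto simp: std_atlas_def points_def Int_absorb2)

lemma chart_inv_std: "x \<in> I \<Longrightarrow> chart_inv (I, \<lambda>x. x) x = x"
  using chart_inv_chart[of "(I, \<lambda>x. x)" x] by simp

text \<open>Everything is inherited from the smooth extension to an open interval. The extension
  agrees with \<open>\<gamma>\<close> on \<open>{a..b}\<close> only, so limits and derivatives are
  taken within that interval.\<close>

lemma smooth_arc_in_chart: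
  assumes A: "diff_atlas A" and \<gamma>: "smooth_arc A \<gamma> a b" and t: "t \<in> {a..b}"
  shows "limitin (manifold_topology A) \<gamma> (\<gamma> t) (at t within {a..b})"
    and "c \<in> A \<Longrightarrow> \<gamma> t \<in> fst c \<Longrightarrow> (snd c \<circ> \<gamma>) differentiable (at t within {a..b})"
    and "\<gamma> t \<in> points A"
proof -
  obtain e \<delta> where e: "e > 0" and \<delta>: "smooth_map (std_atlas {a - e<..<b + e}) A \<delta>"
    and eq: "\<And>t. t \<in> {a..b} \<Longrightarrow> \<delta> t = \<gamma> t" using \<gamma> unfolding smooth_arc_def by blast
  let ?I = "{a - e<..<b + e}"
  have I: "diff_atlas (std_atlas ?I)" by (simp add: diff_atlas_std_open)
  have tI: "t \<in> points (std_atlas ?I)" using t e by (simp add: std_atlas_def points_def)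
  show "\<gamma> t \<in> points A" using smooth_map_points[OF \<delta> tI] eq[OF t] by simp
  have m: "mdifferentiable (std_atlas ?I) A \<delta> t" by (rule smooth_map_mdifferentiable[OF I \<delta> tI])
  have evI: "\<forall>\<^sub>F s in nhds t. s \<in> ?I" using t e by (intro eventually_nhds_in_open) auto
  have diff: "(snd c \<circ> \<delta>) differentiable (at t)" "\<forall>\<^sub>F s in nhds t. \<delta> s \<in> fst c"
    if "c \<in> A" "\<gamma> t \<in> fst c" for c
  proof -
    have c: "\<delta> t \<in> fst c" using that eq[OF t] by simp
    have s: "(?I, \<lambda>x. x) \<in> std_atlas ?I" "t \<in> fst (?I, \<lambda>x. x)" using t e by (auto simp: std_atlas_def)
    note d = mdifferentiable_in_charts[OF I A m s that(1) c]
    show "(snd c \<circ> \<delta>) differentiable (at t)"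
      by (rule differentiable_eventually_cong[OF d(2)[simplified]])
         (use evI in eventually_elim, simp add: chart_inv_std)
    show "\<forall>\<^sub>F s in nhds t. \<delta> s \<in> fst c"
      using d(1)[simplified] evI by eventually_elim (simp add: chart_inv_std)
  qed
  show "(snd c \<circ> \<gamma>) differentiable (at t within {a..b})" if c: "c \<in> A" "\<gamma> t \<in> fst c"
  proof -
    obtain D where "((snd c \<circ> \<delta>) has_derivative D) (at t within {a..b})"
      using diff(1)[OF c] unfolding differentiable_def using has_derivative_at_withinI by blast
    then have "((snd c \<circ> \<gamma>) has_derivative D) (at t within {a..b})"
      using t eq by (elim has_derivative_transform[rotated 2]) auto
    then show ?thesis unfolding differentiable_def by blast
  qed
  obtain c where c: "c \<in> A" "\<gamma> t \<in> fst c"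
    using smooth_map_points[OF \<delta> tI] eq[OF t] by (auto simp: points_def)
  have ev: "\<forall>\<^sub>F s in at t within {a..b}. \<delta> s = \<gamma> s" by (auto simp: eventually_at_filter eq)
  have "\<forall>\<^sub>F s in at t within {a..b}. \<delta> s \<in> fst c"
    using diff(2)[OF c] by (auto simp: eventually_at_filter elim: eventually_mono)
  with ev have "\<forall>\<^sub>F s in at t within {a..b}. \<gamma> s \<in> fst c" by eventually_elim simp
  moreover have "((\<lambda>s. snd c (\<gamma> s)) \<longlongrightarrow> snd c (\<gamma> t)) (at t within {a..b})"
  proof (rule Lim_transform_eventually)
    have "isCont (snd c \<circ> \<delta>) t" using diff(1)[OF c] by (rule differentiable_imp_continuous_within)
    then show "((\<lambda>s. snd c (\<delta> s)) \<longlongrightarrow> snd c (\<gamma> t)) (at t within {a..b})"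
      using eq[OF t] by (auto simp: isCont_def o_def intro: tendsto_within_subset)
    show "\<forall>\<^sub>F s in at t within {a..b}. snd c (\<delta> s) = snd c (\<gamma> s)" using ev by eventually_elim simp
  qed
  ultimately show "limitin (manifold_topology A) \<gamma> (\<gamma> t) (at t within {a..b})"
    using limitin_chart_iff[OF A c] by blast
qed

lemma velocity_has_derivative:
  assumes "diff_atlas A" "smooth_arc A \<gamma> a b" "t \<in> {a..b}" "c \<in> A" "\<gamma> t \<in> fst c"
  shows "((snd c \<circ> \<gamma>) has_vector_derivative velocity A \<gamma> {a..b} t c) (at t within {a..b})"
  using smooth_arc_in_chart(2)[OF assms] assms(4,5)
  by (simp add: velocity_def vector_derivative_works)

text \<open>Moving the right end to \<open>b'\<close> and rescaling happen together because
  truncating a curve needs both: its last piece is cut short, and all pieces are stretched by the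
  same factor.\<close>

lemma smooth_arc_rescale:
  assumes \<gamma>: "smooth_arc A \<gamma> a b" and s: "s > 0" and b': "b' \<le> b"
  shows "smooth_arc A (\<lambda>t. \<gamma> (s * t)) (a / s) (b' / s)"
proof -
  obtain e \<delta> where e: "e > 0" and \<delta>: "smooth_map (std_atlas {a - e<..<b + e}) A \<delta>"
    and eq: "\<And>t. t \<in> {a..b} \<Longrightarrow> \<delta> t = \<gamma> t" using \<gamma> unfolding smooth_arc_def by blast
  let ?I = "{a - e<..<b + e}" and ?I' = "{a / s - e / s<..<b' / s + e / s}"
  have sI: "s * t \<in> ?I" if "t \<in> ?I'" for t
    using that s b' by (simp add: field_simps)
  have "smooth_map (std_atlas ?I') A (\<lambda>t. \<delta> (s * t))"
    unfolding smooth_map_def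
  proof
    fix t assume "t \<in> points (std_atlas ?I')"
    then have t: "t \<in> ?I'" by (simp add: std_atlas_def points_def)
    then have "s * t \<in> points (std_atlas ?I)" using sI by (simp add: std_atlas_def points_def)
    then obtain c W where c: "c \<in> A" and W: "openin (manifold_topology (std_atlas ?I)) W" "s * t \<in> W"
      "\<delta> ` W \<subseteq> fst c" and sm: "smooth_on W (snd c \<circ> \<delta> \<circ> chart_inv (?I, \<lambda>x. x))"
      using \<delta> unfolding smooth_map_def by (auto simp: std_atlas_def)
    have Wo: "W \<subseteq> ?I" "open W" using W(1) by (simp_all add: openin_std_atlas)
    let ?W = "{t \<in> ?I'. s * t \<in> W}"
    have oW: "open ?W"
    proof -
      have "?W = ?I' \<inter> (\<lambda>t. s * t) -` W" by auto
      then show ?thesis using Wo(2) by (auto intro!: open_Int open_vimage continuous_intros)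
    qed
    have "smooth_on ?W (\<lambda>t. (snd c \<circ> \<delta> \<circ> chart_inv (?I, \<lambda>x. x)) (0 + s * t))"
      by (rule smooth_on_compose_affine[OF bounded_linear_mult_right _ oW sm]) simp
    then have "smooth_on ?W (snd c \<circ> (\<lambda>t. \<delta> (s * t)) \<circ> chart_inv (?I', \<lambda>x. x))"
      by (rule smooth_on_cong[OF oW, THEN iffD1, rotated]) (use Wo in \<open>auto simp: chart_inv_std subset_iff\<close>)
    then show "\<exists>c\<in>std_atlas ?I'. \<exists>c'\<in>A. \<exists>W. openin (manifold_topology (std_atlas ?I')) W \<and> t \<in> W \<and>
        W \<subseteq> fst c \<and> (\<lambda>t. \<delta> (s * t)) ` W \<subseteq> fst c' \<and>
        smooth_on (snd c ` W) (snd c' \<circ> (\<lambda>t. \<delta> (s * t)) \<circ> chart_inv c)"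
      using c W t oW
      by (intro bexI[of _ "(?I', \<lambda>x. x)"] bexI[of _ c] exI[of _ ?W])
         (auto simp: openin_std_atlas, auto simp: std_atlas_def)
  qed
  moreover have "\<delta> (s * t) = \<gamma> (s * t)" if "t \<in> {a / s..b' / s}" for t
    using that s b' by (intro eq) (auto simp: field_simps)
  ultimately show ?thesis
    unfolding smooth_arc_def using e s by (intro exI[of _ "e / s"]) auto
qed

lemma velocity_rescale:
  fixes A :: "('a, 'e::euclidean_space) atlas"
  assumes A: "diff_atlas A" and \<gamma>: "smooth_arc A \<gamma> a b" and s: "s > 0" and b': "a < b'" "b' \<le> b"
    and t: "t \<in> {a / s..b' / s}"
  shows "velocity A (\<lambda>t. \<gamma> (s * t)) {a / s..b' / s} t = (\<lambda>c. s *\<^sub>R velocity A \<gamma> {a..b} (s * t) c)"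
proof
  fix c
  have st: "s * t \<in> {a..b}" using t s b' by (auto simp: field_simps)
  show "velocity A (\<lambda>t. \<gamma> (s * t)) {a / s..b' / s} t c = s *\<^sub>R velocity A \<gamma> {a..b} (s * t) c"
  proof (cases "c \<in> A \<and> \<gamma> (s * t) \<in> fst c")
    case True
    let ?I = "{a / s..b' / s}"
    have sub: "(\<lambda>t. s * t) ` ?I \<subseteq> {a..b}" using s b' by (auto simp: field_simps)
    have "((snd c \<circ> \<gamma>) has_vector_derivative velocity A \<gamma> {a..b} (s * t) c) (at (s * t) within (\<lambda>t. s * t) ` ?I)"
      using velocity_has_derivative[OF A \<gamma> st] True sub by (blast intro: has_vector_derivative_within_subset)
    moreover have "((\<lambda>t. s * t) has_vector_derivative s) (at t within ?I)"
      by (auto intro!: derivative_eq_intros simp: has_vector_derivative_def)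
    ultimately have "(((snd c \<circ> \<gamma>) \<circ> (\<lambda>t. s * t)) has_vector_derivative
        s *\<^sub>R velocity A \<gamma> {a..b} (s * t) c) (at t within ?I)"
      by (rule vector_diff_chain_within[rotated])
    \<comment> \<open>The interval is nondegenerate because \<open>a < b'\<close>, so the one-sided
      derivative is unique and \<open>vector_derivative\<close> returns it also at the end
      points.\<close>
    then have "vector_derivative (snd c \<circ> (\<lambda>t. \<gamma> (s * t))) (at t within ?I) = s *\<^sub>R velocity A \<gamma> {a..b} (s * t) c"
      using t s b' by (intro vector_derivative_within_closed_interval) (auto simp: o_def divide_strict_right_mono)
    then show ?thesis using True by (simp add: velocity_def)
  qed (auto simp: velocity_def)
qed

section \<open>Principal subbundles of the frame bundle\<close>

text \<open>Cramer's rule writes the entries of \<open>h\<close> as quotients of determinants formed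
  from \<open>X\<close> and \<open>Y\<close>, which are continuous where \<open>det X\<close> is
  nonzero.\<close>

lemma tendsto_matrix_solve:
  fixes X Y h :: "'a \<Rightarrow> real^'n^'n"
  assumes X: "(X \<longlongrightarrow> X0) F" and Y: "(Y \<longlongrightarrow> Y0) F" and inv: "invertible X0"
    and eq: "\<forall>\<^sub>F t in F. Y t = X t ** h t" "Y0 = X0 ** h0"
  shows "(h \<longlongrightarrow> h0) F"
proof -
  \<comment> \<open>The numerator matrix in Cramer's rule: the \<open>k\<close>-th column of
    \<open>X\<close> is replaced by the \<open>j\<close>-th column of \<open>Y\<close>.\<close>
  let ?C = "\<lambda>X Y k j. (\<chi> i l. if l = k then Y $ i $ j else X $ i $ l) :: real^'n^'n"
  have cr: "h $ k $ j = det (?C X (X ** h) k j) / det X" if "det X \<noteq> 0" for X h :: "real^'n^'n" and k j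
  proof -
    have "X *v column j h = column j (X ** h)"
      by (simp add: column_def matrix_vector_mult_def matrix_matrix_mult_def)
    then have "column j h = (\<chi> k. det (\<chi> i l. if l = k then column j (X ** h) $ i else X $ i $ l) / det X)"
      using cramer[OF that] by blast
    then have "column j h $ k = det (\<chi> i l. if l = k then column j (X ** h) $ i else X $ i $ l) / det X"
      by simp
    then show ?thesis by (simp add: column_def cong: if_cong)
  qed
  have det: "isCont det Z" for Z :: "real^'n^'n"
  proof -
    have "continuous_on UNIV (det :: real^'n^'n \<Rightarrow> real)" by (rule continuous_on_det)
    then show ?thesis by (simp add: continuous_on_eq_continuous_at)
  qed
  have dX: "((\<lambda>t. det (X t)) \<longlongrightarrow> det X0) F" by (rule isCont_tendsto_compose[OF det X])
  have d0: "det X0 \<noteq> 0" using inv by (simp add: invertible_det_nz)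
  have ev: "\<forall>\<^sub>F t in F. det (X t) \<noteq> 0" using tendsto_imp_eventually_ne[OF dX d0] .
  have "((\<lambda>t. h t $ k $ j) \<longlongrightarrow> h0 $ k $ j) F" for k j
  proof (rule Lim_transform_eventually)
    have "((\<lambda>t. ?C (X t) (Y t) k j) \<longlongrightarrow> ?C X0 Y0 k j) F"
      by (intro vec_tendstoI) (auto intro!: tendsto_intros X Y)
    then have "((\<lambda>t. det (?C (X t) (Y t) k j) / det (X t)) \<longlongrightarrow> det (?C X0 Y0 k j) / det X0) F"
      by (rule tendsto_divide[OF isCont_tendsto_compose[OF det] dX d0])
    then show "((\<lambda>t. det (?C (X t) (Y t) k j) / det (X t)) \<longlongrightarrow> h0 $ k $ j) F"
      using cr[OF d0, of h0] eq(2) by (simp cong: if_cong)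
    show "\<forall>\<^sub>F t in F. det (?C (X t) (Y t) k j) / det (X t) = h t $ k $ j"
      using ev eq(1)
    proof eventually_elim
      case (elim t)
      show ?case using cr[OF elim(1), of "h t" k j] unfolding elim(2) by (rule sym)
    qed
  qed
  then show ?thesis by (intro vec_tendstoI) auto
qed

section \<open>The right action of matrices on frames\<close>

lemma frame_act_mult: "frame_act (frame_act p g) h = frame_act p (g ** h)"
proof -
  have "(\<Sum>i\<in>UNIV. h $ i $ j *\<^sub>R (\<Sum>k\<in>UNIV. g $ k $ i *\<^sub>R snd p k c)) =
      (\<Sum>k\<in>UNIV. (g ** h) $ k $ j *\<^sub>R snd p k c)" for j c
  proof -
    have "(\<Sum>i\<in>UNIV. h $ i $ j *\<^sub>R (\<Sum>k\<in>UNIV. g $ k $ i *\<^sub>R snd p k c)) =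
        (\<Sum>i\<in>UNIV. \<Sum>k\<in>UNIV. (g $ k $ i * h $ i $ j) *\<^sub>R snd p k c)"
      by (simp add: scaleR_sum_right mult.commute)
    also have "\<dots> = (\<Sum>k\<in>UNIV. \<Sum>i\<in>UNIV. (g $ k $ i * h $ i $ j) *\<^sub>R snd p k c)" by (rule sum.swap)
    finally show ?thesis by (simp add: matrix_matrix_mult_def scaleR_sum_left)
  qed
  then show ?thesis by (simp add: frame_act_def)
qed

lemma frame_act_one: "frame_act p (mat 1) = p"
proof -
  have "(\<Sum>i\<in>UNIV. (mat 1 :: real^'b^'b) $ i $ j *\<^sub>R snd p i c) = snd p j c" for j c
    by (simp add: mat_def if_distrib[of "\<lambda>x. x *\<^sub>R _"] cong: if_cong)
  then show ?thesis by (simp add: frame_act_def)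
qed

lemma frame_act_free:
  assumes M: "diff_atlas M" and p: "p \<in> frame_bundle M" and eq: "frame_act p g = frame_act p h"
  shows "g = h"
proof -
  obtain c where c: "c \<in> M" "fst p \<in> fst c" using frame_bundle_base[OF p] by (auto simp: points_def)
  have "frame_matrix c p ** g = frame_matrix c p ** h" using eq by (metis frame_matrix_act)
  then show ?thesis
    using matrix_inv_mult(2)[OF frame_matrix_invertible[OF M p c]] by (metis matrix_mul_assoc matrix_mul_lid)
qed

lemma smooth_on_subset: "smooth_on U f \<Longrightarrow> open V \<Longrightarrow> V \<subseteq> U \<Longrightarrow> smooth_on V f"
  using smooth_on_compose_affine[of "\<lambda>x. x" V 0 U f] by (auto simp: subset_iff)

lemma diff_atlas_restrict:
  assumes A: "diff_atlas A" and S: "openin (manifold_topology A) S"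
  shows "diff_atlas (restrict_atlas A S)"
  unfolding diff_atlas_def restrict_atlas_def
proof (intro conjI ballI; elim imageE; simp)
  fix c assume c: "c \<in> A"
  show "inj_on (snd c) (fst c \<inter> S)" using diff_atlas_inj[OF A c] by (rule inj_on_subset) simp
  fix c' assume c': "c' \<in> A"
  have "openin (manifold_topology A) (fst c' \<inter> S)" using openin_chart_domain[OF A c'] S by (rule openin_Int)
  from open_chart_image[OF A c this]
  show "open (snd c ` (fst c \<inter> S \<inter> (fst c' \<inter> S)))" by (simp add: Int_ac)
  fix x assume x: "x \<in> fst c \<and> x \<in> S \<and> x \<in> fst c' \<and> x \<in> S"
  have ev: "\<forall>\<^sub>F z in nhds (snd c x). (snd c' \<circ> chart_inv (fst c \<inter> S, snd c)) z = (snd c' \<circ> chart_inv c) z"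
  proof -
    have "\<forall>\<^sub>F z in nhds (snd c x). chart_inv c z \<in> S \<and> chart_inv c z \<in> fst c \<and> snd c (chart_inv c z) = z"
      using x by (intro eventually_chart_inv[OF A c S]) auto
    then show ?thesis
      by (rule eventually_mono) (metis A c chart_inv_restrict comp_apply)
  qed
  show "(snd c' \<circ> chart_inv (fst c \<inter> S, snd c)) differentiable (at (snd c x))"
    using differentiable_eventually_cong[OF diff_atlas_transition[OF A c c'] ev] x by (simp add: o_def)
qed

text \<open>The charts of the associated bundle require a smooth section over part of a chart
  domain, whereas a trivialization gives one over a set of its own choice.\<close>

lemma smooth_map_restrict_subset:
  assumes A: "diff_atlas A" and F: "smooth_map (restrict_atlas A U) B F"
    and V: "openin (manifold_topology A) V" "V \<subseteq> U"
  shows "smooth_map (restrict_atlas A V) B F"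
  unfolding smooth_map_def
proof
  fix x assume x: "x \<in> points (restrict_atlas A V)"
  then have "x \<in> points (restrict_atlas A U)" using V(2) by (auto simp: points_restrict)
  then obtain d c' W where d: "d \<in> restrict_atlas A U" and c': "c' \<in> B"
    and W: "openin (manifold_topology (restrict_atlas A U)) W" "x \<in> W" "W \<subseteq> fst d" "F ` W \<subseteq> fst c'"
    and sm: "smooth_on (snd d ` W) (snd c' \<circ> F \<circ> chart_inv d)"
    using F unfolding smooth_map_def by meson
  obtain c where c: "c \<in> A" and d': "d = (fst c \<inter> U, snd c)" using d unfolding restrict_atlas_def by blast
  have WV: "openin (manifold_topology A) (W \<inter> V)" using W(1) V(1) by (auto simp: openin_restrict[OF A])
  have sub: "W \<inter> V \<subseteq> fst c" using W(3) d' by auto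
  have o: "open (snd c ` (W \<inter> V))" using open_chart_image[OF A c WV] sub by (simp add: Int_absorb2)
  have "smooth_on (snd c ` (W \<inter> V)) (snd c' \<circ> F \<circ> chart_inv d)"
    using sm o by (rule smooth_on_subset) (auto simp: d')
  then have "smooth_on (snd c ` (W \<inter> V)) (snd c' \<circ> F \<circ> chart_inv (fst c \<inter> V, snd c))"
  proof (rule smooth_on_cong[OF o, THEN iffD1, rotated])
    fix z assume "z \<in> snd c ` (W \<inter> V)"
    then obtain y where "y \<in> W" "y \<in> V" "z = snd c y" by auto
    then show "(snd c' \<circ> F \<circ> chart_inv d) z = (snd c' \<circ> F \<circ> chart_inv (fst c \<inter> V, snd c)) z"
      using subsetD[OF sub, of y] subsetD[OF V(2), of y]
        chart_inv_restrict[OF A c, of y U] chart_inv_restrict[OF A c, of y V] d' by simp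
  qed
  moreover have "openin (manifold_topology (restrict_atlas A V)) (W \<inter> V)" using WV by (simp add: openin_restrict[OF A])
  moreover have "(fst c \<inter> V, snd c) \<in> restrict_atlas A V" using c by (auto simp: restrict_atlas_def)
  ultimately show "\<exists>c\<in>restrict_atlas A V. \<exists>c'\<in>B. \<exists>W. openin (manifold_topology (restrict_atlas A V)) W \<and> x \<in> W \<and>
      W \<subseteq> fst c \<and> F ` W \<subseteq> fst c' \<and> smooth_on (snd c ` W) (snd c' \<circ> F \<circ> chart_inv c)"
    using c' W sub x
    by (intro bexI[of _ "(fst c \<inter> V, snd c)"] bexI[of _ c'] exI[of _ "W \<inter> V"]) (auto simp: points_restrict)
qed

text \<open>In product charts, freezing the second argument is precomposition with the affine map z
  \<mapsto> (0, b) + (z, 0), with \<open>b\<close> in coordinates. Applied to the inverse of a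
  trivialization it produces smooth local sections.\<close>

lemma smooth_map_slice:
  assumes A: "diff_atlas A" and B: "diff_atlas B" and F: "smooth_map (prod_atlas A B) C F"
    and b: "b \<in> points B"
  shows "smooth_map A C (\<lambda>x. F (x, b))"
  unfolding smooth_map_def
proof
  fix x assume x: "x \<in> points A"
  note AB = diff_atlas_prod[OF A B]
  have "(x, b) \<in> points (prod_atlas A B)" using x b by (simp add: points_prod)
  then obtain d c' W where d: "d \<in> prod_atlas A B" and c': "c' \<in> C"
    and W: "openin (manifold_topology (prod_atlas A B)) W" "(x, b) \<in> W" "W \<subseteq> fst d" "F ` W \<subseteq> fst c'"
    and sm: "smooth_on (snd d ` W) (snd c' \<circ> F \<circ> chart_inv d)"
    using F unfolding smooth_map_def by meson
  from d obtain a e where a: "a \<in> A" and e: "e \<in> B" and d': "d = (fst a \<times> fst e, map_prod (snd a) (snd e))"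
    by (rule prod_atlasE)
  have "mdifferentiable A (prod_atlas A B) (\<lambda>y. (y, b)) x"
    using x b by (intro mdifferentiable_Pair mdifferentiable_const mdifferentiable_id A B)
  from mdifferentiable_preimage_nhd[OF A AB this W(1,2)]
  obtain W0 where W0: "openin (manifold_topology A) W0" "x \<in> W0" "\<And>y. y \<in> W0 \<Longrightarrow> (y, b) \<in> W"
    by blast
  have sub: "W0 \<subseteq> fst a" and be: "b \<in> fst e" using W0 W(2,3) d' by auto
  have o: "open (snd a ` W0)" using open_chart_image[OF A a W0(1)] sub by (simp add: Int_absorb2)
  have "bounded_linear (\<lambda>z. (z, 0))" by (intro bounded_linear_Pair bounded_linear_ident bounded_linear_zero)
  then have "smooth_on (snd a ` W0) (\<lambda>z. (snd c' \<circ> F \<circ> chart_inv d) ((0, snd e b) + (z, 0)))"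
  proof (rule smooth_on_compose_affine[OF _ _ o sm])
    fix z assume "z \<in> snd a ` W0"
    then show "(0, snd e b) + (z, 0) \<in> snd d ` W" using W0(3) d' by force
  qed
  then have "smooth_on (snd a ` W0) (snd c' \<circ> (\<lambda>x. F (x, b)) \<circ> chart_inv a)"
  proof (rule smooth_on_cong[OF o, THEN iffD1, rotated])
    fix z assume "z \<in> snd a ` W0"
    then obtain y where y: "y \<in> W0" "z = snd a y" by auto
    then have "y \<in> fst a" using sub by auto
    then show "(snd c' \<circ> F \<circ> chart_inv d) ((0, snd e b) + (z, 0)) = (snd c' \<circ> (\<lambda>x. F (x, b)) \<circ> chart_inv a) z"
      using chart_inv_prod[OF diff_atlas_inj[OF A a] diff_atlas_inj[OF B e] _ be, of y]
        diff_atlas_chart_inv[OF A a] y(2) by (simp add: d')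
  qed
  moreover have "(\<lambda>x. F (x, b)) ` W0 \<subseteq> fst c'" using W0(3) W(4) by auto
  ultimately show "\<exists>c\<in>A. \<exists>c'\<in>C. \<exists>W. openin (manifold_topology A) W \<and> x \<in> W \<and> W \<subseteq> fst c \<and>
      (\<lambda>x. F (x, b)) ` W \<subseteq> fst c' \<and> smooth_on (snd c ` W) (snd c' \<circ> (\<lambda>x. F (x, b)) \<circ> chart_inv c)"
    using a c' W0(1,2) sub by blast
qed

lemma smooth_map_restrict_codomain:
  assumes "smooth_map A (restrict_atlas B S) F" shows "smooth_map A B F"
  unfolding smooth_map_def
proof
  fix x assume "x \<in> points A"
  then obtain c d W where h: "c \<in> A" "d \<in> restrict_atlas B S" "openin (manifold_topology A) W" "x \<in> W"
    "W \<subseteq> fst c" "F ` W \<subseteq> fst d" "smooth_on (snd c ` W) (snd d \<circ> F \<circ> chart_inv c)"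
    using assms unfolding smooth_map_def by meson
  then obtain c' where "c' \<in> B" "d = (fst c' \<inter> S, snd c')" unfolding restrict_atlas_def by blast
  then show "\<exists>c\<in>A. \<exists>c'\<in>B. \<exists>W. openin (manifold_topology A) W \<and> x \<in> W \<and> W \<subseteq> fst c \<and>
      F ` W \<subseteq> fst c' \<and> smooth_on (snd c ` W) (snd c' \<circ> F \<circ> chart_inv c)"
    using h by (intro bexI[of _ c] bexI[of _ c'] exI[of _ W]) auto
qed

text \<open>The group and the bundle are arbitrary here; that they come from holonomy enters only in
  the final theorem.\<close>

locale frame_subbundle =
  fixes M :: "('m, real^'n::finite) atlas"
    and H :: "(real^'n^'n) set" and HA :: "(real^'n^'n, 'h::real_normed_vector) atlas"
    and P :: "('m, 'n) frame set" and PA :: "(('m, 'n) frame, 'p::real_normed_vector) atlas"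
  assumes smooth_base: "smooth_manifold M" and lie: "lie_subgroup H HA"
    and subbundle: "principal_subbundle M P PA H HA"
begin

lemma atlas_M: "diff_atlas M" by (rule smooth_manifold_diff_atlas[OF smooth_base])
lemma atlas_H: "diff_atlas HA" by (rule lie_subgroup_diff_atlas[OF lie])
lemma atlas_F: "diff_atlas (frame_atlas M)" by (rule diff_atlas_frame[OF smooth_base])
lemma atlas_P: "diff_atlas PA"
  using subbundle by (simp add: principal_subbundle_def smooth_manifold_diff_atlas)
lemma points_PA: "points PA = P" using subbundle by (simp add: principal_subbundle_def)
lemma points_HA: "points HA = H" by (rule lie_subgroup_points[OF lie])
lemma P_frame: "p \<in> P \<Longrightarrow> p \<in> frame_bundle M" using subbundle by (auto simp: principal_subbundle_def)
lemma P_act: "p \<in> P \<Longrightarrow> h \<in> H \<Longrightarrow> frame_act p h \<in> P" using subbundle by (simp add: principal_subbundle_def)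
lemma P_base: "p \<in> P \<Longrightarrow> fst p \<in> points M" using P_frame frame_bundle_base by blast

lemma mdifferentiable_inclusion: "p \<in> P \<Longrightarrow> mdifferentiable PA (frame_atlas M) (\<lambda>p. p) p"
  using subbundle points_PA by (intro smooth_map_mdifferentiable atlas_P) (auto simp: principal_subbundle_def)

lemma mdifferentiable_projection: "p \<in> P \<Longrightarrow> mdifferentiable PA M fst p"
  using mdifferentiable_compose[OF atlas_F atlas_M atlas_P mdifferentiable_inclusion
      mdifferentiable_frame_projection[OF smooth_base P_frame]] by simp

lemma mdifferentiable_act: "p \<in> P \<Longrightarrow> h \<in> H \<Longrightarrow> mdifferentiable (prod_atlas PA HA) PA (\<lambda>(p, h). frame_act p h) (p, h)"
  using subbundle points_PA points_HA
  by (intro smooth_map_mdifferentiable diff_atlas_prod atlas_P atlas_H) (auto simp: principal_subbundle_def points_prod)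

text \<open>\<open>s\<close> is the inverse of a trivialization along the identity of
  \<open>H\<close>. By equivariance \<open>s(fst p) \<theta>(p)\<close> has the same image as
  \<open>p\<close> under the trivialization, so \<theta> measures the displacement from
  \<open>s\<close>.\<close>

lemma local_section:
  assumes x: "x \<in> points M"
  obtains U \<theta> s where "openin (manifold_topology M) U" "x \<in> U"
    "\<And>y. y \<in> U \<Longrightarrow> s y \<in> P \<and> fst (s y) = y"
    "\<And>p. p \<in> P \<Longrightarrow> fst p \<in> U \<Longrightarrow> \<theta> p \<in> H \<and> frame_act (s (fst p)) (\<theta> p) = p"
    "\<And>p. p \<in> P \<Longrightarrow> fst p \<in> U \<Longrightarrow> mdifferentiable PA HA \<theta> p"
    "smooth_map (restrict_atlas M U) PA s"
proof -
  have "\<forall>x\<in>points M. \<exists>U \<theta>. openin (manifold_topology M) U \<and> x \<in> U \<and>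
      diffeomorphism (restrict_atlas PA {p \<in> P. fst p \<in> U}) (prod_atlas (restrict_atlas M U) HA)
        (\<lambda>p. (fst p, \<theta> p)) \<and>
      (\<forall>p\<in>P. \<forall>h\<in>H. fst p \<in> U \<longrightarrow> \<theta> (frame_act p h) = \<theta> p ** h)"
    using subbundle unfolding principal_subbundle_def by (elim conjE)
  from bspec[OF this x] obtain U \<theta> where U: "openin (manifold_topology M) U" "x \<in> U"
    and diffeo: "diffeomorphism (restrict_atlas PA {p \<in> P. fst p \<in> U}) (prod_atlas (restrict_atlas M U) HA)
          (\<lambda>p. (fst p, \<theta> p))"
    and equi: "\<forall>p\<in>P. \<forall>h\<in>H. fst p \<in> U \<longrightarrow> \<theta> (frame_act p h) = \<theta> p ** h"
    by (elim exE conjE) (rule that)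
  define S where "S = {p \<in> P. fst p \<in> U}"
  define F where "F p = (fst p, \<theta> p)" for p
  have UM: "U \<subseteq> points M" using openin_subset[OF U(1)] topspace_diff_atlas[OF atlas_M] by simp
  have pS: "points (restrict_atlas PA S) = S" by (auto simp: points_restrict points_PA S_def)
  have pU: "points (prod_atlas (restrict_atlas M U) HA) = U \<times> H"
    using UM by (auto simp: points_prod points_restrict points_HA)
  have bij: "bij_betw F S (U \<times> H)"
    and sF: "smooth_map (restrict_atlas PA S) (prod_atlas (restrict_atlas M U) HA) F"
    and sG: "smooth_map (prod_atlas (restrict_atlas M U) HA) (restrict_atlas PA S) (inv_into S F)"
    using diffeo pS pU unfolding diffeomorphism_def S_def[symmetric] F_def[abs_def, symmetric] by auto
  define s where "s y = inv_into S F (y, mat 1)" for y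
  have s: "s y \<in> S" "F (s y) = (y, mat 1)" if "y \<in> U" for y
    unfolding s_def using bij that lie_subgroup_one[OF lie]
    by (auto simp: bij_betw_def intro!: inv_into_into f_inv_into_f)
  have \<theta>H: "\<theta> p \<in> H" if "p \<in> S" for p
    using bij that by (auto simp: bij_betw_def F_def)
  have "frame_act (s (fst p)) (\<theta> p) = p" if p: "p \<in> P" "fst p \<in> U" for p
  proof -
    have pS: "p \<in> S" using p by (simp add: S_def)
    have sP: "s (fst p) \<in> P" "fst (s (fst p)) = fst p" "\<theta> (s (fst p)) = mat 1"
      using s[OF p(2)] by (auto simp: S_def F_def)
    have "frame_act (s (fst p)) (\<theta> p) \<in> S" using sP P_act[OF sP(1) \<theta>H[OF pS]] p by (simp add: S_def)
    moreover have "F (frame_act (s (fst p)) (\<theta> p)) = F p"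
      using equi sP \<theta>H[OF pS] p by (simp add: F_def)
    ultimately show ?thesis using bij pS by (auto simp: bij_betw_def dest: inj_onD)
  qed
  moreover have "mdifferentiable PA HA \<theta> p" if p: "p \<in> P" "fst p \<in> U" for p
  proof -
    have "mdifferentiable PA (prod_atlas (restrict_atlas M U) HA) F p"
      using p by (intro smooth_map_restrict_mdifferentiable[OF atlas_P sF]) (auto simp: points_PA S_def)
    from mdifferentiable_prodD(2)[OF this] show ?thesis by (simp add: F_def)
  qed
  moreover have "smooth_map (restrict_atlas M U) PA s"
  proof -
    have "mat 1 \<in> points HA" using lie_subgroup_one[OF lie] points_HA by simp
    from smooth_map_restrict_codomain[OF smooth_map_slice[OF diff_atlas_restrict[OF atlas_M U(1)] atlas_H sG this]]
    show ?thesis by (simp add: s_def[abs_def])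
  qed
  moreover have "s y \<in> P \<and> fst (s y) = y" if "y \<in> U" for y using s[OF that] by (simp add: S_def F_def)
  moreover have "\<theta> p \<in> H" if "p \<in> P" "fst p \<in> U" for p using \<theta>H that by (simp add: S_def)
  ultimately show thesis using that[of U s \<theta>] U by blast
qed

lemma P_over:
  assumes x: "x \<in> points M"
  obtains p where "p \<in> P" "fst p = x"
proof (rule local_section[OF x])
  fix U s assume "x \<in> U" "\<And>y. y \<in> U \<Longrightarrow> s y \<in> P \<and> fst (s y) = y"
  then show thesis using that[of "s x"] by simp
qed

lemma P_transitive:
  assumes p: "p \<in> P" and q: "q \<in> P" "fst p = fst q" obtains h where "h \<in> H" "q = frame_act p h"
proof -
  obtain U \<theta> s where "openin (manifold_topology M) U" and U: "fst p \<in> U"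
    and "\<And>y. y \<in> U \<Longrightarrow> s y \<in> P \<and> fst (s y) = y"
    and \<theta>: "\<And>p. p \<in> P \<Longrightarrow> fst p \<in> U \<Longrightarrow> \<theta> p \<in> H \<and> frame_act (s (fst p)) (\<theta> p) = p"
    and "\<And>p. p \<in> P \<Longrightarrow> fst p \<in> U \<Longrightarrow> mdifferentiable PA HA \<theta> p"
    and "smooth_map (restrict_atlas M U) PA s"
    by (rule local_section[OF P_base[OF p]]) (rule that)
  have tp: "\<theta> p \<in> H" "frame_act (s (fst p)) (\<theta> p) = p" using \<theta>[OF p U] by auto
  have tq: "\<theta> q \<in> H" "frame_act (s (fst p)) (\<theta> q) = q" using \<theta>[of q] q U by auto
  note i = lie_subgroup_inverse[OF lie tp(1)]
  have "frame_act p (matrix_inv (\<theta> p) ** \<theta> q) = frame_act (s (fst p)) (\<theta> p ** (matrix_inv (\<theta> p) ** \<theta> q))"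
    using tp(2) frame_act_mult by metis
  also have "\<dots> = q" using tq(2) i by (simp add: matrix_mul_assoc)
  finally show thesis using that lie_subgroup_mult[OF lie i(1) tq(1)] by metis
qed

lemma P_free: "p \<in> P \<Longrightarrow> frame_act p g = frame_act p h \<Longrightarrow> g = h"
  using frame_act_free[OF atlas_M P_frame] .

text \<open>Injectivity is claimed for the chart \<open>chart_at PA p\<close> because
  \<open>tangent_map\<close> is defined through that one, so no change of source chart
  intervenes.\<close>

lemma immersed:
  assumes p: "p \<in> P" and c: "c \<in> PA" "p \<in> fst c" and c': "c' \<in> frame_atlas M" "p \<in> fst c'"
  shows "(snd c' \<circ> chart_inv c) differentiable (at (snd c p))"
    and "c = chart_at PA p \<Longrightarrow> inj (frechet_derivative (snd c' \<circ> chart_inv c) (at (snd c p)))"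
proof -
  note m = mdifferentiable_in_charts[OF atlas_P atlas_F mdifferentiable_inclusion[OF p] c c']
  show d: "(snd c' \<circ> chart_inv c) differentiable (at (snd c p))" using m(2) by (simp add: o_def)
  assume c0: "c = chart_at PA p"
  let ?J = "frechet_derivative (snd c' \<circ> chart_inv c) (at (snd c p))"
  let ?T = "tangent_map PA (frame_atlas M) (\<lambda>p. p) p"
  have inj: "inj_on ?T (tangent_space PA p)" using subbundle p by (simp add: principal_subbundle_def)
  \<comment> \<open>Every component of the image vector is a function of its component
    \<open>?J w\<close> in \<open>c'\<close>; injectivity of the tangent map thus descends to the
    single linear map \<open>?J\<close>.\<close>
  have T: "?T (tangent_vector PA c p w) d = (if d \<in> frame_atlas M \<and> p \<in> fst d
      then frechet_derivative (snd d \<circ> chart_inv c') (at (snd c' p)) (?J w) else 0)" for w d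
  proof (cases "d \<in> frame_atlas M \<and> p \<in> fst d")
    case True
    have ev: "\<forall>\<^sub>F z in nhds (snd c p). (\<lambda>p. p) (chart_inv c z) \<in> fst c'" using m(1) by simp
    have "frechet_derivative (snd d \<circ> (\<lambda>p. p) \<circ> chart_inv c) (at (snd c p)) w =
        frechet_derivative (snd d \<circ> chart_inv c') (at (snd c' p))
          (frechet_derivative (snd c' \<circ> (\<lambda>p. p) \<circ> chart_inv c) (at (snd c p)) w)"
      using True codomain_transition(3)[OF atlas_F c'(1) _ _ _ _ ev m(2), of p d w] c'(2)
        diff_atlas_chart_inv[OF atlas_P c] by simp
    then show ?thesis
      using True by (simp add: tangent_map_def c0[symmetric] tangent_vector_chart[OF atlas_P c] o_def)
  qed (auto simp: tangent_map_def)
  show "inj ?J"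
  proof (rule injI)
    fix v w assume "?J v = ?J w"
    then have "?T (tangent_vector PA c p v) = ?T (tangent_vector PA c p w)" by (intro ext) (simp only: T)
    then have "tangent_vector PA c p v = tangent_vector PA c p w"
      using inj tangent_vector_in[OF atlas_P c] by (metis inj_onD)
    then show "v = w" using tangent_vector_chart[OF atlas_P c] by metis
  qed
qed

text \<open>The limit is claimed for the topology of \<open>PA\<close>. The factor s(x(t)) converges
  there because it depends on the base point alone and \<open>s\<close> maps into \<open>P\<close>
  differentiably; only the factor in \<open>H\<close> calls for the slice argument.\<close>

lemma smooth_arc_limitin:
  assumes \<gamma>: "smooth_arc (frame_atlas M) \<gamma> a b" and P: "\<And>t. t \<in> {a..b} \<Longrightarrow> \<gamma> t \<in> P" and t0: "t0 \<in> {a..b}"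
  shows "limitin (manifold_topology PA) \<gamma> (\<gamma> t0) (at t0 within {a..b})"
proof -
  let ?x = "\<lambda>t. fst (\<gamma> t)"
  obtain U \<theta> s where U: "openin (manifold_topology M) U" "?x t0 \<in> U"
    and s: "\<And>y. y \<in> U \<Longrightarrow> s y \<in> P \<and> fst (s y) = y"
    and \<theta>: "\<And>p. p \<in> P \<Longrightarrow> fst p \<in> U \<Longrightarrow> \<theta> p \<in> H \<and> frame_act (s (fst p)) (\<theta> p) = p"
    and "\<And>p. p \<in> P \<Longrightarrow> fst p \<in> U \<Longrightarrow> mdifferentiable PA HA \<theta> p"
    and smooth_s: "smooth_map (restrict_atlas M U) PA s"
    by (rule local_section[OF P_base[OF P[OF t0]]]) (rule that)
  obtain c where c: "c \<in> M" "?x t0 \<in> fst c" using P_base[OF P[OF t0]] by (auto simp: points_def)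
  have \<gamma>lim: "limitin (manifold_topology (frame_atlas M)) \<gamma> (\<gamma> t) (at t within {a..b})" if "t \<in> {a..b}" for t
    by (rule smooth_arc_in_chart(1)[OF atlas_F \<gamma> that])
  have xlim: "limitin (manifold_topology M) ?x (?x t) (at t within {a..b})" if "t \<in> {a..b}" for t
    by (rule limitin_mdifferentiable[OF atlas_F atlas_M mdifferentiable_frame_projection[OF smooth_base P_frame[OF P[OF that]]] \<gamma>lim[OF that]])
  have "openin (manifold_topology M) (U \<inter> fst c)" using U(1) openin_chart_domain[OF atlas_M c(1)] by (rule openin_Int)
  then have ev: "\<forall>\<^sub>F t in at t0 within {a..b}. ?x t \<in> U \<inter> fst c"
    using xlim[OF t0] U c by (auto simp: limitin_def)
  then obtain d where d: "d > 0" "\<And>t. t \<in> {a..b} \<Longrightarrow> t \<noteq> t0 \<Longrightarrow> dist t t0 < d \<Longrightarrow> ?x t \<in> U \<inter> fst c"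
    unfolding eventually_at by blast
  \<comment> \<open>A convex piece of the parameter interval over which the curve stays within both
    the trivialization and the chart \<open>c\<close>.\<close>
  define N where "N = {a..b} \<inter> ball t0 d"
  have N: "t \<in> {a..b}" "?x t \<in> U" "?x t \<in> fst c" if "t \<in> N" for t
    using that d(2)[of t] U c by (cases "t = t0"; auto simp: N_def dist_commute)+
  have UM: "U \<subseteq> points M" using openin_subset[OF U(1)] topspace_diff_atlas[OF atlas_M] by simp
  have slim: "limitin (manifold_topology PA) (\<lambda>t. s (?x t)) (s (?x t)) (at t within {a..b})" if t: "t \<in> N" for t
    using N[OF t] UM by (intro limitin_mdifferentiable[OF atlas_M atlas_P smooth_map_restrict_mdifferentiable[OF atlas_M smooth_s] xlim]) auto
  have fc: "frame_chart M c \<in> frame_atlas M" using c by (simp add: frame_atlas_eq)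
  have "continuous_on N (\<lambda>t. \<theta> (\<gamma> t))"
    unfolding continuous_on_def
  proof
    fix t1 assume t1: "t1 \<in> N"
    note p1 = P[OF N(1)[OF t1]]
    have frame: "((\<lambda>t. frame_matrix c (q t)) \<longlongrightarrow> frame_matrix c (q t1)) (at t1 within {a..b})"
      if "limitin (manifold_topology (frame_atlas M)) q (q t1) (at t1 within {a..b})"
        "q t1 \<in> frame_bundle M" "fst (q t1) \<in> fst c" for q
    proof -
      have "((\<lambda>t. snd (frame_chart M c) (q t)) \<longlongrightarrow> snd (frame_chart M c) (q t1)) (at t1 within {a..b})"
        using limitin_chart_iff[OF atlas_F fc, of "q t1" q "at t1 within {a..b}"] that by simp
      from tendsto_snd[OF this] show ?thesis by simp
    qed
    have sP: "s (?x t) \<in> P" "fst (s (?x t)) = ?x t" if "t \<in> N" for t using s N(2)[OF that] by auto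
    have "limitin (manifold_topology (frame_atlas M)) (\<lambda>t. s (?x t)) (s (?x t1)) (at t1 within {a..b})"
      using limitin_mdifferentiable[OF atlas_P atlas_F mdifferentiable_inclusion[OF sP(1)[OF t1]] slim[OF t1]] .
    then have X: "((\<lambda>t. frame_matrix c (s (?x t))) \<longlongrightarrow> frame_matrix c (s (?x t1))) (at t1 within {a..b})"
      using sP[OF t1] N(3)[OF t1] P_frame by (intro frame) auto
    have Y: "((\<lambda>t. frame_matrix c (\<gamma> t)) \<longlongrightarrow> frame_matrix c (\<gamma> t1)) (at t1 within {a..b})"
      using N(3)[OF t1] P_frame[OF p1] by (intro frame \<gamma>lim N t1)
    have eq: "frame_matrix c (\<gamma> t) = frame_matrix c (s (?x t)) ** \<theta> (\<gamma> t)" if "t \<in> N" for t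
      using \<theta>[OF P[OF N(1)[OF that]] N(2)[OF that]] frame_matrix_act by metis
    have sub: "N \<subseteq> {a..b}" by (auto simp: N_def)
    \<comment> \<open>By \<open>eq\<close>, \<theta>(\<gamma> t) is the quotient of two continuous
      families of frame matrices, which gives continuity for the topology of matrices.\<close>
    show "((\<lambda>t. \<theta> (\<gamma> t)) \<longlongrightarrow> \<theta> (\<gamma> t1)) (at t1 within N)"
    proof (rule tendsto_matrix_solve[OF tendsto_within_subset[OF X sub] tendsto_within_subset[OF Y sub]])
      show "invertible (frame_matrix c (s (?x t1)))"
        using sP[OF t1] N(3)[OF t1] P_frame by (intro frame_matrix_invertible[OF atlas_M _ c(1)]) auto
      show "\<forall>\<^sub>F t in at t1 within N. frame_matrix c (\<gamma> t) = frame_matrix c (s (?x t)) ** \<theta> (\<gamma> t)"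
        by (auto simp: eventually_at_filter eq)
    qed (rule eq[OF t1])
  qed
  moreover have t0N: "t0 \<in> N" using t0 d(1) by (simp add: N_def)
  moreover have "convex N" unfolding N_def by (intro convex_Int convex_ball) auto
  moreover have "(\<lambda>t. \<theta> (\<gamma> t)) ` N \<subseteq> H" using \<theta>[OF P[OF N(1)] N(2)] by auto
  ultimately have "limitin (manifold_topology HA) (\<lambda>t. \<theta> (\<gamma> t)) (\<theta> (\<gamma> t0)) (at t0 within N)"
    by (intro lie_subgroup_curve_limitin[OF lie])
  moreover have "at t0 within N = at t0 within {a..b}"
    using d(1) by (intro at_within_nhd[of _ "ball t0 d"]) (auto simp: N_def)
  \<comment> \<open>Both factors now converge in their own topologies, and the action P \<times> H
    \<rightarrow> P is differentiable for these structures, hence continuous.\<close>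
  ultimately have "limitin (manifold_topology (prod_atlas PA HA)) (\<lambda>t. (s (?x t), \<theta> (\<gamma> t)))
      (s (?x t0), \<theta> (\<gamma> t0)) (at t0 within {a..b})"
    using slim[OF t0N] by (intro limitin_Pair_prod atlas_P atlas_H) auto
  moreover have "s (?x t0) \<in> P" "\<theta> (\<gamma> t0) \<in> H" using s[OF U(2)] \<theta>[OF P[OF t0] U(2)] by auto
  ultimately have "limitin (manifold_topology PA) (\<lambda>t. case (s (?x t), \<theta> (\<gamma> t)) of (p, h) \<Rightarrow> frame_act p h)
      (case (s (?x t0), \<theta> (\<gamma> t0)) of (p, h) \<Rightarrow> frame_act p h) (at t0 within {a..b})"
    by (intro limitin_mdifferentiable[OF diff_atlas_prod[OF atlas_P atlas_H] atlas_P mdifferentiable_act])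
  then have "limitin (manifold_topology PA) (\<lambda>t. frame_act (s (?x t)) (\<theta> (\<gamma> t))) (\<gamma> t0) (at t0 within {a..b})"
    using \<theta>[OF P[OF t0] U(2)] by simp
  moreover have "\<forall>\<^sub>F t in at t0 within {a..b}. frame_act (s (?x t)) (\<theta> (\<gamma> t)) = \<gamma> t"
    using ev by (auto simp: eventually_at_filter \<theta> P elim: eventually_mono)
  ultimately show ?thesis by (rule limitin_transform_eventually[rotated])
qed

end

section \<open>Parallel sections\<close>

text \<open>Rescaling multiplies the velocity by \<open>s\<close>; the distribution is closed under
  linear combinations, here with coefficients \<open>s\<close> and 0.\<close>

lemma horizontal_arc_rescale:
  fixes M :: "('m, real^'n::finite) atlas"
  assumes M: "smooth_manifold M" and A: "is_connection M A"
    and \<gamma>: "smooth_arc (frame_atlas M) \<gamma> a b" "\<forall>t\<in>{a..b}. velocity (frame_atlas M) \<gamma> {a..b} t \<in> A (\<gamma> t)"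
    and s: "s > 0" and b': "a < b'" "b' \<le> b"
  shows "smooth_arc (frame_atlas M) (\<lambda>t. \<gamma> (s * t)) (a / s) (b' / s) \<and>
    (\<forall>t\<in>{a / s..b' / s}. velocity (frame_atlas M) (\<lambda>t. \<gamma> (s * t)) {a / s..b' / s} t \<in> A (\<gamma> (s * t)))"
proof (intro conjI ballI)
  note F = diff_atlas_frame[OF M]
  show "smooth_arc (frame_atlas M) (\<lambda>t. \<gamma> (s * t)) (a / s) (b' / s)"
    by (rule smooth_arc_rescale[OF \<gamma>(1) s b'(2)])
  fix t assume t: "t \<in> {a / s..b' / s}"
  have st: "s * t \<in> {a..b}" using t s b' by (auto simp: field_simps)
  let ?\<xi> = "velocity (frame_atlas M) \<gamma> {a..b} (s * t)"
  have "\<gamma> (s * t) \<in> frame_bundle M"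
    using smooth_arc_in_chart(3)[OF F \<gamma>(1) st] by (simp add: points_frame_atlas)
  then have "(\<lambda>c. s *\<^sub>R ?\<xi> c + 0 *\<^sub>R ?\<xi> c) \<in> A (\<gamma> (s * t))"
    using A \<gamma>(2) st unfolding is_connection_def by blast
  then show "velocity (frame_atlas M) (\<lambda>t. \<gamma> (s * t)) {a / s..b' / s} t \<in> A (\<gamma> (s * t))"
    by (simp add: velocity_rescale[OF F \<gamma>(1) s b' t])
qed

text \<open>Stretching the part up to time \<open>t\<close> over the unit interval turns
  \<open>\<gamma> t\<close> into an end point. Time 0 is excluded because the factor must be
  positive.\<close>

lemma horizontal_curve_truncate:
  fixes M :: "('m, real^'n::finite) atlas"
  assumes M: "smooth_manifold M" and A: "is_connection M A" and \<gamma>: "horizontal_curve M A \<gamma>"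
    and t: "0 < t" "t \<le> 1"
  shows "horizontal_curve M A (\<lambda>s. \<gamma> (t * s))" "\<gamma> t \<in> frame_bundle M"
proof -
  let ?Q = "\<lambda>\<gamma> a b. smooth_arc (frame_atlas M) \<gamma> a b \<and>
       (\<forall>t\<in>{a..b}. velocity (frame_atlas M) \<gamma> {a..b} t \<in> A (\<gamma> t))"
  obtain k \<tau> where \<tau>: "\<tau> 0 = (0::real)" "\<tau> k = 1"
    and Q: "\<And>i. i < k \<Longrightarrow> \<tau> i < \<tau> (Suc i) \<and> ?Q \<gamma> (\<tau> i) (\<tau> (Suc i))"
    using \<gamma> unfolding horizontal_curve_def piecewise_def by blast
  have "\<exists>i<k. \<tau> i < t \<and> t \<le> \<tau> (Suc i)"
  proof (rule ccontr)
    assume c: "\<not> ?thesis"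
    have "i \<le> k \<Longrightarrow> \<tau> i < t" for i
    proof (induction i)
      case (Suc i)
      then show ?case using c by (metis Suc_le_lessD Suc_leD not_le)
    qed (use \<tau> t in simp)
    then show False using \<tau> t by force
  qed
  then obtain i where i: "i < k" "\<tau> i < t" "t \<le> \<tau> (Suc i)" by blast
  have arc: "smooth_arc (frame_atlas M) \<gamma> (\<tau> i) (\<tau> (Suc i))" using Q[OF i(1)] by blast
  show "\<gamma> t \<in> frame_bundle M"
    using smooth_arc_in_chart(3)[OF diff_atlas_frame[OF M] arc, of t] i by (simp add: points_frame_atlas)
  \<comment> \<open>Breakpoints up to the piece containing \<open>t\<close>, rescaled, followed by
    1. That piece is chosen with \<open>\<tau> i < t\<close> strictly, so the last new piece is
    nondegenerate.\<close>
  define \<tau>' where "\<tau>' j = (if j \<le> i then \<tau> j / t else 1)" for j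
  have "\<tau>' 0 = 0" "\<tau>' (Suc i) = 1" using \<tau> by (simp_all add: \<tau>'_def)
  moreover have "\<tau>' j < \<tau>' (Suc j) \<and> ?Q (\<lambda>s. \<gamma> (t * s)) (\<tau>' j) (\<tau>' (Suc j))" if j: "j < Suc i" for j
  proof (cases "j = i")
    case True
    have "?Q (\<lambda>s. \<gamma> (t * s)) (\<tau> i / t) (t / t)"
      using horizontal_arc_rescale[OF M A, of \<gamma> "\<tau> i" "\<tau> (Suc i)" t t] Q[OF i(1)] t i by blast
    then show ?thesis using True i t by (simp add: \<tau>'_def)
  next
    case False
    then have j': "j < i" "j < k" using j i by auto
    have "?Q (\<lambda>s. \<gamma> (t * s)) (\<tau> j / t) (\<tau> (Suc j) / t)"
      using horizontal_arc_rescale[OF M A, of \<gamma> "\<tau> j" "\<tau> (Suc j)" t "\<tau> (Suc j)"] Q[OF j'(2)] t by blast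
    then show ?thesis using Q[OF j'(2)] j' t by (simp add: \<tau>'_def divide_strict_right_mono)
  qed
  ultimately show "horizontal_curve M A (\<lambda>s. \<gamma> (t * s))"
    unfolding horizontal_curve_def piecewise_def by blast
qed

lemma differential_zero:
  assumes A: "diff_atlas A" and x: "x \<in> points A" and g: "mdifferentiable A (std_atlas UNIV) g x"
  shows "differential A g x (\<lambda>c. 0) = 0"
  using mdifferentiable_std_iff[OF A, of "chart_at A x" x g] chart_at[OF x] g
  by (simp add: differential_def linear_0 linear_frechet_derivative)

locale frame_subbundle_rep = frame_subbundle M H HA P PA
  for M :: "('m, real^'n::finite) atlas" and H HA P PA +
  fixes \<rho> :: "real^'n^'n \<Rightarrow> 'v::real_normed_vector \<Rightarrow>\<^sub>L 'v"
  assumes rep: "is_representation HA \<rho>"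
begin

section \<open>Points of the associated bundle and functions of sections\<close>

abbreviation "cls \<equiv> assoc_class P H \<rho>"

lemma rep_bij: "h \<in> H \<Longrightarrow> bij (blinfun_apply (\<rho> h))"
  using rep by (simp add: is_representation_def points_HA)

lemma rep_mult: "g \<in> H \<Longrightarrow> h \<in> H \<Longrightarrow> \<rho> (g ** h) v = \<rho> g (\<rho> h v)"
  using rep by (simp add: is_representation_def points_HA)

text \<open>\<open>is_representation\<close> does not state the unit law; it follows because
  \<rho>(1) is idempotent and injective.\<close>

lemma rep_one: "\<rho> (mat 1) v = v"
proof -
  note one = lie_subgroup_one[OF lie]
  have "\<rho> (mat 1) (\<rho> (mat 1) v) = \<rho> (mat 1) v" using rep_mult[OF one one] by simp
  then show ?thesis using bij_is_inj[OF rep_bij[OF one]] by (simp add: inj_eq)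
qed

lemma rep_inverse:
  assumes h: "h \<in> H"
  shows "\<rho> h (\<rho> (matrix_inv h) v) = v" "\<rho> (matrix_inv h) (\<rho> h v) = v" "inv (blinfun_apply (\<rho> h)) v = \<rho> (matrix_inv h) v"
proof -
  note i = lie_subgroup_inverse[OF lie h]
  show 1: "\<rho> h (\<rho> (matrix_inv h) v) = v" "\<rho> (matrix_inv h) (\<rho> h v) = v"
    using rep_mult[OF h i(1)] rep_mult[OF i(1) h] i rep_one by metis+
  show "inv (blinfun_apply (\<rho> h)) v = \<rho> (matrix_inv h) v"
    by (rule inv_f_eq[OF bij_is_inj[OF rep_bij[OF h]] 1(1)])
qed

lemma cls_eq: "p \<in> P \<Longrightarrow> cls p v = {(frame_act p h, \<rho> (matrix_inv h) v) | h. h \<in> H}"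
proof -
  assume p: "p \<in> P"
  have "cls p v = {(frame_act p h, inv (blinfun_apply (\<rho> h)) v) | h. h \<in> H}"
    unfolding assoc_class_def assoc_rel_def using p by blast
  also have "\<dots> = {(frame_act p h, \<rho> (matrix_inv h) v) | h. h \<in> H}"
    using rep_inverse(3) by (intro Collect_cong ex_cong1) auto
  finally show ?thesis .
qed

text \<open>The substitution k = h g matches the two orbits. This is the rule by which
  representatives are moved along a fibre.\<close>

lemma cls_act:
  assumes p: "p \<in> P" and h: "h \<in> H"
  shows "cls (frame_act p h) w = cls p (\<rho> h w)"
proof -
  note hi = lie_subgroup_inverse[OF lie h]
  have inv: "matrix_inv (h ** g) = matrix_inv g ** matrix_inv h" if g: "g \<in> H" for g
  proof -
    note gi = lie_subgroup_inverse[OF lie g]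
    note hgi = lie_subgroup_inverse[OF lie lie_subgroup_mult[OF lie h g]]
    have "(matrix_inv g ** matrix_inv h) ** (h ** g) = mat 1"
      by (metis gi(3) hi(3) matrix_mul_assoc matrix_mul_rid)
    then show ?thesis by (metis hgi(2) matrix_mul_assoc matrix_mul_lid matrix_mul_rid)
  qed
  have eq: "\<rho> (matrix_inv (h ** g)) (\<rho> h w) = \<rho> (matrix_inv g) w" if g: "g \<in> H" for g
    using rep_mult[OF lie_subgroup_inverse(1)[OF lie g] hi(1)] rep_inverse(2)[OF h] by (simp add: inv[OF g])
  have "cls (frame_act p h) w = {(frame_act p (h ** g), \<rho> (matrix_inv (h ** g)) (\<rho> h w)) | g. g \<in> H}"
    using cls_eq[OF P_act[OF p h]] eq by (auto simp: frame_act_mult)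
  also have "\<dots> = {(frame_act p k, \<rho> (matrix_inv k) (\<rho> h w)) | k. k \<in> H}"
  proof (intro Collect_cong iffI; elim exE conjE)
    fix z k assume "z = (frame_act p k, \<rho> (matrix_inv k) (\<rho> h w))" "k \<in> H"
    then show "\<exists>g. z = (frame_act p (h ** g), \<rho> (matrix_inv (h ** g)) (\<rho> h w)) \<and> g \<in> H"
      using hi lie_subgroup_mult[OF lie hi(1)]
      by (intro exI[of _ "matrix_inv h ** k"]) (simp add: matrix_mul_assoc)
  qed (use lie_subgroup_mult[OF lie h] in blast)
  finally show ?thesis using cls_eq[OF p] by simp
qed

lemma cls_self: "p \<in> P \<Longrightarrow> (p, v) \<in> cls p v"
proof -
  assume p: "p \<in> P"
  note one = lie_subgroup_one[OF lie]
  have "(frame_act p (mat 1), \<rho> (matrix_inv (mat 1)) v) \<in> cls p v" using cls_eq[OF p] one by blast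
  moreover have "\<rho> (matrix_inv (mat 1)) v = v" using rep_inverse(2)[OF one, of v] by (simp add: rep_one)
  ultimately show ?thesis by (simp add: frame_act_one)
qed

text \<open>Two pairs over the same \<open>p\<close> in one class differ by some \<open>h\<close>
  fixing \<open>p\<close>, and freeness of the action forces \<open>h = mat 1\<close>.\<close>

lemma cls_inj:
  assumes p: "p \<in> P" and eq: "cls p v = cls p w" shows "v = w"
proof -
  obtain h where h: "h \<in> H" "p = frame_act p h" "v = \<rho> (matrix_inv h) w"
    using cls_self[OF p, of v] eq cls_eq[OF p, of w] by auto
  then have "h = mat 1" using P_free[OF p] frame_act_one by metis
  then show "v = w" using h rep_inverse(2)[OF lie_subgroup_one[OF lie], of w] by (simp add: rep_one)
qed

lemma cls_base: "p \<in> P \<Longrightarrow> q \<in> P \<Longrightarrow> cls p v = cls q w \<Longrightarrow> fst p = fst q"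
  using cls_self[of p v] cls_eq[of q w] by auto

text \<open>Transitivity on fibres moves the given representative to \<open>p\<close>, and
  \<open>cls_inj\<close> makes the description by \<open>THE\<close> unique.\<close>

lemma section_function_eq:
  assumes \<sigma>: "\<exists>q\<in>P. \<exists>v. fst q = fst p \<and> \<sigma> (fst p) = cls q v" and p: "p \<in> P"
  shows "\<sigma> (fst p) = cls p (section_function P H \<rho> \<sigma> p)"
proof -
  obtain q v where q: "q \<in> P" "fst q = fst p" "\<sigma> (fst p) = cls q v" using \<sigma> by blast
  obtain h where h: "h \<in> H" "q = frame_act p h" using P_transitive[OF p q(1)] q(2) by metis
  have eq: "\<sigma> (fst p) = cls p (\<rho> h v)" using q(3) h cls_act[OF p h(1)] by simp
  have "section_function P H \<rho> \<sigma> p = \<rho> h v"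
    unfolding section_function_def using eq cls_inj[OF p] by (intro the_equality) auto
  then show ?thesis using eq by simp
qed

lemma section_function_unique:
  "p \<in> P \<Longrightarrow> \<sigma> (fst p) = cls p v \<Longrightarrow> section_function P H \<rho> \<sigma> p = v"
  unfolding section_function_def using cls_inj by (intro the_equality) auto

text \<open>A class determines its base point, hence the \<open>x\<close> in the description, and
  over that point it determines the vector.\<close>

lemma assoc_chart_apply:
  assumes s: "\<And>x. x \<in> U \<Longrightarrow> s x \<in> P \<and> fst (s x) = x" and y: "y \<in> U"
  shows "(THE z. \<exists>x\<in>U. \<exists>w. cls (s y) v = cls (s x) w \<and> z = (k x, w)) = (k y, v)"
proof (rule the_equality)
  fix z assume "\<exists>x\<in>U. \<exists>w. cls (s y) v = cls (s x) w \<and> z = (k x, w)"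
  then obtain x w where x: "x \<in> U" "cls (s y) v = cls (s x) w" "z = (k x, w)" by blast
  have "x = y" using cls_base[OF _ _ x(2)] s[OF x(1)] s[OF y] by simp
  then show "z = (k y, v)" using x cls_inj s[OF y] by metis
qed (use y in blast)

text \<open>For invariant \<open>v\<close> the class does not depend on the chosen point of the
  fibre, by \<open>cls_act\<close>. The restriction to \<open>points M\<close> follows the
  convention for sections.\<close>

definition invariant_section :: "'v \<Rightarrow> 'm \<Rightarrow> (('m, 'n) frame \<times> 'v) set" where
  "invariant_section v = (\<lambda>x\<in>points M. cls (SOME p. p \<in> P \<and> fst p = x) v)"

lemma invariant_section_apply:
  assumes v: "v \<in> invariant_vectors H \<rho>" and p: "p \<in> P"
  shows "invariant_section v (fst p) = cls p v"
proof -
  define q where "q = (SOME q. q \<in> P \<and> fst q = fst p)"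
  have q: "q \<in> P \<and> fst q = fst p" unfolding q_def by (rule someI[of _ p]) (use p in simp)
  obtain h where h: "h \<in> H" "q = frame_act p h" using P_transitive[OF p] q by metis
  have "cls q v = cls p v" using cls_act[OF p h(1)] h v by (simp add: invariant_vectors_def)
  then show ?thesis using P_base[OF p] by (simp add: invariant_section_def q_def)
qed

text \<open>In the chart of \<open>E\<close> built from a local section of \<open>P\<close>, the
  vector part of this section is the constant \<open>v\<close>.\<close>

lemma invariant_section_smooth:
  assumes v: "v \<in> invariant_vectors H \<rho>"
  shows "invariant_section v \<in> smooth_sections M PA H \<rho>"
proof -
  have "smooth_map M (assoc_atlas M PA H \<rho>) (invariant_section v)"
    unfolding smooth_map_def
  proof
    fix x assume x: "x \<in> points M"
    obtain U \<theta> s where U: "openin (manifold_topology M) U" "x \<in> U"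
      and s: "\<And>y. y \<in> U \<Longrightarrow> s y \<in> P \<and> fst (s y) = y"
      and "\<And>p. p \<in> P \<Longrightarrow> fst p \<in> U \<Longrightarrow> \<theta> p \<in> H \<and> frame_act (s (fst p)) (\<theta> p) = p"
      and "\<And>p. p \<in> P \<Longrightarrow> fst p \<in> U \<Longrightarrow> mdifferentiable PA HA \<theta> p"
      and sm: "smooth_map (restrict_atlas M U) PA s"
      by (rule local_section[OF x]) (rule that)
    obtain c where c: "c \<in> M" "x \<in> fst c" using x by (auto simp: points_def)
    \<comment> \<open>The charts of \<open>E\<close> are taken over sets inside a chart domain of
      the base.\<close>
    define V where "V = U \<inter> fst c"
    have V: "openin (manifold_topology M) V" "x \<in> V" "V \<subseteq> fst c" "V \<subseteq> U"
      unfolding V_def using U c openin_chart_domain[OF atlas_M c(1)] by auto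
    have smV: "smooth_map (restrict_atlas M V) PA s"
      by (rule smooth_map_restrict_subset[OF atlas_M sm V(1) V(4)])
    define e where "e = ({cls (s x) w | x w. x \<in> V}, \<lambda>e. THE z. \<exists>x\<in>V. \<exists>w. e = cls (s x) w \<and> z = (snd c x, w))"
    have e: "e \<in> assoc_atlas M PA H \<rho>"
      unfolding assoc_atlas_def e_def points_PA
      by (intro CollectI exI[of _ c] exI[of _ V] exI[of _ s]) (use c V smV s in auto)
    have val: "invariant_section v y = cls (s y) v" if "y \<in> V" for y
      using invariant_section_apply[OF v, of "s y"] s[of y] that V(4) by auto
    have "snd e (invariant_section v y) = (snd c y, v)" if "y \<in> V" for y
      unfolding val[OF that] e_def snd_conv using s V(4) that by (intro assoc_chart_apply) auto
    then have eq: "(snd e \<circ> invariant_section v \<circ> chart_inv c) z = (z, v)" if "z \<in> snd c ` V" for z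
      using that V(3) diff_atlas_chart_inv[OF atlas_M c(1)] by auto
    have "open (snd c ` V)" using open_chart_image[OF atlas_M c(1) V(1)] V(3) by (simp add: Int_absorb2)
    then have "smooth_on (snd c ` V) (snd e \<circ> invariant_section v \<circ> chart_inv c)"
      using smooth_on_cong[of "snd c ` V" "snd e \<circ> invariant_section v \<circ> chart_inv c" "\<lambda>z. (z, v)"]
        eq smooth_on_Pair_const by blast
    moreover have "invariant_section v ` V \<subseteq> fst e" using val by (auto simp: e_def)
    ultimately show "\<exists>c\<in>M. \<exists>c'\<in>assoc_atlas M PA H \<rho>. \<exists>W. openin (manifold_topology M) W \<and> x \<in> W \<and> W \<subseteq> fst c \<and>
        invariant_section v ` W \<subseteq> fst c' \<and>
        smooth_on (snd c ` W) (snd c' \<circ> invariant_section v \<circ> chart_inv c)"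
      using c(1) e V by blast
  qed
  moreover have "\<exists>p\<in>points PA. \<exists>w. fst p = x \<and> invariant_section v x = assoc_class (points PA) H \<rho> p w"
    if "x \<in> points M" for x
    using P_over[OF that] invariant_section_apply[OF v] points_PA by metis
  moreover have "invariant_section v \<in> extensional (points M)" by (simp add: invariant_section_def)
  ultimately show ?thesis unfolding smooth_sections_def by blast
qed

text \<open>Smoothness of \<sigma> controls \<open>f\<close> only along the local section
  \<open>s1\<close> hidden in some chart of \<open>E\<close>. Equivariance spreads this over
  \<open>P\<close>: if q \<kappa>(q) = s1(fst q), then f(q) = \<rho>(\<kappa>(q)) f(s1(fst q)), so
  differentiability of \<kappa> is what remains.\<close>

lemma mdifferentiable_section_function:
  assumes \<sigma>: "\<sigma> \<in> smooth_sections M PA H \<rho>" and p: "p \<in> P"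
  shows "mdifferentiable PA (std_atlas UNIV) (section_function P H \<rho> \<sigma>) p"
proof -
  define f where "f = section_function P H \<rho> \<sigma>"
  define x where "x = fst p"
  have xM: "x \<in> points M" using P_base[OF p] by (simp add: x_def)
  have f: "\<sigma> (fst q) = cls q (f q)" if "q \<in> P" for q
    unfolding f_def using \<sigma> P_base[OF that] that
    by (intro section_function_eq) (auto simp: smooth_sections_def points_PA)
  obtain c e W where c: "c \<in> M" and e: "e \<in> assoc_atlas M PA H \<rho>"
    and W: "openin (manifold_topology M) W" "x \<in> W" "W \<subseteq> fst c" "\<sigma> ` W \<subseteq> fst e"
    and sm: "smooth_on (snd c ` W) (snd e \<circ> \<sigma> \<circ> chart_inv c)"
  proof -
    have "smooth_map M (assoc_atlas M PA H \<rho>) \<sigma>" using \<sigma> by (simp add: smooth_sections_def)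
    from bspec[OF this[unfolded smooth_map_def] xM] show thesis
      by (elim bexE exE conjE) (rule that)
  qed
  obtain c1 :: "('m, real^'n) chart" and U1 s1 where e': "e = ({cls (s1 x) w | x w. x \<in> U1},
       \<lambda>e. THE z. \<exists>x\<in>U1. \<exists>w. e = cls (s1 x) w \<and> z = (snd c1 x, w))"
    and U1: "openin (manifold_topology M) U1"
    and s1: "smooth_map (restrict_atlas M U1) PA s1" "\<forall>x\<in>U1. fst (s1 x) = x"
    using e unfolding assoc_atlas_def points_PA by (elim CollectE exE conjE) (rule that)
  have U1M: "U1 \<subseteq> points M" using openin_subset[OF U1] topspace_diff_atlas[OF atlas_M] by simp
  have s1P: "s1 y \<in> P \<and> fst (s1 y) = y" if "y \<in> U1" for y
    using smooth_map_points[OF s1(1), of y] that U1M s1(2) by (auto simp: points_restrict points_PA)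
  \<comment> \<open>\<sigma> maps \<open>W\<close> into the domain of the chart \<open>e\<close>,
    whose classes lie over \<open>U1\<close>; as a class determines its base point, \<open>W\<close>
    lies in \<open>U1\<close>.\<close>
  have WU1: "W \<subseteq> U1"
  proof
    fix y assume y: "y \<in> W"
    have "y \<in> points M" using W(3) y c by (auto simp: points_def)
    then obtain q where q: "q \<in> P" "fst q = y" by (rule P_over)
    have "\<sigma> y \<in> fst e" using W(4) y by auto
    then obtain y' w where y': "y' \<in> U1" "\<sigma> y = cls (s1 y') w" by (auto simp: e')
    then have "fst q = fst (s1 y')" using cls_base[OF q(1)] s1P[OF y'(1)] f[OF q(1)] q(2) by metis
    then show "y \<in> U1" using q y' s1P by simp
  qed
  have \<sigma>s: "\<sigma> y = cls (s1 y) (f (s1 y))" if "y \<in> U1" for y using f[of "s1 y"] s1P[OF that] by simp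
  have fs: "f (s1 y) = snd (snd e (\<sigma> y))" if y: "y \<in> U1" for y
    unfolding \<sigma>s[OF y] e' snd_conv using assoc_chart_apply[of U1 s1 y "f (s1 y)" "snd c1"] s1P y by simp
  have xc: "x \<in> fst c" using W by auto
  have "mdifferentiable M (std_atlas UNIV) (\<lambda>y. f (s1 y)) x"
    unfolding mdifferentiable_std_iff[OF atlas_M c xc]
  proof (rule differentiable_eventually_cong)
    have "(snd e \<circ> \<sigma> \<circ> chart_inv c) differentiable (at (snd c x))"
      using W(2) by (intro smooth_on_imp_differentiable[OF sm]) auto
    then show "(\<lambda>z. snd ((snd e \<circ> \<sigma> \<circ> chart_inv c) z)) differentiable (at (snd c x))"
      unfolding differentiable_def by (blast intro: has_derivative_snd)
    have "\<forall>\<^sub>F z in nhds (snd c x). chart_inv c z \<in> W"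
      using eventually_chart_inv[OF atlas_M c W(1,2) xc] by eventually_elim simp
    then show "\<forall>\<^sub>F z in nhds (snd c x). ((\<lambda>y. f (s1 y)) \<circ> chart_inv c) z = snd ((snd e \<circ> \<sigma> \<circ> chart_inv c) z)"
      by (rule eventually_mono) (use fs WU1 in auto)
  qed
  from mdifferentiable_compose[OF atlas_M diff_atlas_std atlas_P mdifferentiable_projection[OF p] this[unfolded x_def]]
  have m1: "mdifferentiable PA (std_atlas UNIV) (\<lambda>q. f (s1 (fst q))) p" .
  obtain U \<theta> s where U: "openin (manifold_topology M) U" "x \<in> U"
    and s: "\<And>y. y \<in> U \<Longrightarrow> s y \<in> P \<and> fst (s y) = y"
    and \<theta>: "\<And>p. p \<in> P \<Longrightarrow> fst p \<in> U \<Longrightarrow> \<theta> p \<in> H \<and> frame_act (s (fst p)) (\<theta> p) = p"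
    and m\<theta>: "\<And>p. p \<in> P \<Longrightarrow> fst p \<in> U \<Longrightarrow> mdifferentiable PA HA \<theta> p"
    and "smooth_map (restrict_atlas M U) PA s"
    by (rule local_section[OF xM]) (rule that)
  \<comment> \<open>The element carrying \<open>q\<close> to \<open>s1 (fst q)\<close>. Expressed as
    a quotient of displacements from a second local section \<open>s\<close>, it inherits
    differentiability from \<theta> and the group operations.\<close>
  define \<kappa> where "\<kappa> q = matrix_inv (\<theta> q) ** \<theta> (s1 (fst q))" for q
  have xU1: "x \<in> U1" using WU1 W by auto
  have key: "f q = \<rho> (\<kappa> q) (f (s1 (fst q)))" if q: "q \<in> P" "fst q \<in> W" "fst q \<in> U" for q
  proof -
    have y: "fst q \<in> U1" using WU1 q by auto
    note sq = s1P[OF y]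
    have t1: "\<theta> q \<in> H" "frame_act (s (fst q)) (\<theta> q) = q" using \<theta>[OF q(1,3)] by auto
    have t2: "\<theta> (s1 (fst q)) \<in> H" "frame_act (s (fst q)) (\<theta> (s1 (fst q))) = s1 (fst q)"
      using \<theta>[of "s1 (fst q)"] sq q by auto
    note i = lie_subgroup_inverse[OF lie t1(1)]
    have \<kappa>H: "\<kappa> q \<in> H" unfolding \<kappa>_def by (rule lie_subgroup_mult[OF lie i(1) t2(1)])
    have "frame_act q (\<kappa> q) = frame_act (s (fst q)) (\<theta> q ** \<kappa> q)" using t1(2) frame_act_mult by metis
    also have "\<dots> = s1 (fst q)" using t2(2) i by (simp add: \<kappa>_def matrix_mul_assoc)
    finally have "cls (s1 (fst q)) (f (s1 (fst q))) = cls q (\<rho> (\<kappa> q) (f (s1 (fst q))))"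
      using cls_act[OF q(1) \<kappa>H] by simp
    then show ?thesis using f[OF q(1)] \<sigma>s[OF y] cls_inj[OF q(1)] by metis
  qed
  have m\<kappa>: "mdifferentiable PA HA \<kappa> p"
  proof -
    have pU: "fst p \<in> U" using U by (simp add: x_def)
    have tH: "\<theta> p \<in> H" using \<theta>[OF p pU] by simp
    have s1x: "s1 x \<in> P" "fst (s1 x) \<in> U" using s1P[OF xU1] U by auto
    have inv: "mdifferentiable HA HA matrix_inv (\<theta> p)"
      using lie tH by (intro smooth_map_mdifferentiable[OF atlas_H]) (auto simp: lie_subgroup_def)
    have a: "mdifferentiable PA HA (\<lambda>q. matrix_inv (\<theta> q)) p"
      by (rule mdifferentiable_compose[OF atlas_H atlas_H atlas_P m\<theta>[OF p pU] inv])
    have "mdifferentiable M PA s1 x" by (rule smooth_map_restrict_mdifferentiable[OF atlas_M s1(1) xM xU1])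
    then have "mdifferentiable PA PA (\<lambda>q. s1 (fst q)) p"
      unfolding x_def by (rule mdifferentiable_compose[OF atlas_M atlas_P atlas_P mdifferentiable_projection[OF p]])
    then have b: "mdifferentiable PA HA (\<lambda>q. \<theta> (s1 (fst q))) p"
      by (rule mdifferentiable_compose[OF atlas_P atlas_H atlas_P]) (use m\<theta>[OF s1x] in \<open>simp add: x_def\<close>)
    have c: "mdifferentiable (prod_atlas HA HA) HA (\<lambda>(g, h). g ** h) (matrix_inv (\<theta> p), \<theta> (s1 (fst p)))"
      using lie_subgroup_inverse(1)[OF lie tH] \<theta>[OF s1x] by (intro lie_subgroup_mdifferentiable_mult[OF lie]) (auto simp: x_def)
    show ?thesis
      using mdifferentiable_compose[OF diff_atlas_prod[OF atlas_H atlas_H] atlas_H atlas_P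
          mdifferentiable_Pair[OF atlas_P atlas_H atlas_H a b] c]
      by (simp add: \<kappa>_def[abs_def])
  qed
  obtain c0 where c0: "c0 \<in> PA" "p \<in> fst c0" using p points_PA by (auto simp: points_def)
  have \<kappa>pH: "\<kappa> p \<in> H"
    unfolding \<kappa>_def using \<theta>[OF p] \<theta>[of "s1 (fst p)"] s1P[OF xU1] U lie_subgroup_inverse(1)[OF lie]
    by (intro lie_subgroup_mult[OF lie]) (auto simp: x_def)
  have "mdifferentiable HA (std_atlas UNIV) \<rho> (\<kappa> p)"
    using rep \<kappa>pH points_HA by (intro smooth_map_mdifferentiable[OF atlas_H]) (auto simp: is_representation_def)
  from mdifferentiable_compose[OF atlas_H diff_atlas_std atlas_P m\<kappa> this]
  have m2: "mdifferentiable PA (std_atlas UNIV) (\<lambda>q. \<rho> (\<kappa> q)) p" .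
  have m: "mdifferentiable PA (std_atlas UNIV) (\<lambda>q. \<rho> (\<kappa> q) (f (s1 (fst q)))) p"
  proof -
    obtain D1 D2 where "((\<lambda>z. \<rho> (\<kappa> (chart_inv c0 z))) has_derivative D1) (at (snd c0 p))"
      "((\<lambda>z. f (s1 (fst (chart_inv c0 z)))) has_derivative D2) (at (snd c0 p))"
      using m1 m2 unfolding mdifferentiable_std_iff[OF atlas_P c0] differentiable_def o_def by blast
    from bounded_bilinear.FDERIV[OF bounded_bilinear_blinfun_apply this]
    show ?thesis unfolding mdifferentiable_std_iff[OF atlas_P c0] differentiable_def o_def by blast
  qed
  obtain V where V: "openin (manifold_topology PA) V" "p \<in> V" "\<And>q. q \<in> V \<Longrightarrow> fst q \<in> W \<inter> U"
    using mdifferentiable_preimage_nhd[OF atlas_P atlas_M mdifferentiable_projection[OF p] openin_Int[OF W(1) U(1)]] W(2) U(2)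
    unfolding x_def by blast
  have "V \<subseteq> P" using openin_subset[OF V(1)] topspace_diff_atlas[OF atlas_P] points_PA by simp
  then have "f q = \<rho> (\<kappa> q) (f (s1 (fst q)))" if "q \<in> V" for q using key V(3)[OF that] that by blast
  then show ?thesis unfolding f_def[symmetric] by (rule mdifferentiable_cong[OF atlas_P m V(1,2)])
qed

text \<open>Horizontal vectors have \<phi> = 0, so this removes the connection term for them. That
  \<open>H\<close> is immersed makes \<open>THE\<close> select the zero tangent vector.\<close>

lemma lie_rep_zero: "lie_rep HA \<rho> 0 = 0"
proof -
  note one = lie_subgroup_one[OF lie]
  have oneP: "mat 1 \<in> points HA" using one points_HA by simp
  have inj: "inj_on (differential HA (\<lambda>g. g) (mat 1)) (tangent_space HA (mat 1))"
    and id: "smooth_map HA (std_atlas UNIV) (\<lambda>g. g)"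
    using lie one by (auto simp: lie_subgroup_def)
  have "(THE \<tau>. \<tau> \<in> tangent_space HA (mat 1) \<and> differential HA (\<lambda>g. g) (mat 1) \<tau> = 0) = (\<lambda>c. 0)"
    using differential_zero[OF atlas_H oneP smooth_map_mdifferentiable[OF atlas_H id oneP]] tangent_space_zero[OF atlas_H, of "mat 1"]
    by (intro the_equality) (auto intro: inj_onD[OF inj])
  moreover have "mdifferentiable HA (std_atlas UNIV) \<rho> (mat 1)"
    using rep by (intro smooth_map_mdifferentiable[OF atlas_H _ oneP]) (simp add: is_representation_def)
  ultimately show ?thesis unfolding lie_rep_def by (simp add: differential_zero[OF atlas_H oneP])
qed

text \<open>Whatever vector \<open>lie_rep\<close> differentiates along, and even where \<open>X\<close> is outside the Lie algebra,
  it differentiates the constant map \<open>h \<mapsto> \<rho> h v\<close>.\<close>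

lemma lie_rep_invariant:
  assumes v: "v \<in> invariant_vectors H \<rho>"
  shows "lie_rep HA \<rho> X v = 0"
proof -
  have oneP: "mat 1 \<in> points HA" using lie_subgroup_one[OF lie] points_HA by simp
  let ?c = "chart_at HA (mat 1)"
  have c: "?c \<in> HA" "mat 1 \<in> fst ?c" using chart_at[OF oneP] by auto
  have "mdifferentiable HA (std_atlas UNIV) \<rho> (mat 1)"
    using rep by (intro smooth_map_mdifferentiable[OF atlas_H _ oneP]) (simp add: is_representation_def)
  then obtain D where D: "((\<rho> \<circ> chart_inv ?c) has_derivative D) (at (snd ?c (mat 1)))"
    unfolding mdifferentiable_std_iff[OF atlas_H c] differentiable_def by blast
  have D0: "((\<lambda>z. (\<rho> \<circ> chart_inv ?c) z v) has_derivative (\<lambda>w. D w v)) (at (snd ?c (mat 1)))"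
    by (rule bounded_linear.has_derivative[OF blinfun.bounded_linear_left D])
  have "\<forall>\<^sub>F z in nhds (snd ?c (mat 1)). (\<rho> \<circ> chart_inv ?c) z v = v"
    using eventually_chart_inv[OF atlas_H c(1) openin_points[OF atlas_H] oneP c(2)]
    by eventually_elim (use v points_HA in \<open>auto simp: invariant_vectors_def\<close>)
  then have "((\<lambda>z. (\<rho> \<circ> chart_inv ?c) z v) has_derivative (\<lambda>w. 0)) (at (snd ?c (mat 1)))"
    by (rule has_derivative_eventually_cong[OF has_derivative_const])
  then have "D w v = 0" for w using has_derivative_unique[OF D0] by metis
  then show ?thesis
    by (simp add: lie_rep_def differential_def frechet_derivative_at[OF D, symmetric])
qed

lemma invariant_section_parallel:
  assumes v: "v \<in> invariant_vectors H \<rho>"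
  shows "invariant_section v \<in> parallel_sections M \<phi> PA HA \<rho>"
proof -
  have sf: "section_function P H \<rho> (invariant_section v) p = v" if "p \<in> P" for p
    by (rule section_function_unique[where \<sigma> = "invariant_section v", OF that invariant_section_apply[OF v that]])
  have "cov_differential M \<phi> PA HA \<rho> (section_function P H \<rho> (invariant_section v)) p \<xi> = 0"
    if p: "p \<in> P" for p \<xi>
  proof -
    have pP: "p \<in> points PA" using p points_PA by simp
    let ?c = "chart_at PA p"
    have c: "?c \<in> PA" "p \<in> fst ?c" using chart_at[OF pP] by auto
    have "\<forall>\<^sub>F z in nhds (snd ?c p). (section_function P H \<rho> (invariant_section v) \<circ> chart_inv ?c) z = v"
      using eventually_chart_inv[OF atlas_P c(1) openin_points[OF atlas_P] pP c(2)]
      by eventually_elim (use sf points_PA in auto)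
    then have "((section_function P H \<rho> (invariant_section v) \<circ> chart_inv ?c) has_derivative (\<lambda>w. 0)) (at (snd ?c p))"
      by (rule has_derivative_eventually_cong[OF has_derivative_const])
    from frechet_derivative_at[OF this, symmetric]
    have "differential PA (section_function P H \<rho> (invariant_section v)) p \<xi> = 0"
      by (simp add: differential_def)
    then show ?thesis by (simp add: cov_differential_def sf[OF p] lie_rep_invariant[OF v])
  qed
  then show ?thesis
    using invariant_section_smooth[OF v] by (simp add: parallel_sections_def points_PA points_HA)
qed

text \<open>\<open>f\<close> is differentiable on \<open>P\<close> only, so the chain rule has to
  run through a chart of \<open>PA\<close>, although the velocity is given in the frame
  bundle.\<close>

lemma parallel_along_horizontal_arc:
  assumes \<phi>: "is_connection_form M A \<phi>" and red: "connection_reduces M A PA"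
    and f: "\<And>p. p \<in> P \<Longrightarrow> mdifferentiable PA (std_atlas UNIV) f p"
    and par: "\<And>p \<xi>. p \<in> P \<Longrightarrow> \<xi> \<in> tangent_space PA p \<Longrightarrow> cov_differential M \<phi> PA HA \<rho> f p \<xi> = 0"
    and \<gamma>: "smooth_arc (frame_atlas M) \<gamma> a b" and P: "\<And>t. t \<in> {a..b} \<Longrightarrow> \<gamma> t \<in> P"
    and t: "t \<in> {a..b}" and hor: "velocity (frame_atlas M) \<gamma> {a..b} t \<in> A (\<gamma> t)"
  shows "((\<lambda>t. f (\<gamma> t)) has_vector_derivative 0) (at t within {a..b})"
proof -
  define p where "p = \<gamma> t"
  have p: "p \<in> P" using P[OF t] by (simp add: p_def)
  then have pP: "p \<in> points PA" using points_PA by simp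
  \<comment> \<open>Both \<open>tangent_map\<close> and \<open>differential\<close> compute in this
    chart.\<close>
  define c where "c = chart_at PA p"
  have c: "c \<in> PA" "p \<in> fst c" using chart_at[OF pP] by (auto simp: c_def)
  obtain c' where c': "c' \<in> frame_atlas M" "p \<in> fst c'"
    using P_frame[OF p] points_frame_atlas unfolding points_def by blast
  let ?v = "velocity (frame_atlas M) \<gamma> {a..b} t"
  let ?J = "frechet_derivative (snd c' \<circ> chart_inv c) (at (snd c p))"
  \<comment> \<open>Tangency of the distribution to \<open>P\<close> lifts the velocity to a tangent
    vector of \<open>PA\<close>.\<close>
  have "?v \<in> tangent_map PA (frame_atlas M) (\<lambda>p. p) p ` tangent_space PA p"
    using red hor pP unfolding connection_reduces_def p_def by blast
  then obtain \<xi> where \<xi>: "\<xi> \<in> tangent_space PA p" and v: "?v = tangent_map PA (frame_atlas M) (\<lambda>p. p) p \<xi>"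
    by blast
  have "lie_rep HA \<rho> (\<phi> p ?v) = 0"
    using \<phi> hor P_frame[OF p] lie_rep_zero unfolding is_connection_form_def p_def by simp
  then have df: "differential PA f p \<xi> = 0"
    using par[OF p \<xi>] v by (simp add: cov_differential_def)
  have J\<xi>: "?v c' = ?J (\<xi> c)"
    unfolding v tangent_map_def c_def[symmetric] using c' by (simp add: o_def)
  have lim: "limitin (manifold_topology PA) \<gamma> p (at t within {a..b})"
    unfolding p_def by (rule smooth_arc_limitin[OF \<gamma> P t])
  then have ev: "\<forall>\<^sub>F s in at t within {a..b}. \<gamma> s \<in> fst c"
    and z: "((\<lambda>s. snd c (\<gamma> s)) \<longlongrightarrow> snd c p) (at t within {a..b})"
    using limitin_chart_iff[OF atlas_P c, of \<gamma> "at t within {a..b}"] by auto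
  have inv: "\<forall>\<^sub>F s in at t within {a..b}. chart_inv c (snd c (\<gamma> s)) = \<gamma> s"
    using ev by (rule eventually_mono) (rule diff_atlas_chart_inv[OF atlas_P c(1)])
  have inv_t: "chart_inv c (snd c (\<gamma> t)) = \<gamma> t"
    using diff_atlas_chart_inv[OF atlas_P c] by (simp add: p_def)
  have "((snd c' \<circ> \<gamma>) has_vector_derivative ?J (\<xi> c)) (at t within {a..b})"
    using velocity_has_derivative[OF atlas_F \<gamma> t c'(1)] c'(2) J\<xi> by (simp add: p_def)
  \<comment> \<open>In coordinates the curve is j(z(t)), with j the inclusion and z the curve read
    in \<open>PA\<close>. The identity holds near \<open>t\<close> only, because it needs
    \<open>\<gamma> s\<close> in the domain of \<open>c\<close>; this is where continuity in
    \<open>P\<close> is spent.\<close>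
  then have "((\<lambda>s. (snd c' \<circ> chart_inv c) (snd c (\<gamma> s))) has_vector_derivative ?J (\<xi> c)) (at t within {a..b})"
    unfolding has_vector_derivative_def
    by (rule has_derivative_transform_eventually)
       (use t inv_t in \<open>auto intro: eventually_mono[OF inv]\<close>)
  then have zd: "((\<lambda>s. snd c (\<gamma> s)) has_vector_derivative \<xi> c) (at t within {a..b})"
    using immersed[OF p c c'] z
    by (intro immersion_curve_derivative[of "snd c' \<circ> chart_inv c" ?J "snd c p"])
       (auto simp: frechet_derivative_works c_def p_def)
  have "(f \<circ> chart_inv c) differentiable (at (snd c p))"
    using f[OF p] mdifferentiable_std_iff[OF atlas_P c] by blast
  then have fd: "((f \<circ> chart_inv c) has_derivative frechet_derivative (f \<circ> chart_inv c) (at (snd c p)))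
      (at (snd c (\<gamma> t)) within (\<lambda>s. snd c (\<gamma> s)) ` {a..b})"
    unfolding p_def[symmetric] by (simp add: frechet_derivative_works has_derivative_at_withinI)
  have "(((f \<circ> chart_inv c) \<circ> (\<lambda>s. snd c (\<gamma> s))) has_vector_derivative
      frechet_derivative (f \<circ> chart_inv c) (at (snd c p)) (\<xi> c)) (at t within {a..b})"
    by (rule vector_derivative_diff_chain_within[OF zd fd])
  then have "(((f \<circ> chart_inv c) \<circ> (\<lambda>s. snd c (\<gamma> s))) has_vector_derivative 0) (at t within {a..b})"
    using df by (simp add: differential_def c_def)
  then show ?thesis
    unfolding has_vector_derivative_def
    by (rule has_derivative_transform_eventually)
       (use t inv_t in \<open>auto intro: eventually_mono[OF inv]\<close>)
qed

lemma parallel_along_horizontal_curve: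
  assumes A: "is_connection M A" "is_connection_form M A \<phi>" "connection_reduces M A PA"
    and f: "\<And>p. p \<in> P \<Longrightarrow> mdifferentiable PA (std_atlas UNIV) f p"
    and par: "\<And>p \<xi>. p \<in> P \<Longrightarrow> \<xi> \<in> tangent_space PA p \<Longrightarrow> cov_differential M \<phi> PA HA \<rho> f p \<xi> = 0"
    and \<gamma>: "horizontal_curve M A \<gamma>" and P: "\<And>t. t \<in> {0..1} \<Longrightarrow> \<gamma> t \<in> P"
  shows "f (\<gamma> 1) = f (\<gamma> 0)"
proof -
  obtain k \<tau> where \<tau>: "\<tau> 0 = (0::real)" "\<tau> k = 1"
    and Q: "\<And>i. i < k \<Longrightarrow> \<tau> i < \<tau> (Suc i) \<and> smooth_arc (frame_atlas M) \<gamma> (\<tau> i) (\<tau> (Suc i)) \<and>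
       (\<forall>t\<in>{\<tau> i..\<tau> (Suc i)}. velocity (frame_atlas M) \<gamma> {\<tau> i..\<tau> (Suc i)} t \<in> A (\<gamma> t))"
    using \<gamma> unfolding horizontal_curve_def piecewise_def by blast
  \<comment> \<open>Membership in \<open>P\<close> is given on the unit interval, so all breakpoints
    are first located there.\<close>
  have lo: "i \<le> k \<Longrightarrow> 0 \<le> \<tau> i" for i
  proof (induction i)
    case (Suc i)
    then show ?case using Q[of i] by simp
  qed (simp add: \<tau>)
  have hi: "\<tau> i \<le> 1" if "i \<le> k" for i
    using that
  proof (induction rule: inc_induct)
    case (step i)
    then show ?case using Q[of i] by simp
  qed (simp add: \<tau>)
  have step: "f (\<gamma> (\<tau> (Suc i))) = f (\<gamma> (\<tau> i))" if i: "i < k" for i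
  proof -
    have sub: "\<gamma> t \<in> P" if "t \<in> {\<tau> i..\<tau> (Suc i)}" for t
      using that lo[of i] hi[of "Suc i"] i by (intro P) auto
    have "((\<lambda>t. f (\<gamma> t)) has_vector_derivative 0) (at t within {\<tau> i..\<tau> (Suc i)})"
      if t: "t \<in> {\<tau> i..\<tau> (Suc i)}" for t
      using Q[OF i] t sub by (intro parallel_along_horizontal_arc[OF A(2,3) f par]) auto
    then obtain C where "\<And>t. t \<in> {\<tau> i..\<tau> (Suc i)} \<Longrightarrow> f (\<gamma> t) = C"
      using has_vector_derivative_zero_constant[of "{\<tau> i..\<tau> (Suc i)}" "\<lambda>t. f (\<gamma> t)"] by (metis convex_real_interval(5))
    then show ?thesis using Q[OF i] by simp
  qed
  have "i \<le> k \<Longrightarrow> f (\<gamma> (\<tau> i)) = f (\<gamma> 0)" for i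
    by (induction i) (use \<tau> step in auto)
  from this[of k] show ?thesis using \<tau> by simp
qed

end

theorem proposition4p1p1:
  fixes M :: "('m, real^'n::finite) atlas"
    and A :: "('m, 'n) distribution"
    and \<phi> :: "('m, 'n) frame \<Rightarrow> ('m, 'n) frame_tangent \<Rightarrow> real^'n^'n"
    and u\<^sub>0 :: "('m, 'n) frame"
    and H :: "(real^'n^'n) set" and HA :: "(real^'n^'n, 'h::real_normed_vector) atlas"
    and P :: "('m, 'n) frame set" and PA :: "(('m, 'n) frame, 'p::real_normed_vector) atlas"
    and \<rho> :: "real^'n^'n \<Rightarrow> 'v::real_normed_vector \<Rightarrow>\<^sub>L 'v"
  assumes "smooth_manifold M" and "connected_space (manifold_topology M)"
    and "is_connection M A" and "is_connection_form M A \<phi>"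
    and "u\<^sub>0 \<in> frame_bundle M"
    and "H = Hol M A u\<^sub>0" and "lie_subgroup H HA"
    and "P = holonomy_bundle M A u\<^sub>0" and "principal_subbundle M P PA H HA"
    and "connection_reduces M A PA"
    and "\<exists>B::'v set. finite B \<and> span B = UNIV"
    and "is_representation HA \<rho>"
  shows "\<exists>\<Phi>. bij_betw \<Phi> (invariant_vectors H \<rho>) (parallel_sections M \<phi> PA HA \<rho>) \<and>
           (\<forall>v\<in>invariant_vectors H \<rho>. \<forall>p\<in>P. \<Phi> v (fst p) = assoc_class P H \<rho> p v)"
proof -
  interpret frame_subbundle_rep M H HA P PA \<rho>
    by unfold_locales (use assms in auto)
  \<comment> \<open>\<open>u\<^sub>0\<close> belongs to \<open>P\<close> through an actual
    horizontal curve from \<open>u\<^sub>0\<close> back to itself; the one witnessing that the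
    identity is in the holonomy group serves.\<close>
  have "mat 1 \<in> Hol M A u\<^sub>0" using lie_subgroup_one[OF lie] assms(6) by simp
  then have u0: "u\<^sub>0 \<in> P"
    using assms(5) frame_act_one[of "u\<^sub>0"] unfolding Hol_def assms(8) holonomy_bundle_def by fastforce
  \<comment> \<open>Each later point of the curve is the end point of a truncated horizontal curve.
    At time 0, where truncation degenerates, \<open>u0\<close> takes over.\<close>
  have stay: "\<gamma> t \<in> P" if "horizontal_curve M A \<gamma>" "\<gamma> 0 = u\<^sub>0" "t \<in> {0..1}" for \<gamma> t
  proof (cases "t = 0")
    case False
    then have "0 < t" "t \<le> 1" using that by auto
    from horizontal_curve_truncate[OF assms(1,3) that(1) this] show ?thesis
      using that(2) unfolding assms(8) holonomy_bundle_def by (auto intro!: exI[of _ "\<lambda>s. \<gamma> (t * s)"])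
  qed (use u0 that in simp)
  have "bij_betw invariant_section (invariant_vectors H \<rho>) (parallel_sections M \<phi> PA HA \<rho>)"
    unfolding bij_betw_def
  proof (intro conjI equalityI subsetI inj_onI)
    fix v w assume "v \<in> invariant_vectors H \<rho>" "w \<in> invariant_vectors H \<rho>"
      "invariant_section v = invariant_section w"
    then show "v = w" using invariant_section_apply[OF _ u0] cls_inj[OF u0] by metis
  next
    fix \<sigma> assume "\<sigma> \<in> invariant_section ` invariant_vectors H \<rho>"
    then show "\<sigma> \<in> parallel_sections M \<phi> PA HA \<rho>" using invariant_section_parallel by blast
  next
    fix \<sigma> assume \<sigma>: "\<sigma> \<in> parallel_sections M \<phi> PA HA \<rho>"
    define f where "f = section_function P H \<rho> \<sigma>"
    have sm: "\<sigma> \<in> smooth_sections M PA H \<rho>"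
      and par: "\<And>p \<xi>. p \<in> P \<Longrightarrow> \<xi> \<in> tangent_space PA p \<Longrightarrow> cov_differential M \<phi> PA HA \<rho> f p \<xi> = 0"
      using \<sigma> by (auto simp: parallel_sections_def points_PA points_HA f_def)
    have f: "\<sigma> (fst p) = cls p (f p)" if "p \<in> P" for p
      unfolding f_def using sm P_base[OF that] that
      by (intro section_function_eq) (auto simp: smooth_sections_def points_PA)
    have m: "mdifferentiable PA (std_atlas UNIV) f p" if "p \<in> P" for p
      unfolding f_def by (rule mdifferentiable_section_function[OF sm that])
    define v where "v = f u\<^sub>0"
    have const: "f p = v" if p: "p \<in> P" for p
    proof -
      obtain \<gamma> where \<gamma>: "horizontal_curve M A \<gamma>" "\<gamma> 0 = u\<^sub>0" "\<gamma> 1 = p"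
        using p unfolding assms(8) holonomy_bundle_def by blast
      show ?thesis
        using parallel_along_horizontal_curve[OF assms(3,4,10) m par \<gamma>(1) stay[OF \<gamma>(1,2)]] \<gamma>
        by (simp add: v_def)
    qed
    have inv: "v \<in> invariant_vectors H \<rho>"
      unfolding invariant_vectors_def
    proof (intro CollectI ballI)
      fix h assume h: "h \<in> H"
      \<comment> \<open>Since \<open>f\<close> is constant on \<open>P\<close>, the value of
        \<sigma> over this base point is represented both by v at \<open>u\<^sub>0\<close> and by v
        at the translate of \<open>u\<^sub>0\<close> by \<open>h\<close>.\<close>
      have "cls u\<^sub>0 v = cls (frame_act u\<^sub>0 h) v"
        using f[OF u0] f[OF P_act[OF u0 h]] const[OF u0] const[OF P_act[OF u0 h]] by simp
      then show "\<rho> h v = v" using cls_act[OF u0 h] cls_inj[OF u0] by metis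
    qed
    have "\<sigma> = invariant_section v"
    proof (rule extensionalityI[of _ "points M"])
      show "\<sigma> \<in> extensional (points M)" using sm by (simp add: smooth_sections_def)
      show "invariant_section v \<in> extensional (points M)" by (simp add: invariant_section_def)
      fix x assume "x \<in> points M"
      then obtain p where "p \<in> P" "fst p = x" by (rule P_over)
      then show "\<sigma> x = invariant_section v x"
        using f const invariant_section_apply[OF inv] by metis
    qed
    then show "\<sigma> \<in> invariant_section ` invariant_vectors H \<rho>" using inv by blast
  qed
  then show ?thesis using invariant_section_apply by blast
qed

end
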